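(* Let $\psi$ be a $(k,r)$-map of the cohomogeneity one manifold $M$, i.e. $\psi(g\cdot\gamma(t))=g\cdot\gamma(r(t))$, and let $\tau$ be its tension field. Then the component of $\tau$ tangential to the orbits is given by $$\tau^{\mathrm{tan}}_{|\gamma(t)} = -\sum_{\mu,\nu=1}^n \langle [E_{\mu},F_{\nu}]^{\ast},E_{\mu}^{\ast}\rangle_{|\gamma(r(t))}\, F^{\ast}_{\nu|\gamma(r(t))}$$ for $0<t<L$. Here $E_1,\ldots,E_n\in\mathfrak n$ and $F_1,\ldots,F_n\in\mathfrak n$ are such that $E^{\ast}_{1|\gamma(t)},\ldots,E^{\ast}_{n|\gamma(t)}$ form an orthonormal basis of $T_{\gamma(t)}(G\cdot\gamma(t))$ and $F^{\ast}_{1|\gamma(r(t))},\ldots,F^{\ast}_{n|\gamma(r(t))}$ form an orthonormal basis of $T_{\gamma(r(t))}(G\cdot\gamma(r(t)))$.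
   Context: Setting: $M$ is a compact Riemannian manifold with an isometric action of a compact Lie group $G$ such that $M/G$ is isometric to a closed interval $[0,L]$; the endpoints correspond to non-principal orbits and interior points to principal orbits. $\gamma:\mathbb R\to M$ is a fixed unit-speed normal geodesic, i.e. a geodesic meeting all orbits perpendicularly, with $\gamma(0)$ and $\gamma(L)$ in the non-principal orbits corresponding to $0$ and $L$. The Weyl group $W$ (elements of $G$ leaving $\gamma$ invariant modulo elements fixing it pointwise) is assumed finite. The integer $k$ is of the form $k=j|W|/2+1$ with $j$ an even integer (any integer $j$ is allowed if the isotropy group $G_{\gamma(L)}$ is contained in $G_{\gamma((|W|/2+1)L)}$). A $(k,r)$-map of $M$ is the map $g\cdot\gamma(t)\mapsto g\cdot\gamma(r(t))$ ($g\in G$, $0\le t\le L$), where $r:[0,L]\to\mathbb R$ is smooth with $r(0)=0$ and $r(L)=kL$. The isotropy groups $G_{\gamma(t)}$, $t\notin L\mathbb Z$, are all equal to one group $H$ (principal isotropy group) with Lie algebra $\mathfrak h$. $Q$ is a fixed biinvariant metric on $G$ and $\mathfrak n$ is the $Q$-orthogonal complement of $\mathfrak h$ in the Lie algebra $\mathfrak g$ of $G$; $n=\dim\mathfrak n=\dim M-1$. For $X\in\mathfrak g$ the action field $X^{\ast}$ is $X^{\ast}_{|p}=\frac{d}{ds}(\exp sX\cdot p)_{|s=0}$. The tension field is $\tau=\mathrm{trace}\,\nabla d\psi$, and $\tau^{\mathrm{tan}}_{|\gamma(t)}$ is the component of $\tau_{|\gamma(t)}\in T_{\gamma(r(t))}M$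 tangential to the orbit $G\cdot\gamma(r(t))$. *)

theory Defs
  imports "HOL-Analysis.Analysis" "HOL-Algebra.Group_Action"
begin

section \<open>Smooth maps and smooth manifolds\<close>

text \<open>The set \<open>S\<close> is always open where \<open>smooth_on\<close> is used, and the domain is finite-dimensional,
  so that continuity of all iterated directional derivatives is smoothness in the usual sense.\<close>

primrec Ck_on :: "nat \<Rightarrow> 'a::real_normed_vector set \<Rightarrow> ('a \<Rightarrow> 'b::real_normed_vector) \<Rightarrow> bool" where
  "Ck_on 0 S f \<longleftrightarrow> continuous_on S f"
| "Ck_on (Suc k) S f \<longleftrightarrow> (\<forall>x\<in>S. f differentiable (at x)) \<and>
     (\<forall>v. Ck_on k S (\<lambda>x. frechet_derivative f (at x) v))"

definition smooth_on :: "'a::real_normed_vector set \<Rightarrow> ('a \<Rightarrow> 'b::real_normed_vector) \<Rightarrow> bool" where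
  "smooth_on S f \<longleftrightarrow> (\<forall>k. Ck_on k S f)"

text \<open>A manifold structure on the type \<open>'m\<close>, modelled on \<open>'e\<close>, assigns to every point a preferred
  chart around it; the smooth structure is the one generated by these charts. The tangent space
  at \<open>p\<close> is identified with \<open>'e\<close> by means of the preferred chart at \<open>p\<close>. In this way tangent
  vectors at any point are elements of \<open>'e\<close>, and all tangent maps, metrics, etc. are
  expressed in preferred charts. The model space is only required to be a finite-dimensional Banach
  space, which (unlike class \<open>euclidean_space\<close>) does not exclude dimension \<open>0\<close>, i.e. finite Lie
  groups.\<close>

type_synonym ('m, 'e) charts = "'m \<Rightarrow> 'm set \<times> ('m \<Rightarrow> 'e)"

definition chart_dom :: "('m, 'e) charts \<Rightarrow> 'm \<Rightarrow> 'm set" where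
  "chart_dom C p = fst (C p)"

definition chart_map :: "('m, 'e) charts \<Rightarrow> 'm \<Rightarrow> 'm \<Rightarrow> 'e" where
  "chart_map C p = snd (C p)"

definition chart_inv :: "('m, 'e) charts \<Rightarrow> 'm \<Rightarrow> 'e \<Rightarrow> 'm" where
  "chart_inv C p = inv_into (chart_dom C p) (chart_map C p)"

definition smooth_manifold :: "('m::t2_space, 'e::banach) charts \<Rightarrow> bool" where
  "smooth_manifold C \<longleftrightarrow>
     (\<exists>B::'e set. finite B \<and> span B = UNIV) \<and>
     (\<forall>p. open (chart_dom C p) \<and> p \<in> chart_dom C p \<and> open (chart_map C p ` chart_dom C p) \<and>
          homeomorphism (chart_dom C p) (chart_map C p ` chart_dom C p)
            (chart_map C p) (chart_inv C p)) \<and>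
     (\<forall>p q. smooth_on (chart_map C p ` (chart_dom C p \<inter> chart_dom C q))
              (chart_map C q \<circ> chart_inv C p))"

definition smooth_map ::
  "('m::topological_space, 'e::real_normed_vector) charts \<Rightarrow>
   ('n::topological_space, 'f::real_normed_vector) charts \<Rightarrow> ('m \<Rightarrow> 'n) \<Rightarrow> bool" where
  "smooth_map C D f \<longleftrightarrow> continuous_on UNIV f \<and>
     (\<forall>p q. smooth_on (chart_map C p ` (chart_dom C p \<inter> f -` chart_dom D q))
              (chart_map D q \<circ> f \<circ> chart_inv C p))"

definition vector_space_charts :: "('e, 'e) charts" where
  "vector_space_charts = (\<lambda>_. (UNIV, id))"

definition prod_charts :: "('m, 'e) charts \<Rightarrow> ('n, 'f) charts \<Rightarrow> ('m \<times> 'n, 'e \<times> 'f) charts" where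
  "prod_charts C D = (\<lambda>(p, q). (chart_dom C p \<times> chart_dom D q,
                                 map_prod (chart_map C p) (chart_map D q)))"

definition tangent_map ::
  "('m, 'e::real_normed_vector) charts \<Rightarrow> ('n, 'f::real_normed_vector) charts \<Rightarrow>
   ('m \<Rightarrow> 'n) \<Rightarrow> 'm \<Rightarrow> 'e \<Rightarrow> 'f" where
  "tangent_map C D f p =
     frechet_derivative (chart_map D (f p) \<circ> f \<circ> chart_inv C p) (at (chart_map C p p))"

definition velocity :: "('m, 'e::real_normed_vector) charts \<Rightarrow> (real \<Rightarrow> 'm) \<Rightarrow> real \<Rightarrow> 'e" where
  "velocity C c t = vector_derivative (chart_map C (c t) \<circ> c) (at t)"

text \<open>A vector field assigns to \<open>q\<close> a vector with respect to the preferred chart at \<open>q\<close>;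
  \<open>vf_in_chart C p V\<close> is its representation in the single chart at \<open>p\<close>.\<close>

definition vf_in_chart ::
  "('m, 'e::real_normed_vector) charts \<Rightarrow> 'm \<Rightarrow> ('m \<Rightarrow> 'e) \<Rightarrow> 'e \<Rightarrow> 'e" where
  "vf_in_chart C p V y = (let q = chart_inv C p y in
     frechet_derivative (chart_map C p \<circ> chart_inv C q) (at (chart_map C q q)) (V q))"

text \<open>The bracket with \<open>[V, W] f = V (W f) - W (V f)\<close>, in coordinates.\<close>

definition vf_bracket ::
  "('m, 'e::real_normed_vector) charts \<Rightarrow> ('m \<Rightarrow> 'e) \<Rightarrow> ('m \<Rightarrow> 'e) \<Rightarrow> 'm \<Rightarrow> 'e" where
  "vf_bracket C V W p = (let x = chart_map C p p in
     frechet_derivative (vf_in_chart C p W) (at x) (vf_in_chart C p V x)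
     - frechet_derivative (vf_in_chart C p V) (at x) (vf_in_chart C p W x))"


section \<open>Riemannian metrics\<close>

definition chart_metric ::
  "('m, 'e::real_normed_vector) charts \<Rightarrow> ('m \<Rightarrow> 'e \<Rightarrow> 'e \<Rightarrow> real) \<Rightarrow> 'm \<Rightarrow> 'e \<Rightarrow> 'e \<Rightarrow> 'e \<Rightarrow> real" where
  "chart_metric C g p y v w = (let q = chart_inv C p y;
       T = frechet_derivative (chart_map C q \<circ> chart_inv C p) (at y)
     in g q (T v) (T w))"

definition riemannian_metric ::
  "('m, 'e::real_normed_vector) charts \<Rightarrow> ('m \<Rightarrow> 'e \<Rightarrow> 'e \<Rightarrow> real) \<Rightarrow> bool" where
  "riemannian_metric C g \<longleftrightarrow>
     (\<forall>p. bilinear (g p) \<and> (\<forall>v w. g p v w = g p w v) \<and> (\<forall>v. v \<noteq> 0 \<longrightarrow> g p v v > 0)) \<and>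
     (\<forall>p v w. smooth_on (chart_map C p ` chart_dom C p) (\<lambda>y. chart_metric C g p y v w))"

definition is_isometry ::
  "('m::topological_space, 'e::real_normed_vector) charts \<Rightarrow> ('m \<Rightarrow> 'e \<Rightarrow> 'e \<Rightarrow> real) \<Rightarrow> ('m \<Rightarrow> 'm) \<Rightarrow> bool" where
  "is_isometry C g f \<longleftrightarrow> bij f \<and> smooth_map C C f \<and>
     (\<forall>p v w. g (f p) (tangent_map C C f p v) (tangent_map C C f p w) = g p v w)"

definition curve_length ::
  "('m, 'e::real_normed_vector) charts \<Rightarrow> ('m \<Rightarrow> 'e \<Rightarrow> 'e \<Rightarrow> real) \<Rightarrow> (real \<Rightarrow> 'm) \<Rightarrow> real" where
  "curve_length C g c =
     integral {0..1} (\<lambda>t. sqrt (g (c t) (velocity C c t) (velocity C c t)))"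

text \<open>Smooth, not necessarily regular, curves suffice: a piecewise smooth curve can be
  reparametrized without changing its length such that all derivatives vanish at the break points
  and at the end points. The distance of points in different components is \<open>\<infinity>\<close>.\<close>

definition riemannian_dist ::
  "('m::topological_space, 'e::real_normed_vector) charts \<Rightarrow> ('m \<Rightarrow> 'e \<Rightarrow> 'e \<Rightarrow> real) \<Rightarrow> 'm \<Rightarrow> 'm \<Rightarrow> ereal" where
  "riemannian_dist C g p q =
     (INF c\<in>{c. smooth_map vector_space_charts C c \<and> c 0 = p \<and> c 1 = q}. ereal (curve_length C g c))"

text \<open>The Christoffel symbols of the Levi-Civita connection, at the point \<open>p\<close> and with respect to the
  chart at \<open>p\<close>, as a bilinear map: \<open>christoffel C g p v w\<close> is \<open>\<nabla>\<^sub>v w\<close> for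
  coordinate fields \<open>v\<close>, \<open>w\<close> (Koszul formula).\<close>

definition christoffel ::
  "('m, 'e::real_normed_vector) charts \<Rightarrow> ('m \<Rightarrow> 'e \<Rightarrow> 'e \<Rightarrow> real) \<Rightarrow> 'm \<Rightarrow> 'e \<Rightarrow> 'e \<Rightarrow> 'e" where
  "christoffel C g p v w = (let x = chart_map C p p;
       D = (\<lambda>a b c. frechet_derivative (\<lambda>y. chart_metric C g p y b c) (at x) a)
     in THE z. \<forall>u. g p z u = (D v w u + D w v u - D u v w) / 2)"

definition is_geodesic ::
  "('m::topological_space, 'e::real_normed_vector) charts \<Rightarrow> ('m \<Rightarrow> 'e \<Rightarrow> 'e \<Rightarrow> real) \<Rightarrow> (real \<Rightarrow> 'm) \<Rightarrow> bool" where
  "is_geodesic C g c \<longleftrightarrow> smooth_map vector_space_charts C c \<and>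
     (\<forall>t. let x = chart_map C (c t) \<circ> c in
        vector_derivative (\<lambda>s. vector_derivative x (at s)) (at t)
        + christoffel C g (c t) (velocity C c t) (velocity C c t) = 0)"

definition orthonormal_basis ::
  "('e::real_vector \<Rightarrow> 'e \<Rightarrow> real) \<Rightarrow> 'e set \<Rightarrow> nat \<Rightarrow> (nat \<Rightarrow> 'e) \<Rightarrow> bool" where
  "orthonormal_basis \<beta> V n b \<longleftrightarrow>
     (\<forall>i\<in>{1..n}. \<forall>j\<in>{1..n}. \<beta> (b i) (b j) = (if i = j then 1 else 0)) \<and> span (b ` {1..n}) = V"

text \<open>The bilinear form \<open>\<nabla>df\<close> at \<open>p\<close>, that is
  \<open>(v, w) \<mapsto> \<nabla>\<^sub>v(df w) - df(\<nabla>\<^sub>v w)\<close> with the connection induced on \<open>f\<^sup>*TN\<close>, in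
  local coordinates; \<open>w\<close> is extended as a coordinate field.\<close>

definition nabla_d ::
  "('m, 'e::real_normed_vector) charts \<Rightarrow> ('m \<Rightarrow> 'e \<Rightarrow> 'e \<Rightarrow> real) \<Rightarrow>
   ('n, 'f::real_normed_vector) charts \<Rightarrow> ('n \<Rightarrow> 'f \<Rightarrow> 'f \<Rightarrow> real) \<Rightarrow>
   ('m \<Rightarrow> 'n) \<Rightarrow> 'm \<Rightarrow> 'e \<Rightarrow> 'e \<Rightarrow> 'f" where
  "nabla_d C g D h f p v w = (let x = chart_map C p p;
       DF = (\<lambda>y. frechet_derivative (chart_map D (f p) \<circ> f \<circ> chart_inv C p) (at y))
     in frechet_derivative (\<lambda>y. DF y w) (at x) v
        + christoffel D h (f p) (DF x v) (DF x w)
        - DF x (christoffel C g p v w))"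

definition tension_field ::
  "('m, 'e::euclidean_space) charts \<Rightarrow> ('m \<Rightarrow> 'e \<Rightarrow> 'e \<Rightarrow> real) \<Rightarrow>
   ('n, 'f::real_normed_vector) charts \<Rightarrow> ('n \<Rightarrow> 'f \<Rightarrow> 'f \<Rightarrow> real) \<Rightarrow>
   ('m \<Rightarrow> 'n) \<Rightarrow> 'm \<Rightarrow> 'f" where
  "tension_field C g D h f p =
     (let b = (SOME b. orthonormal_basis (g p) UNIV DIM('e) b)
      in \<Sum>i=1..DIM('e). nabla_d C g D h f p (b i) (b i))"


section \<open>Lie groups\<close>

definition lie_group :: "'g monoid \<Rightarrow> ('g::t2_space, 'h::banach) charts \<Rightarrow> bool" where
  "lie_group G CG \<longleftrightarrow> group G \<and> carrier G = UNIV \<and> smooth_manifold CG \<and>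
     smooth_map (prod_charts CG CG) CG (\<lambda>(a, b). a \<otimes>\<^bsub>G\<^esub> b) \<and>
     smooth_map CG CG (\<lambda>a. inv\<^bsub>G\<^esub> a)"

text \<open>The Lie algebra is the tangent space at \<open>\<one>\<close>, that is the whole type \<open>'h\<close>.\<close>

definition left_invariant_field ::
  "'g monoid \<Rightarrow> ('g, 'h::real_normed_vector) charts \<Rightarrow> 'h \<Rightarrow> 'g \<Rightarrow> 'h" where
  "left_invariant_field G CG X a = tangent_map CG CG (\<lambda>b. a \<otimes>\<^bsub>G\<^esub> b) \<one>\<^bsub>G\<^esub> X"

definition lie_bracket ::
  "'g monoid \<Rightarrow> ('g, 'h::real_normed_vector) charts \<Rightarrow> 'h \<Rightarrow> 'h \<Rightarrow> 'h" where
  "lie_bracket G CG X Y =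
     vf_bracket CG (left_invariant_field G CG X) (left_invariant_field G CG Y) \<one>\<^bsub>G\<^esub>"

definition one_parameter_subgroup ::
  "'g monoid \<Rightarrow> ('g::topological_space, 'h::real_normed_vector) charts \<Rightarrow> 'h \<Rightarrow> (real \<Rightarrow> 'g) \<Rightarrow> bool" where
  "one_parameter_subgroup G CG X c \<longleftrightarrow> smooth_map vector_space_charts CG c \<and>
     (\<forall>s t. c (s + t) = c s \<otimes>\<^bsub>G\<^esub> c t) \<and> c 0 = \<one>\<^bsub>G\<^esub> \<and> velocity CG c 0 = X"

definition lie_exp ::
  "'g monoid \<Rightarrow> ('g::topological_space, 'h::real_normed_vector) charts \<Rightarrow> 'h \<Rightarrow> 'g" where
  "lie_exp G CG X = (THE c. one_parameter_subgroup G CG X c) 1"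

definition lie_algebra_of ::
  "'g monoid \<Rightarrow> ('g::topological_space, 'h::real_normed_vector) charts \<Rightarrow> 'g set \<Rightarrow> 'h set" where
  "lie_algebra_of G CG H = {X. \<forall>s::real. lie_exp G CG (s *\<^sub>R X) \<in> H}"

definition biinvariant_metric ::
  "'g monoid \<Rightarrow> ('g::topological_space, 'h::real_normed_vector) charts \<Rightarrow> ('g \<Rightarrow> 'h \<Rightarrow> 'h \<Rightarrow> real) \<Rightarrow> bool" where
  "biinvariant_metric G CG Q \<longleftrightarrow> riemannian_metric CG Q \<and>
     (\<forall>a\<in>carrier G. is_isometry CG Q (\<lambda>b. a \<otimes>\<^bsub>G\<^esub> b) \<and> is_isometry CG Q (\<lambda>b. b \<otimes>\<^bsub>G\<^esub> a))"

definition orth_complement :: "('h \<Rightarrow> 'h \<Rightarrow> real) \<Rightarrow> 'h set \<Rightarrow> 'h set" where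
  "orth_complement \<beta> V = {X. \<forall>Y\<in>V. \<beta> X Y = 0}"


section \<open>Isometric actions of cohomogeneity one\<close>

definition isometric_action ::
  "'g monoid \<Rightarrow> ('g::t2_space, 'h::banach) charts \<Rightarrow>
   ('m::t2_space, 'e::banach) charts \<Rightarrow> ('m \<Rightarrow> 'e \<Rightarrow> 'e \<Rightarrow> real) \<Rightarrow> ('g \<Rightarrow> 'm \<Rightarrow> 'm) \<Rightarrow> bool" where
  "isometric_action G CG CM g act \<longleftrightarrow> group_action G UNIV act \<and>
     smooth_map (prod_charts CG CM) CM (\<lambda>(a, p). act a p) \<and>
     (\<forall>a\<in>carrier G. is_isometry CM g (act a))"

definition action_field ::
  "'g monoid \<Rightarrow> ('g::topological_space, 'h::real_normed_vector) charts \<Rightarrow>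
   ('m, 'e::real_normed_vector) charts \<Rightarrow> ('g \<Rightarrow> 'm \<Rightarrow> 'm) \<Rightarrow> 'h \<Rightarrow> 'm \<Rightarrow> 'e" where
  "action_field G CG CM act X p = velocity CM (\<lambda>s. act (lie_exp G CG (s *\<^sub>R X)) p) 0"

text \<open>The tangent space at \<open>p\<close> of the orbit of \<open>p\<close>, as the image of the Lie algebra under
  the differential at \<open>\<one>\<close> of the orbit map.\<close>

definition orbit_tangent_space ::
  "'g monoid \<Rightarrow> ('g::topological_space, 'h::real_normed_vector) charts \<Rightarrow>
   ('m, 'e::real_normed_vector) charts \<Rightarrow> ('g \<Rightarrow> 'm \<Rightarrow> 'm) \<Rightarrow> 'm \<Rightarrow> 'e set" where
  "orbit_tangent_space G CG CM act p = range (\<lambda>X. action_field G CG CM act X p)"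

definition orbit_tangential_part ::
  "'g monoid \<Rightarrow> ('g::topological_space, 'h::real_normed_vector) charts \<Rightarrow>
   ('m, 'e::real_normed_vector) charts \<Rightarrow> ('m \<Rightarrow> 'e \<Rightarrow> 'e \<Rightarrow> real) \<Rightarrow>
   ('g \<Rightarrow> 'm \<Rightarrow> 'm) \<Rightarrow> 'm \<Rightarrow> 'e \<Rightarrow> 'e" where
  "orbit_tangential_part G CG CM g act p w =
     (THE u. u \<in> orbit_tangent_space G CG CM act p \<and>
             (\<forall>v\<in>orbit_tangent_space G CG CM act p. g p (w - u) v = 0))"

text \<open>The orbit of \<open>p\<close> is principal if it has maximal orbit type: every isotropy group contains a
  conjugate of the isotropy group of \<open>p\<close>; these conjugates are the isotropy groups of the points
  \<open>act a p\<close>.\<close>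

definition principal_point :: "'g monoid \<Rightarrow> ('g \<Rightarrow> 'm \<Rightarrow> 'm) \<Rightarrow> 'm \<Rightarrow> bool" where
  "principal_point G act p \<longleftrightarrow>
     (\<forall>q. \<exists>a\<in>carrier G. stabilizer G act (act a p) \<subseteq> stabilizer G act q)"

definition orbit_dist ::
  "('m::topological_space, 'e::real_normed_vector) charts \<Rightarrow> ('m \<Rightarrow> 'e \<Rightarrow> 'e \<Rightarrow> real) \<Rightarrow>
   'm set \<Rightarrow> 'm set \<Rightarrow> ereal" where
  "orbit_dist CM g A B = (INF p\<in>A. INF q\<in>B. riemannian_dist CM g p q)"

text \<open>\<open>\<iota>\<close> is an isometry from the orbit space \<open>M/G\<close> onto \<open>[0, L]\<close> under which precisely the
  interior points correspond to principal orbits.\<close>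

definition orbit_space_isometry ::
  "'g monoid \<Rightarrow> ('m::topological_space, 'e::real_normed_vector) charts \<Rightarrow>
   ('m \<Rightarrow> 'e \<Rightarrow> 'e \<Rightarrow> real) \<Rightarrow> ('g \<Rightarrow> 'm \<Rightarrow> 'm) \<Rightarrow> real \<Rightarrow> ('m set \<Rightarrow> real) \<Rightarrow> bool" where
  "orbit_space_isometry G CM g act L \<iota> \<longleftrightarrow>
     bij_betw \<iota> (orbits G UNIV act) {0..L} \<and>
     (\<forall>A\<in>orbits G UNIV act. \<forall>B\<in>orbits G UNIV act. orbit_dist CM g A B = ereal \<bar>\<iota> A - \<iota> B\<bar>) \<and>
     (\<forall>p. principal_point G act p \<longleftrightarrow> \<iota> (orbit G act p) \<in> {0<..<L})"

definition normal_geodesic ::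
  "'g monoid \<Rightarrow> ('g::topological_space, 'h::real_normed_vector) charts \<Rightarrow>
   ('m::topological_space, 'e::real_normed_vector) charts \<Rightarrow> ('m \<Rightarrow> 'e \<Rightarrow> 'e \<Rightarrow> real) \<Rightarrow>
   ('g \<Rightarrow> 'm \<Rightarrow> 'm) \<Rightarrow> (real \<Rightarrow> 'm) \<Rightarrow> bool" where
  "normal_geodesic G CG CM g act \<gamma> \<longleftrightarrow> is_geodesic CM g \<gamma> \<and>
     (\<forall>t. g (\<gamma> t) (velocity CM \<gamma> t) (velocity CM \<gamma> t) = 1) \<and>
     (\<forall>A\<in>orbits G UNIV act. \<exists>t. \<gamma> t \<in> A) \<and>
     (\<forall>t. \<forall>v\<in>orbit_tangent_space G CG CM act (\<gamma> t). g (\<gamma> t) (velocity CM \<gamma> t) v = 0)"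

definition weyl_group :: "'g monoid \<Rightarrow> ('g \<Rightarrow> 'm \<Rightarrow> 'm) \<Rightarrow> (real \<Rightarrow> 'm) \<Rightarrow> 'g set monoid" where
  "weyl_group G act \<gamma> =
     G\<lparr>carrier := {a \<in> carrier G. act a ` range \<gamma> = range \<gamma>}\<rparr>
     Mod {a \<in> carrier G. \<forall>t. act a (\<gamma> t) = \<gamma> t}"

definition admissible_degree ::
  "'g monoid \<Rightarrow> ('g \<Rightarrow> 'm \<Rightarrow> 'm) \<Rightarrow> (real \<Rightarrow> 'm) \<Rightarrow> real \<Rightarrow> int \<Rightarrow> bool" where
  "admissible_degree G act \<gamma> L k \<longleftrightarrow> (let w = real (order (weyl_group G act \<gamma>)) in
     \<exists>j::int. real_of_int k = of_int j * w / 2 + 1 \<and>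
       (even j \<or> stabilizer G act (\<gamma> L) \<subseteq> stabilizer G act (\<gamma> ((w / 2 + 1) * L))))"

text \<open>Smoothness of \<open>r\<close> on the closed interval means that \<open>r\<close> extends smoothly to the real line;
  the values of \<open>r\<close> outside the interval are irrelevant.\<close>

definition kr_map ::
  "'g monoid \<Rightarrow> ('g \<Rightarrow> 'm \<Rightarrow> 'm) \<Rightarrow> (real \<Rightarrow> 'm) \<Rightarrow> real \<Rightarrow> int \<Rightarrow> (real \<Rightarrow> real) \<Rightarrow> ('m \<Rightarrow> 'm) \<Rightarrow> bool" where
  "kr_map G act \<gamma> L k r \<psi> \<longleftrightarrow>
     (\<exists>r'. smooth_on UNIV r' \<and> (\<forall>t\<in>{0..L}. r' t = r t)) \<and> r 0 = 0 \<and> r L = of_int k * L \<and>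
     (\<forall>a\<in>carrier G. \<forall>t\<in>{0..L}. \<psi> (act a (\<gamma> t)) = act a (\<gamma> (r t)))"

end

theory Submission
  imports Defs
begin

text \<open>
  Let \<open>p = \<gamma>(t)\<close> and \<open>q = \<gamma>(r(t))\<close>. The vectors \<open>\<gamma>'(t)\<close> and \<open>E\<^sub>\<mu>\<^sup>*\<close> form an orthonormal basis at \<open>p\<close>. The tension
  field is the sum of the terms \<open>\<nabla>d\<psi>(v, v)\<close> over this basis, and each of them is the acceleration of \<open>\<psi> \<circ> a\<close> minus the image under
  \<open>d\<psi>\<close> of the acceleration of \<open>a\<close>, for any curve \<open>a\<close> with velocity \<open>v\<close>. For \<open>a = \<gamma>\<close> this is a multiple of
  \<open>\<gamma>'(r(t))\<close>. For \<open>a(s) = exp(s E\<^sub>\<mu>) \<cdot> p\<close> equivariance gives \<open>\<psi>(a(s)) = exp(s E\<^sub>\<mu>) \<cdot> q\<close>, so that both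
  accelerations are of the form \<open>\<nabla>\<^sub>X\<^sub>*X\<^sup>*\<close>. The Killing equation together with \<open>[X\<^sup>*, Z\<^sup>*] = - [X, Z]\<^sup>*\<close> yields
  \<open>\<langle>\<nabla>\<^sub>X\<^sub>*X\<^sup>*, Z\<^sup>*\<rangle> = - \<langle>[X, Z]\<^sup>*, X\<^sup>*\<rangle>\<close>. At \<open>q\<close> this is the asserted formula. At \<open>p\<close> the sum over \<open>\<mu>\<close> is the trace
  of \<open>X \<mapsto> [X, Z]\<close> on \<open>\<nn>\<close>, which vanishes since \<open>Q\<close> is biinvariant. Hence the sum of the accelerations at \<open>p\<close> is
  a multiple of \<open>\<gamma>'(t)\<close> and does not contribute to the tangential part.
\<close>

section \<open>Finite-dimensional normed spaces\<close>

text \<open>\<open>kr_map\<close> prescribes \<open>\<psi>\<close> only through its values on orbit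
  points, so its differentiability at \<open>\<gamma> t\<close> has to be derived. There
  \<open>\<psi>\<close> is a smooth map composed with the inverse of v \<mapsto> a(v)
  \<gamma>(s(v)). The inverse function theorem supplies a once differentiable inverse; its second
  derivative is extracted by hand at the one point where the tension field is evaluated, and
  \<open>twice_differentiable_at\<close> records this amount of regularity. The exponential map is a
  definite description, so the curve exp(sX) p has provable properties only after existence and
  uniqueness of one-parameter subgroups. The Lie algebra is merely a Banach space spanned by
  finitely many vectors, whence the coordinates built for such spaces. In the trace at p, X
  \<mapsto> [X, Z] is skew for \<open>Q\<close>, but the \<open>E \<mu>\<close> are adapted to the
  orbit metric instead of \<open>Q\<close>, and [X, Z] may leave \<open>\<nn>\<close>. Both defects
  are absorbed by one fact: if the action field of X vanishes at p, then X lies in the isotropy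
  algebra, which is \<open>Q\<close>-orthogonal to \<open>\<nn>\<close>.\<close>

definition fin_dim :: "'a::real_normed_vector itself \<Rightarrow> bool" where
  "fin_dim _ \<longleftrightarrow> (\<exists>B::'a set. finite B \<and> span B = UNIV)"

lemma fin_dim_euclidean: "fin_dim TYPE('a::euclidean_space)"
  unfolding fin_dim_def by (rule exI[of _ Basis]) simp

lemma fin_dim_prod:
  assumes "fin_dim TYPE('a::real_normed_vector)" "fin_dim TYPE('b::real_normed_vector)"
  shows "fin_dim TYPE('a \<times> 'b)"
proof -
  obtain B :: "'a set" and C :: "'b set" where B: "finite B" "span B = UNIV" and C: "finite C" "span C = UNIV"
    using assms unfolding fin_dim_def by auto
  let ?S = "(\<lambda>x. (x, 0::'b)) ` B \<union> (\<lambda>y. (0::'a, y)) ` C"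
  have 1: "linear (\<lambda>x::'a. (x, 0::'b))" and 2: "linear (\<lambda>y::'b. (0::'a, y))"
    by (auto intro!: linearI)
  have "z \<in> span ?S" for z
  proof -
    have a: "(fst z, 0) \<in> span ((\<lambda>x. (x, 0::'b)) ` B)"
      using linear_span_image[OF 1, of B] B by auto
    have b: "(0, snd z) \<in> span ((\<lambda>y. (0::'a, y)) ` C)"
      using linear_span_image[OF 2, of C] C by auto
    have "(fst z, 0) + (0, snd z) \<in> span ?S"
      by (rule span_add) (use a b span_mono[of _ ?S] in blast)+
    then show ?thesis by simp
  qed
  then show ?thesis
    unfolding fin_dim_def using B C by (intro exI[of _ ?S]) auto
qed

text \<open>Closedness and bounded coordinates go through the induction together. A vector
  \<open>a\<close> outside the closed span of \<open>B\<close> has positive distance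
  \<open>d\<close> to it, and |s| d \<le> |s a + w| for w in the span bounds the new coordinate. The
  same inequality makes the new coordinates of a convergent sequence Cauchy, which yields closedness
  of the larger span.\<close>

lemma fin_dim_span_coords:
  fixes B :: "'a::real_normed_vector set"
  assumes "finite B" "independent B"
  shows "closed (span B) \<and> (\<exists>K\<ge>0. \<exists>c. \<forall>x\<in>span B. x = (\<Sum>b\<in>B. c x b *\<^sub>R b) \<and> (\<forall>b\<in>B. \<bar>c x b\<bar> \<le> K * norm x))"
  using assms
proof (induction B rule: finite_induct)
  case empty
  show ?case by (auto intro!: exI[of _ 0])
next
  case (insert a B)
  have ind: "independent B" and a: "a \<notin> span B"
    using insert by (auto simp: independent_insert)
  obtain K c where K: "K \<ge> 0" and c: "\<And>x. x \<in> span B \<Longrightarrow> x = (\<Sum>b\<in>B. c x b *\<^sub>R b)"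
    and cb: "\<And>x b. x \<in> span B \<Longrightarrow> b \<in> B \<Longrightarrow> \<bar>c x b\<bar> \<le> K * norm x"
    and cl: "closed (span B)"
    using insert.IH[OF ind] by blast
  define d where "d = infdist a (span B)"
  have ne: "span B \<noteq> {}" using span_zero[of B] by blast
  have d: "d > 0"
    unfolding d_def using cl a ne infdist_pos_not_in_closed by blast
  have low: "\<bar>s\<bar> * d \<le> norm (s *\<^sub>R a + w)" if w: "w \<in> span B" for s w
  proof (cases "s = 0")
    case False
    have "(- (1/s)) *\<^sub>R w \<in> span B" using w by (rule span_scale)
    then have "d \<le> dist a ((- (1/s)) *\<^sub>R w)"
      unfolding d_def by (rule infdist_le)
    also have "\<dots> = norm (a + (1/s) *\<^sub>R w)" by (simp add: dist_norm)
    finally have "\<bar>s\<bar> * d \<le> \<bar>s\<bar> * norm (a + (1/s) *\<^sub>R w)" by (simp add: mult_left_mono)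
    also have "\<dots> = norm (s *\<^sub>R (a + (1/s) *\<^sub>R w))" by simp
    also have "\<dots> = norm (s *\<^sub>R a + w)" using False by (simp add: scaleR_add_right)
    finally show ?thesis .
  qed simp
  have dec: "\<exists>s. x - s *\<^sub>R a \<in> span B" if "x \<in> span (insert a B)" for x
    using that by (simp add: span_insert)
  define s where "s = (\<lambda>x. SOME s. x - s *\<^sub>R a \<in> span B)"
  have s: "x - s x *\<^sub>R a \<in> span B" if "x \<in> span (insert a B)" for x
    unfolding s_def using someI_ex[OF dec[OF that]] .
  have sb: "\<bar>s x\<bar> \<le> norm x / d" if "x \<in> span (insert a B)" for x
    using low[OF s[OF that], of "s x"] d by (simp add: field_simps)
  define c' where "c' = (\<lambda>x b. if b = a then s x else c (x - s x *\<^sub>R a) b)"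
  have c': "x = (\<Sum>b\<in>insert a B. c' x b *\<^sub>R b)" if "x \<in> span (insert a B)" for x
  proof -
    have "(\<Sum>b\<in>B. c' x b *\<^sub>R b) = (\<Sum>b\<in>B. c (x - s x *\<^sub>R a) b *\<^sub>R b)"
      using insert.hyps by (intro sum.cong) (auto simp: c'_def)
    also have "\<dots> = x - s x *\<^sub>R a" using c[OF s[OF that]] by simp
    finally show ?thesis using insert.hyps by (simp add: c'_def)
  qed
  \<comment> \<open>The first entry bounds the coordinate of \<open>a\<close>. The second bounds the
    others, which are coordinates of x - s(x) a, a vector of norm at most
    \<open>(1 + norm a / d) * norm x\<close>.\<close>
  define K' where "K' = max (1/d) (K * (1 + norm a / d))"
  have nrm: "norm (x - s x *\<^sub>R a) \<le> (1 + norm a / d) * norm x" if "x \<in> span (insert a B)" for x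
  proof -
    have "norm (x - s x *\<^sub>R a) \<le> norm x + \<bar>s x\<bar> * norm a"
      using norm_triangle_ineq4[of x "s x *\<^sub>R a"] by simp
    also have "\<dots> \<le> norm x + norm x / d * norm a"
      using mult_right_mono[OF sb[OF that], of "norm a"] by simp
    finally show ?thesis by (simp add: algebra_simps)
  qed
  have cb': "\<bar>c' x b\<bar> \<le> K' * norm x" if "x \<in> span (insert a B)" "b \<in> insert a B" for x b
  proof (cases "b = a")
    case True
    have "\<bar>s x\<bar> \<le> (1/d) * norm x" using sb[OF that(1)] by simp
    also have "\<dots> \<le> K' * norm x" unfolding K'_def by (intro mult_right_mono) auto
    finally show ?thesis using True by (simp add: c'_def)
  next
    case False
    then have "\<bar>c' x b\<bar> \<le> K * norm (x - s x *\<^sub>R a)"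
      using cb[OF s[OF that(1)], of b] that by (simp add: c'_def)
    also have "\<dots> \<le> K * ((1 + norm a / d) * norm x)"
      using nrm[OF that(1)] K by (rule mult_left_mono)
    also have "\<dots> = (K * (1 + norm a / d)) * norm x" by simp
    also have "\<dots> \<le> K' * norm x" unfolding K'_def by (intro mult_right_mono) auto
    finally show ?thesis .
  qed
  have "closed (span (insert a B))"
    unfolding closed_sequential_limits
  proof (intro allI impI, elim conjE)
    fix X l assume X: "\<forall>n. X n \<in> span (insert a B)" and l: "X \<longlonglongrightarrow> l"
    have lip: "\<bar>s (X m) - s (X n)\<bar> \<le> norm (X m - X n) / d" for m n
    proof -
      have "(X m - s (X m) *\<^sub>R a) - (X n - s (X n) *\<^sub>R a) \<in> span B"
        by (rule span_diff[OF s s]) (use X in auto)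
      from low[OF this, of "s (X m) - s (X n)"]
      have "\<bar>s (X m) - s (X n)\<bar> * d \<le> norm (X m - X n)" by (simp add: algebra_simps)
      then show ?thesis using d by (simp add: field_simps)
    qed
    have "Cauchy (\<lambda>n. s (X n))"
      unfolding Cauchy_def
    proof (intro allI impI)
      fix e :: real assume e: "e > 0"
      have "Cauchy X" using l LIMSEQ_imp_Cauchy by blast
      then obtain M where M: "\<forall>m\<ge>M. \<forall>n\<ge>M. dist (X m) (X n) < e * d"
        using e d unfolding Cauchy_def by (meson mult_pos_pos)
      have "dist (s (X m)) (s (X n)) < e" if "m \<ge> M" "n \<ge> M" for m n
      proof -
        have "norm (X m - X n) / d < e"
          using M that d by (simp add: dist_norm field_simps)
        then show ?thesis using lip[of m n] by (simp add: dist_real_def)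
      qed
      then show "\<exists>M. \<forall>m\<ge>M. \<forall>n\<ge>M. dist (s (X m)) (s (X n)) < e" by blast
    qed
    then obtain t where t: "(\<lambda>n. s (X n)) \<longlonglongrightarrow> t"
      using Cauchy_convergent_iff convergent_def by blast
    have "(\<lambda>n. X n - s (X n) *\<^sub>R a) \<longlonglongrightarrow> l - t *\<^sub>R a"
      by (intro tendsto_intros l t)
    then have "l - t *\<^sub>R a \<in> span B"
      by (rule closed_sequentially[OF cl, rotated]) (use s X in blast)
    then show "l \<in> span (insert a B)" by (auto simp: span_insert)
  qed
  moreover have "K' \<ge> 0" unfolding K'_def using d by (simp add: le_max_iff_disj)
  ultimately show ?case using c' cb' by blast
qed

lemma fin_dim_coords:
  assumes "fin_dim TYPE('a::real_normed_vector)"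
  obtains B :: "'a::real_normed_vector set" and c where "finite B" "\<And>b. bounded_linear (\<lambda>x. c x b)"
    "\<And>x. x = (\<Sum>b\<in>B. c x b *\<^sub>R b)"
proof -
  obtain S :: "'a set" where S: "finite S" "span S = UNIV"
    using assms unfolding fin_dim_def by auto
  obtain B where B: "B \<subseteq> S" "independent B" "S \<subseteq> span B"
    using maximal_independent_subset[of S] by blast
  have fB: "finite B" using B S finite_subset by blast
  have sB: "span B = UNIV" using span_mono[OF B(3)] S by (auto simp: span_span)
  obtain K c where K: "K \<ge> 0" and c: "\<And>x. x = (\<Sum>b\<in>B. c x b *\<^sub>R b)"
    and cb: "\<And>x b. b \<in> B \<Longrightarrow> \<bar>c x b\<bar> \<le> K * norm x"
    using fin_dim_span_coords[OF fB B(2)] sB by (metis UNIV_I)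
  have uniq: "u b = v b" if "(\<Sum>b\<in>B. u b *\<^sub>R b) = (\<Sum>b\<in>B. v b *\<^sub>R b)" "b \<in> B" for u v b
  proof -
    have "(\<Sum>b\<in>B. (u b - v b) *\<^sub>R b) = 0"
      using that by (simp add: scaleR_left_diff_distrib sum_subtractf)
    then show ?thesis
      using independentD[OF B(2) fB subset_refl, of "\<lambda>b. u b - v b" b] that by simp
  qed
  \<comment> \<open>Zero outside \<open>B\<close>, so that boundedness can be stated for every index
    \<open>b\<close>.\<close>
  define c' where "c' = (\<lambda>x b. if b \<in> B then c x b else 0)"
  have "bounded_linear (\<lambda>x. c' x b)" for b
  proof (cases "b \<in> B")
    case True
    have add: "c (x + y) b = c x b + c y b" for x y
    proof (rule uniq[of "c (x+y)" "\<lambda>b. c x b + c y b"])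
      show "(\<Sum>b\<in>B. c (x + y) b *\<^sub>R b) = (\<Sum>b\<in>B. (c x b + c y b) *\<^sub>R b)"
        using c[of "x+y"] c[of x] c[of y] by (simp add: scaleR_left_distrib sum.distrib)
    qed fact
    have scl: "c (k *\<^sub>R x) b = k * c x b" for k x
    proof (rule uniq[of "c (k *\<^sub>R x)" "\<lambda>b. k * c x b"])
      show "(\<Sum>b\<in>B. c (k *\<^sub>R x) b *\<^sub>R b) = (\<Sum>b\<in>B. (k * c x b) *\<^sub>R b)"
        using c[of "k *\<^sub>R x"] arg_cong[OF c[of x], of "scaleR k"] by (simp add: scaleR_sum_right)
    qed fact
    show ?thesis
      by (rule bounded_linear_intro[where K=K]) (use True add scl cb in \<open>auto simp: c'_def mult.commute\<close>)
  qed (simp add: c'_def)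
  moreover have "x = (\<Sum>b\<in>B. c' x b *\<^sub>R b)" for x
  proof -
    have "(\<Sum>b\<in>B. c x b *\<^sub>R b) = (\<Sum>b\<in>B. c' x b *\<^sub>R b)"
      by (rule sum.cong) (simp_all add: c'_def)
    then show ?thesis using c[of x] by simp
  qed
  ultimately show ?thesis using that[OF fB] by blast
qed

lemma linear_coords:
  assumes "linear l" "x = (\<Sum>b\<in>B. c b *\<^sub>R b)"
  shows "l x = (\<Sum>b\<in>B. c b *\<^sub>R l b)"
  by (simp only: assms(2) linear_sum[OF assms(1)] linear_scale[OF assms(1)])

text \<open>A product rule for evaluation that works with z \<mapsto> L(z) v at fixed v, instead of
  an operator-valued derivative of \<open>L\<close>: in coordinates of \<open>u z\<close> it becomes
  a finite sum of scalars times vectors. Linearity is asked for near \<open>z0\<close> because the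
  families in question are Frechet derivatives, which have unspecified values where the map is not
  differentiable.\<close>

lemma has_derivative_linear_family:
  fixes L :: "'z::real_normed_vector \<Rightarrow> 'a::real_normed_vector \<Rightarrow> 'b::real_normed_vector"
  assumes fd: "fin_dim TYPE('a)"
    and lin: "\<forall>\<^sub>F z in nhds z0. linear (L z)"
    and L': "\<And>v. ((\<lambda>z. L z v) has_derivative L' v) (at z0)"
    and u: "(u has_derivative u') (at z0)"
  shows "((\<lambda>z. L z (u z)) has_derivative (\<lambda>h. L' (u z0) h + L z0 (u' h))) (at z0)"
proof -
  obtain B :: "'a set" and c where c: "finite B" "\<And>b. bounded_linear (\<lambda>x. c x b)"
    and cx: "\<And>x. x = (\<Sum>b\<in>B. c x b *\<^sub>R b)" using fin_dim_coords[OF fd] by blast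
  have ex: "l v = (\<Sum>b\<in>B. c v b *\<^sub>R l b)" if "linear l" for l :: "'a \<Rightarrow> 'b" and v
    by (rule linear_coords[OF that cx])
  have lin0: "linear (L z0)" using lin by (rule eventually_nhds_x_imp_x)
  \<comment> \<open>The derivative inherits linearity in \<open>v\<close>: expand
    \<open>L z v\<close> near \<open>z0\<close> and compare the two derivatives.\<close>
  have L'lin: "L' v = (\<lambda>h. \<Sum>b\<in>B. c v b *\<^sub>R L' b h)" for v
  proof (rule has_derivative_unique)
    show "((\<lambda>z. L z v) has_derivative L' v) (at z0)" by fact
    have "((\<lambda>z. \<Sum>b\<in>B. c v b *\<^sub>R L z b) has_derivative (\<lambda>h. \<Sum>b\<in>B. c v b *\<^sub>R L' b h)) (at z0)"
      by (intro has_derivative_sum has_derivative_scaleR_right L')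
    then show "((\<lambda>z. L z v) has_derivative (\<lambda>h. \<Sum>b\<in>B. c v b *\<^sub>R L' b h)) (at z0)"
    proof (rule has_derivative_transform_eventually)
      show "\<forall>\<^sub>F z in at z0. (\<Sum>b\<in>B. c v b *\<^sub>R L z b) = L z v"
        using lin ex unfolding eventually_at_filter by (auto elim!: eventually_mono)
    qed (simp_all add: ex[OF lin0, symmetric])
  qed
  have cu: "((\<lambda>z. c (u z) b) has_derivative (\<lambda>h. c (u' h) b)) (at z0)" for b
    using bounded_linear.has_derivative[OF c(2) u] .
  have "((\<lambda>z. \<Sum>b\<in>B. c (u z) b *\<^sub>R L z b) has_derivative
      (\<lambda>h. \<Sum>b\<in>B. c (u z0) b *\<^sub>R L' b h + c (u' h) b *\<^sub>R L z0 b)) (at z0)"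
    by (intro has_derivative_sum has_derivative_scaleR cu L')
  moreover have "(\<lambda>h. \<Sum>b\<in>B. c (u z0) b *\<^sub>R L' b h + c (u' h) b *\<^sub>R L z0 b)
      = (\<lambda>h. L' (u z0) h + L z0 (u' h))"
    by (subst (2) L'lin) (simp add: sum.distrib fun_eq_iff ex[OF lin0, symmetric])
  ultimately have "((\<lambda>z. \<Sum>b\<in>B. c (u z) b *\<^sub>R L z b) has_derivative (\<lambda>h. L' (u z0) h + L z0 (u' h))) (at z0)"
    by simp
  then show ?thesis
  proof (rule has_derivative_transform_eventually)
    show "\<forall>\<^sub>F z in at z0. (\<Sum>b\<in>B. c (u z) b *\<^sub>R L z b) = L z (u z)"
      using lin ex unfolding eventually_at_filter by (auto elim!: eventually_mono)
  qed (simp_all add: ex[OF lin0, symmetric])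
qed

section \<open>Calculus of smooth maps\<close>

lemma Ck_on_Suc_imp: "Ck_on (Suc k) S f \<Longrightarrow> Ck_on k S f"
proof (induction k arbitrary: f)
  case 0
  then show ?case
    by (auto intro!: continuous_at_imp_continuous_on differentiable_imp_continuous_within)
next
  case (Suc k)
  then show ?case by (metis Ck_on.simps(2))
qed

lemma Ck_on_le: "Ck_on k S f \<Longrightarrow> j \<le> k \<Longrightarrow> Ck_on j S f"
  by (induction k) (auto simp: le_Suc_eq simp del: Ck_on.simps dest: Ck_on_Suc_imp)

lemma Ck_on_continuous_on: "Ck_on k S f \<Longrightarrow> continuous_on S f"
  using Ck_on_le[of k S f 0] by simp

lemma Ck_on_subset: "Ck_on k S f \<Longrightarrow> T \<subseteq> S \<Longrightarrow> Ck_on k T f"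
  by (induction k arbitrary: f) (auto intro: continuous_on_subset)

text \<open>\<open>frechet_derivative\<close> is a choice over the predicate
  \<open>has_derivative\<close>. Both functions satisfy the same instances of this predicate at
  \<open>x\<close>, so the chosen values agree, even where neither function is
  differentiable.\<close>

lemma frechet_derivative_cong_open:
  assumes "open S" "x \<in> S" "\<And>y. y \<in> S \<Longrightarrow> f y = g y"
  shows "frechet_derivative f (at x) = frechet_derivative g (at x)"
proof -
  have "(f has_derivative D) (at x) \<longleftrightarrow> (g has_derivative D) (at x)" for D
    using assms has_derivative_transform_within_open[of f D x UNIV S g]
      has_derivative_transform_within_open[of g D x UNIV S f] by auto
  then show ?thesis unfolding frechet_derivative_def by simp
qed

lemma Ck_on_cong:
  assumes "open S" "\<And>x. x \<in> S \<Longrightarrow> f x = g x" "Ck_on k S f"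
  shows "Ck_on k S g"
  using assms(2,3)
proof (induction k arbitrary: f g)
  case 0
  then show ?case using continuous_on_cong by force
next
  case (Suc k)
  have d: "f differentiable (at x)" "Ck_on k S (\<lambda>x. frechet_derivative f (at x) v)" if "x \<in> S" for x v
    using Suc.prems that by auto
  have "Ck_on k S (\<lambda>x. frechet_derivative g (at x) v)" for v
  proof (rule Suc.IH)
    show "Ck_on k S (\<lambda>x. frechet_derivative f (at x) v)" using Suc.prems by simp
    show "frechet_derivative f (at x) v = frechet_derivative g (at x) v" if "x \<in> S" for x
      using frechet_derivative_cong_open[OF assms(1) that, of f g] Suc.prems by simp
  qed
  moreover have "g differentiable (at x)" if "x \<in> S" for x
    using d(1)[OF that] has_derivative_transform_within_open[of f _ x UNIV S g] assms(1) that Suc.prems(1)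
    unfolding differentiable_def by blast
  ultimately show ?case by simp
qed

lemma Ck_on_const: "Ck_on k S (\<lambda>x. c)"
  by (induction k arbitrary: c) auto

lemma Ck_on_bounded_linear:
  assumes "bounded_linear f" shows "Ck_on k S f"
proof (cases k)
  case 0
  then show ?thesis using assms by (simp add: linear_continuous_on)
next
  case (Suc j)
  have "frechet_derivative f (at x) = f" for x
    using bounded_linear_imp_has_derivative[OF assms] frechet_derivative_at by metis
  then show ?thesis using Suc assms Ck_on_const bounded_linear_imp_differentiable by auto
qed

lemma Ck_on_bounded_linear_compose:
  assumes "bounded_linear l" "open S" "Ck_on k S f"
  shows "Ck_on k S (\<lambda>x. l (f x))"
  using assms(3)
proof (induction k arbitrary: f)
  case 0
  then show ?case using assms(1) by (simp add: bounded_linear.continuous_on)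
next
  case (Suc k)
  have df: "(f has_derivative frechet_derivative f (at x)) (at x)" if "x \<in> S" for x
    using Suc.prems that frechet_derivative_works by auto
  have d: "((\<lambda>x. l (f x)) has_derivative (\<lambda>v. l (frechet_derivative f (at x) v))) (at x)" if "x \<in> S" for x
    by (rule bounded_linear.has_derivative[OF assms(1) df[OF that]])
  then have e: "frechet_derivative (\<lambda>x. l (f x)) (at x) = (\<lambda>v. l (frechet_derivative f (at x) v))" if "x \<in> S" for x
    using frechet_derivative_at[OF d[OF that]] by simp
  have "Ck_on k S (\<lambda>x. frechet_derivative (\<lambda>x. l (f x)) (at x) v)" for v
  proof (rule Ck_on_cong[OF assms(2)])
    show "Ck_on k S (\<lambda>x. l (frechet_derivative f (at x) v))" using Suc by simp
  qed (simp add: e)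
  then show ?case using differentiableI[OF d] by auto
qed

lemma Ck_on_add:
  assumes "open S" "Ck_on k S f" "Ck_on k S g"
  shows "Ck_on k S (\<lambda>x. f x + g x)"
  using assms(2,3)
proof (induction k arbitrary: f g)
  case 0
  then show ?case by (simp add: continuous_on_add)
next
  case (Suc k)
  have d: "((\<lambda>x. f x + g x) has_derivative (\<lambda>v. frechet_derivative f (at x) v + frechet_derivative g (at x) v)) (at x)"
    if "x \<in> S" for x
    using Suc.prems that frechet_derivative_works by (auto intro!: has_derivative_add)
  have "Ck_on k S (\<lambda>x. frechet_derivative (\<lambda>x. f x + g x) (at x) v)" for v
  proof (rule Ck_on_cong[OF assms(1)])
    show "Ck_on k S (\<lambda>x. frechet_derivative f (at x) v + frechet_derivative g (at x) v)" using Suc by simp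
  qed (simp add: frechet_derivative_at[OF d, symmetric])
  then show ?case using differentiableI[OF d] by auto
qed

lemma Ck_on_sum:
  assumes "open S" "finite A" "\<And>i. i \<in> A \<Longrightarrow> Ck_on k S (f i)"
  shows "Ck_on k S (\<lambda>x. \<Sum>i\<in>A. f i x)"
  using assms(2,3)
  by (induction A rule: finite_induct) (auto intro!: Ck_on_const Ck_on_add[OF assms(1)])

lemma Ck_on_bilinear:
  assumes "bounded_bilinear m" "open S" "Ck_on k S f" "Ck_on k S g"
  shows "Ck_on k S (\<lambda>x. m (f x) (g x))"
  using assms(3,4)
proof (induction k arbitrary: f g)
  case 0
  then show ?case using assms(1) by (simp add: bounded_bilinear.continuous_on)
next
  case (Suc k)
  have d: "((\<lambda>x. m (f x) (g x)) has_derivative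
      (\<lambda>v. m (f x) (frechet_derivative g (at x) v) + m (frechet_derivative f (at x) v) (g x))) (at x)"
    if "x \<in> S" for x
    by (rule bounded_bilinear.FDERIV[OF assms(1)]) (use Suc.prems that in \<open>auto simp: frechet_derivative_works[symmetric]\<close>)
  have "Ck_on k S (\<lambda>x. frechet_derivative (\<lambda>x. m (f x) (g x)) (at x) v)" for v
  proof (rule Ck_on_cong[OF assms(2)])
    have fg: "Ck_on k S f" "Ck_on k S g" using Suc.prems Ck_on_Suc_imp by blast+
    show "Ck_on k S (\<lambda>x. m (f x) (frechet_derivative g (at x) v) + m (frechet_derivative f (at x) v) (g x))"
      using Suc fg by (intro Ck_on_add[OF assms(2)] Suc.IH) auto
  qed (simp add: frechet_derivative_at[OF d, symmetric])
  then show ?case using differentiableI[OF d] by auto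
qed

text \<open>The derivative of f(g(x)) in direction v is Df(g(x)) applied to a vector depending on x,
  so it is no composition to which the induction hypothesis applies. Expanding that vector in
  coordinates gives a sum of products of a scalar function with a composition of a partial
  derivative of \<open>f\<close> with \<open>g\<close>; hence the induction generalizes over
  \<open>f\<close>.\<close>

lemma Ck_on_compose:
  fixes f :: "'a::real_normed_vector \<Rightarrow> 'b::real_normed_vector" and g :: "'z::real_normed_vector \<Rightarrow> 'a"
  assumes fd: "fin_dim TYPE('a)" and S: "open S" and gS: "g ` S \<subseteq> T"
    and f: "Ck_on k T f" and g: "Ck_on k S g"
  shows "Ck_on k S (\<lambda>x. f (g x))"
  using f g
proof (induction k arbitrary: f)
  case 0
  then show ?case using continuous_on_compose2[of T f S g] gS by simp
next
  case (Suc k)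
  obtain B :: "'a set" and c where c: "finite B" "\<And>b. bounded_linear (\<lambda>x. c x b)"
    and cx: "\<And>x. x = (\<Sum>b\<in>B. c x b *\<^sub>R b)" using fin_dim_coords[OF fd] by blast
  have df: "(f has_derivative frechet_derivative f (at y)) (at y)" if "y \<in> T" for y
    using Suc.prems(1) that frechet_derivative_works by auto
  have dg: "(g has_derivative frechet_derivative g (at x)) (at x)" if "x \<in> S" for x
    using Suc.prems(2) that frechet_derivative_works by auto
  have d: "((\<lambda>x. f (g x)) has_derivative
     (\<lambda>v. frechet_derivative f (at (g x)) (frechet_derivative g (at x) v))) (at x)" if "x \<in> S" for x
    using has_derivative_compose[OF dg df] that gS by blast
  have ex: "frechet_derivative f (at (g x)) w = (\<Sum>b\<in>B. c w b *\<^sub>R frechet_derivative f (at (g x)) b)"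
    if "x \<in> S" for x w
  proof -
    have "linear (frechet_derivative f (at (g x)))"
      using df gS that has_derivative_linear by blast
    then show ?thesis
      by (rule linear_coords[OF _ cx])
  qed
  have "Ck_on k S (\<lambda>x. frechet_derivative (\<lambda>x. f (g x)) (at x) v)" for v
  proof (rule Ck_on_cong[OF S])
    have "Ck_on k S g" using Suc.prems(2) by (rule Ck_on_Suc_imp)
    then show "Ck_on k S (\<lambda>x. \<Sum>b\<in>B. c (frechet_derivative g (at x) v) b *\<^sub>R frechet_derivative f (at (g x)) b)"
      using Suc.prems c
      by (intro Ck_on_sum[OF S] Ck_on_bilinear[OF bounded_bilinear_scaleR S]
          Ck_on_bounded_linear_compose[OF c(2) S] Suc.IH) auto
  qed (simp add: frechet_derivative_at[OF d, symmetric] ex[symmetric])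
  then show ?case using differentiableI[OF d] by auto
qed

lemma smooth_on_subset: "smooth_on S f \<Longrightarrow> T \<subseteq> S \<Longrightarrow> smooth_on T f"
  unfolding smooth_on_def using Ck_on_subset by blast

lemma smooth_on_cong: "open S \<Longrightarrow> smooth_on S f \<Longrightarrow> (\<And>x. x \<in> S \<Longrightarrow> f x = g x) \<Longrightarrow> smooth_on S g"
  unfolding smooth_on_def using Ck_on_cong by blast

lemma smooth_on_continuous_on: "smooth_on S f \<Longrightarrow> continuous_on S f"
  unfolding smooth_on_def using Ck_on_continuous_on by blast

lemma smooth_on_has_derivative:
  "smooth_on S f \<Longrightarrow> x \<in> S \<Longrightarrow> (f has_derivative frechet_derivative f (at x)) (at x)"
  unfolding smooth_on_def using Ck_on.simps(2) frechet_derivative_works by blast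

lemma smooth_on_deriv: "smooth_on S f \<Longrightarrow> smooth_on S (\<lambda>x. frechet_derivative f (at x) v)"
  unfolding smooth_on_def using Ck_on.simps(2) by blast

lemma smooth_on_const: "smooth_on S (\<lambda>x. c)"
  unfolding smooth_on_def by (simp add: Ck_on_const)

lemma smooth_on_bounded_linear: "bounded_linear f \<Longrightarrow> smooth_on S f"
  unfolding smooth_on_def by (simp add: Ck_on_bounded_linear)

lemma smooth_on_id: "smooth_on S (\<lambda>x. x)"
  by (intro smooth_on_bounded_linear bounded_linear_ident)

lemma smooth_on_bounded_linear_compose:
  "bounded_linear l \<Longrightarrow> open S \<Longrightarrow> smooth_on S f \<Longrightarrow> smooth_on S (\<lambda>x. l (f x))"
  unfolding smooth_on_def by (simp add: Ck_on_bounded_linear_compose)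

lemma smooth_on_add:
  "open S \<Longrightarrow> smooth_on S f \<Longrightarrow> smooth_on S g \<Longrightarrow> smooth_on S (\<lambda>x. f x + g x)"
  unfolding smooth_on_def by (simp add: Ck_on_add)

lemma smooth_on_compose:
  fixes f :: "'a::real_normed_vector \<Rightarrow> 'b::real_normed_vector" and g :: "'z::real_normed_vector \<Rightarrow> 'a"
  assumes "fin_dim TYPE('a)" "open S" "g ` S \<subseteq> T" "smooth_on T f" "smooth_on S g"
  shows "smooth_on S (\<lambda>x. f (g x))"
  using assms unfolding smooth_on_def by (blast intro: Ck_on_compose)

lemma smooth_on_Pair:
  assumes "open S" "smooth_on S f" "smooth_on S g"
  shows "smooth_on S (\<lambda>x. (f x, g x))"
proof -
  have "bounded_linear (\<lambda>x. (x, 0))" "bounded_linear (\<lambda>x. (0, x))"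
    by (intro bounded_linear_Pair bounded_linear_ident bounded_linear_zero)+
  from smooth_on_bounded_linear_compose[OF this(1) assms(1,2)] smooth_on_bounded_linear_compose[OF this(2) assms(1,3)]
  have "smooth_on S (\<lambda>x. (f x, 0) + (0, g x))"
    by (rule smooth_on_add[OF assms(1)])
  then show ?thesis by simp
qed

abbreviation fder :: "('a::real_normed_vector \<Rightarrow> 'b::real_normed_vector) \<Rightarrow> 'a \<Rightarrow> 'a \<Rightarrow> 'b" where
  "fder f x \<equiv> frechet_derivative f (at x)"

lemma fder_eqI: "(f has_derivative f') (at x) \<Longrightarrow> fder f x = f'"
  by (rule frechet_derivative_at[symmetric])

lemma has_vector_derivative_compose_fder:
  assumes "(f has_derivative f') (at (c t))" "(c has_vector_derivative v) (at t)"
  shows "((\<lambda>s. f (c s)) has_vector_derivative f' v) (at t)"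
proof -
  have "((\<lambda>s. f (c s)) has_derivative (\<lambda>h. f' (h *\<^sub>R v))) (at t)"
    using has_derivative_compose[OF assms(2)[unfolded has_vector_derivative_def] assms(1)] .
  then show ?thesis
    using linear_scale[OF has_derivative_linear[OF assms(1)]] by (simp add: has_vector_derivative_def)
qed

lemma smooth_on_velocity:
  fixes k :: "real \<Rightarrow> 'a::real_normed_vector"
  assumes I: "open I" and k: "smooth_on I k"
  shows "\<And>s. s \<in> I \<Longrightarrow> (k has_vector_derivative vector_derivative k (at s)) (at s)"
    and "smooth_on I (\<lambda>s. vector_derivative k (at s))"
proof -
  have d: "(k has_vector_derivative fder k s 1) (at s)" if "s \<in> I" for s
    using has_vector_derivative_compose_fder[OF smooth_on_has_derivative[OF k that] has_vector_derivative_id] by simp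
  then show "\<And>s. s \<in> I \<Longrightarrow> (k has_vector_derivative vector_derivative k (at s)) (at s)"
    using vector_derivative_at by metis
  show "smooth_on I (\<lambda>s. vector_derivative k (at s))"
    by (rule smooth_on_cong[OF I smooth_on_deriv[OF k, of 1]]) (simp add: vector_derivative_at[OF d])
qed

section \<open>Mean value inequality and symmetry of second derivatives\<close>

lemma vector_derivative_bound:
  fixes g :: "real \<Rightarrow> 'a::real_normed_vector"
  assumes "0 < h" "\<And>t. t \<in> {0..h} \<Longrightarrow> (g has_vector_derivative g' t) (at t)"
    "\<And>t. t \<in> {0..h} \<Longrightarrow> norm (g' t) \<le> K"
  shows "norm (g h - g 0) \<le> K * h"
proof -
  have "norm (g h - g 0) \<le> K * h - K * 0"
  proof (rule differentiable_bound_general[OF assms(1), where f' = g' and \<phi>' = "\<lambda>_. K"])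
    show "continuous_on {0..h} g"
      using assms(2) by (meson continuous_at_imp_continuous_on has_vector_derivative_continuous)
    show "((*) K has_vector_derivative K) (at x)" for x :: real
      by (auto intro!: derivative_eq_intros)
  qed (use assms in \<open>auto intro!: continuous_intros\<close>)
  then show ?thesis by simp
qed

text \<open>The second difference is the increment of s \<mapsto> f(x + h w + s v) - f(x + s v),
  whose derivative is in turn an increment of \<open>fv\<close> in direction \<open>w\<close>. The
  mean value inequality is applied to each, after subtracting the linear term with coefficient
  \<open>P\<close>; continuity of the iterated derivative at \<open>x\<close> bounds what
  remains.\<close>

lemma second_difference_bound:
  fixes f :: "'a::real_normed_vector \<Rightarrow> 'b::real_normed_vector"
  assumes S: "open S" "x \<in> S" and f: "smooth_on S f" and e: "e > 0"
  shows "\<exists>d>0. \<forall>h. 0 < h \<and> h < d \<longrightarrow>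
    norm (f (x + h *\<^sub>R v + h *\<^sub>R w) - f (x + h *\<^sub>R v) - f (x + h *\<^sub>R w) + f x
      - (h * h) *\<^sub>R fder (\<lambda>y. fder f y v) x w) \<le> e * (h * h)"
proof -
  define fv where "fv = (\<lambda>y. fder f y v)"
  define P where "P = fder fv x w"
  have fv: "smooth_on S fv" unfolding fv_def by (rule smooth_on_deriv[OF f])
  have "continuous_on S (\<lambda>y. fder fv y w)"
    using smooth_on_continuous_on[OF smooth_on_deriv[OF fv]] .
  then have "isCont (\<lambda>y. fder fv y w) x"
    using S by (simp add: continuous_on_eq_continuous_at)
  then obtain d1 where d1: "d1 > 0" "\<And>y. dist y x < d1 \<Longrightarrow> dist (fder fv y w) P < e"
    unfolding continuous_at_eps_delta P_def using e by (metis dist_commute)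
  obtain d2 where d2: "d2 > 0" "ball x d2 \<subseteq> S" using S openE by blast
  \<comment> \<open>Keeps x + s v + t w within \<open>min d1 d2\<close> of \<open>x\<close> for s, t
    in [0, h] and h < d. The added 1 keeps the denominator positive.\<close>
  define d where "d = min d1 d2 / (norm v + norm w + 1)"
  have pos: "norm v + norm w + 1 > 0" by (simp add: add_nonneg_pos)
  have d: "d > 0" unfolding d_def using d1 d2 pos by simp
  have near: "dist (x + s *\<^sub>R v + t *\<^sub>R w) x < min d1 d2" if "s \<in> {0..h}" "t \<in> {0..h}" "0 < h" "h < d" for s t h
  proof -
    have "dist (x + s *\<^sub>R v + t *\<^sub>R w) x = norm (s *\<^sub>R v + t *\<^sub>R w)" by (simp add: dist_norm)
    also have "\<dots> \<le> s * norm v + t * norm w"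
      using that norm_triangle_ineq[of "s *\<^sub>R v" "t *\<^sub>R w"] by simp
    also have "\<dots> \<le> h * norm v + h * norm w"
      using that by (intro add_mono mult_right_mono) auto
    also have "\<dots> < h * (norm v + norm w + 1)" using that by (simp add: algebra_simps)
    also have "\<dots> \<le> d * (norm v + norm w + 1)" using that pos by (intro mult_right_mono) auto
    also have "\<dots> = min d1 d2" unfolding d_def using pos by simp
    finally show ?thesis .
  qed
  have inS: "x + s *\<^sub>R v + t *\<^sub>R w \<in> S" if "s \<in> {0..h}" "t \<in> {0..h}" "0 < h" "h < d" for s t h
    using near[OF that] d2 by (auto simp: dist_commute)
  have line: "((\<lambda>t. a + t *\<^sub>R u) has_vector_derivative u) (at t)" for a u :: 'a and t
    by (auto intro!: derivative_eq_intros)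
  have inner: "norm (fv (x + s *\<^sub>R v + h *\<^sub>R w) - fv (x + s *\<^sub>R v) - h *\<^sub>R P) \<le> e * h"
    if s: "s \<in> {0..h}" and h: "0 < h" "h < d" for s h
  proof -
    have "norm ((fv (x + s *\<^sub>R v + h *\<^sub>R w) - h *\<^sub>R P) - (fv (x + s *\<^sub>R v + 0 *\<^sub>R w) - 0 *\<^sub>R P)) \<le> e * h"
    proof (rule vector_derivative_bound[OF h(1), where g = "\<lambda>t. fv (x + s *\<^sub>R v + t *\<^sub>R w) - t *\<^sub>R P"
          and g' = "\<lambda>t. fder fv (x + s *\<^sub>R v + t *\<^sub>R w) w - P"])
      fix t assume t: "t \<in> {0..h}"
      have "((\<lambda>t. fv (x + s *\<^sub>R v + t *\<^sub>R w)) has_vector_derivative fder fv (x + s *\<^sub>R v + t *\<^sub>R w) w) (at t)"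
        by (rule has_vector_derivative_compose_fder[OF smooth_on_has_derivative[OF fv inS[OF s t h]] line])
      then show "((\<lambda>t. fv (x + s *\<^sub>R v + t *\<^sub>R w) - t *\<^sub>R P) has_vector_derivative
          fder fv (x + s *\<^sub>R v + t *\<^sub>R w) w - P) (at t)"
        by (rule has_vector_derivative_diff) (auto intro!: derivative_eq_intros)
      show "norm (fder fv (x + s *\<^sub>R v + t *\<^sub>R w) w - P) \<le> e"
        using d1(2)[of "x + s *\<^sub>R v + t *\<^sub>R w"] near[OF s t h] by (simp add: dist_norm)
    qed
    then show ?thesis by (simp add: algebra_simps)
  qed
  have "norm (f (x + h *\<^sub>R v + h *\<^sub>R w) - f (x + h *\<^sub>R v) - f (x + h *\<^sub>R w) + f x - (h * h) *\<^sub>R P) \<le> e * (h * h)"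
    if h: "0 < h" "h < d" for h
  proof -
    have h0: "0 \<in> {0..h}" "h \<in> {0..h}" using h by auto
    have "norm ((f (x + h *\<^sub>R w + h *\<^sub>R v) - f (x + h *\<^sub>R v) - (h * h) *\<^sub>R P) -
        (f (x + h *\<^sub>R w + 0 *\<^sub>R v) - f (x + 0 *\<^sub>R v) - (0 * h) *\<^sub>R P)) \<le> (e * h) * h"
    proof (rule vector_derivative_bound[OF h(1), where g = "\<lambda>s. f (x + h *\<^sub>R w + s *\<^sub>R v) - f (x + s *\<^sub>R v) - (s * h) *\<^sub>R P"
          and g' = "\<lambda>s. fv (x + s *\<^sub>R v + h *\<^sub>R w) - fv (x + s *\<^sub>R v) - h *\<^sub>R P"])
      fix s assume s: "s \<in> {0..h}"
      have 1: "x + h *\<^sub>R w + s *\<^sub>R v \<in> S" using inS[OF s h0(2) h] by (simp add: algebra_simps)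
      have 2: "x + s *\<^sub>R v \<in> S" using inS[OF s h0(1) h] by simp
      have "((\<lambda>s. f (x + h *\<^sub>R w + s *\<^sub>R v)) has_vector_derivative fv (x + s *\<^sub>R v + h *\<^sub>R w)) (at s)"
        using has_vector_derivative_compose_fder[OF smooth_on_has_derivative[OF f 1] line]
        by (simp add: fv_def algebra_simps)
      moreover have "((\<lambda>s. f (x + s *\<^sub>R v)) has_vector_derivative fv (x + s *\<^sub>R v)) (at s)"
        using has_vector_derivative_compose_fder[OF smooth_on_has_derivative[OF f 2] line] by (simp add: fv_def)
      moreover have "((\<lambda>s. (s * h) *\<^sub>R P) has_vector_derivative h *\<^sub>R P) (at s)"
        by (auto intro!: derivative_eq_intros)
      ultimately show "((\<lambda>s. f (x + h *\<^sub>R w + s *\<^sub>R v) - f (x + s *\<^sub>R v) - (s * h) *\<^sub>R P)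
          has_vector_derivative fv (x + s *\<^sub>R v + h *\<^sub>R w) - fv (x + s *\<^sub>R v) - h *\<^sub>R P) (at s)"
        by (intro has_vector_derivative_diff)
    qed (use inner[OF _ h] in auto)
    then show ?thesis by (simp add: algebra_simps)
  qed
  then show ?thesis using d unfolding P_def fv_def by blast
qed

text \<open>The second difference is symmetric in \<open>v\<close> and \<open>w\<close>, and each
  iterated derivative times h^2 approximates it up to e/2 h^2. Dividing by h^2 bounds the difference
  of the two by \<open>e\<close>.\<close>

lemma smooth_on_symmetric_second_derivative:
  fixes f :: "'a::real_normed_vector \<Rightarrow> 'b::real_normed_vector"
  assumes S: "open S" "x \<in> S" and f: "smooth_on S f"
  shows "fder (\<lambda>y. fder f y v) x w = fder (\<lambda>y. fder f y w) x v"
proof -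
  let ?P = "fder (\<lambda>y. fder f y v) x w" and ?Q = "fder (\<lambda>y. fder f y w) x v"
  have "norm (?P - ?Q) \<le> e" if e: "e > 0" for e
  proof -
    have e2: "e / 2 > 0" using e by simp
    obtain d1 d2 where d: "d1 > 0" "d2 > 0"
      and 1: "\<And>h. 0 < h \<and> h < d1 \<Longrightarrow>
        norm (f (x + h *\<^sub>R v + h *\<^sub>R w) - f (x + h *\<^sub>R v) - f (x + h *\<^sub>R w) + f x - (h * h) *\<^sub>R ?P) \<le> e/2 * (h * h)"
      and 2: "\<And>h. 0 < h \<and> h < d2 \<Longrightarrow>
        norm (f (x + h *\<^sub>R w + h *\<^sub>R v) - f (x + h *\<^sub>R w) - f (x + h *\<^sub>R v) + f x - (h * h) *\<^sub>R ?Q) \<le> e/2 * (h * h)"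
      using second_difference_bound[OF S f e2, of v w] second_difference_bound[OF S f e2, of w v] by blast
    define h where "h = min d1 d2 / 2"
    have h: "0 < h" "h < d1" "h < d2" unfolding h_def using d by auto
    let ?A = "f (x + h *\<^sub>R v + h *\<^sub>R w) - f (x + h *\<^sub>R v) - f (x + h *\<^sub>R w) + f x"
    have A: "f (x + h *\<^sub>R w + h *\<^sub>R v) - f (x + h *\<^sub>R w) - f (x + h *\<^sub>R v) + f x = ?A"
      by (simp add: algebra_simps)
    have b: "norm (?A - (h * h) *\<^sub>R ?Q) \<le> e/2 * (h * h)" using 2[of h] h unfolding A by blast
    have a: "norm (?A - (h * h) *\<^sub>R ?P) \<le> e/2 * (h * h)" using 1[of h] h by blast
    have PQ: "(h * h) *\<^sub>R (?P - ?Q) = (?A - (h * h) *\<^sub>R ?Q) - (?A - (h * h) *\<^sub>R ?P)"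
      by (simp add: algebra_simps)
    have "norm ((h * h) *\<^sub>R (?P - ?Q)) \<le> e/2 * (h * h) + e/2 * (h * h)"
      unfolding PQ using norm_triangle_ineq4[of "?A - (h * h) *\<^sub>R ?Q" "?A - (h * h) *\<^sub>R ?P"] a b by linarith
    moreover have "norm ((h * h) *\<^sub>R (?P - ?Q)) = (h * h) * norm (?P - ?Q)"
      by (simp only: norm_scaleR abs_mult abs_mult_self_eq)
    moreover have "e/2 * (h * h) + e/2 * (h * h) = (h * h) * e" by simp
    ultimately have "(h * h) * norm (?P - ?Q) \<le> (h * h) * e" by linarith
    then show ?thesis using h by (simp add: mult_le_cancel_left)
  qed
  then have "norm (?P - ?Q) \<le> 0" by (meson field_le_epsilon add_0 order_refl le_numeral_extra(3) dense_ge)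
  then show ?thesis by simp
qed

section \<open>Manifolds in charts\<close>

lemma isCont_eventually_nhds:
  assumes "isCont f x" "\<forall>\<^sub>F y in nhds (f x). P y"
  shows "\<forall>\<^sub>F z in nhds x. P (f z)"
proof -
  have "filterlim f (nhds (f x)) (nhds x)" using assms(1) by (simp add: isCont_def tendsto_at_iff_tendsto_nhds)
  then show ?thesis using assms(2) unfolding filterlim_iff by blast
qed

abbreviation chart_im :: "('m, 'e) charts \<Rightarrow> 'm \<Rightarrow> 'e set" where
  "chart_im C p \<equiv> chart_map C p ` chart_dom C p"

text \<open>Unlike in \<open>tangent_map\<close>, the charts at \<open>p\<close> and
  \<open>q\<close> are chosen independently of the point of evaluation, so that a whole
  neighbourhood is treated in one fixed pair of charts. For \<open>f = id\<close> this is a change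
  of charts.\<close>

definition local_rep :: "('m, 'e) charts \<Rightarrow> ('n, 'f) charts \<Rightarrow> 'm \<Rightarrow> 'n \<Rightarrow> ('m \<Rightarrow> 'n) \<Rightarrow> 'e \<Rightarrow> 'f" where
  "local_rep C D p q f = chart_map D q \<circ> f \<circ> chart_inv C p"

context
  fixes C :: "('m::t2_space, 'e::banach) charts"
  assumes C: "smooth_manifold C"
begin

lemma manifold_fin_dim: "fin_dim TYPE('e)"
  using C unfolding smooth_manifold_def fin_dim_def by blast

lemma chart_homeo:
  "homeomorphism (chart_dom C p) (chart_im C p) (chart_map C p) (chart_inv C p)"
  using C unfolding smooth_manifold_def by blast

lemma open_chart_dom: "open (chart_dom C p)"
  and open_chart_im: "open (chart_im C p)"
  and chart_dom_self: "p \<in> chart_dom C p"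
  using C unfolding smooth_manifold_def by blast+

lemma chart_inv_map: "x \<in> chart_dom C p \<Longrightarrow> chart_inv C p (chart_map C p x) = x"
  using chart_homeo[of p] unfolding homeomorphism_def by blast

lemma chart_map_inv: "y \<in> chart_im C p \<Longrightarrow> chart_map C p (chart_inv C p y) = y"
  using chart_homeo[of p] unfolding homeomorphism_def by blast

lemma chart_inv_dom: "y \<in> chart_im C p \<Longrightarrow> chart_inv C p y \<in> chart_dom C p"
  using chart_homeo[of p] unfolding homeomorphism_def by blast

lemma inj_on_chart_map: "inj_on (chart_map C p) (chart_dom C p)"
  by (rule inj_on_inverseI[of _ "chart_inv C p"]) (rule chart_inv_map)

lemma isCont_chart_inv: "y \<in> chart_im C p \<Longrightarrow> isCont (chart_inv C p) y"
  using chart_homeo[of p] continuous_on_eq_continuous_at[OF open_chart_im, of p] homeomorphism_cont2 by blast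

lemma open_chart_map_image:
  assumes "open U" shows "open (chart_map C p ` (chart_dom C p \<inter> U))"
proof -
  have "openin (top_of_set (chart_im C p)) (chart_map C p ` (chart_dom C p \<inter> U))"
    using homeomorphism_imp_open_map[OF chart_homeo] assms by (simp add: openin_open_Int)
  then show ?thesis using open_chart_im openin_open_trans by blast
qed

lemma eventually_chart_inv:
  assumes "x \<in> chart_dom C p" "\<forall>\<^sub>F z in nhds x. P z"
  shows "\<forall>\<^sub>F y in nhds (chart_map C p x). y \<in> chart_im C p \<and> P (chart_inv C p y)"
proof -
  have 1: "\<forall>\<^sub>F y in nhds (chart_map C p x). y \<in> chart_im C p"
    using open_chart_im[of p] assms(1) by (intro eventually_nhds_in_open) auto
  have "isCont (chart_inv C p) (chart_map C p x)" using assms(1) isCont_chart_inv by blast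
  then have "\<forall>\<^sub>F y in nhds (chart_map C p x). P (chart_inv C p y)"
    by (rule isCont_eventually_nhds) (simp add: chart_inv_map assms)
  with 1 show ?thesis by (rule eventually_conj)
qed

lemma smooth_map_id: "smooth_map C C id"
proof -
  have "smooth_on (chart_map C p ` (chart_dom C p \<inter> id -` chart_dom C q)) (chart_map C q \<circ> id \<circ> chart_inv C p)" for p q
    using C unfolding smooth_manifold_def by simp
  then show ?thesis unfolding smooth_map_def by (simp add: continuous_on_id)
qed

end

lemma local_rep_map:
  assumes "smooth_manifold C" "x \<in> chart_dom C p"
  shows "local_rep C D p q f (chart_map C p x) = chart_map D q (f x)"
  using chart_inv_map[OF assms] by (simp add: local_rep_def)

lemma has_derivative_eventually_cong:
  assumes "(f has_derivative f') (at x)" "\<forall>\<^sub>F y in nhds x. f y = g y"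
  shows "(g has_derivative f') (at x)"
proof (rule has_derivative_transform_eventually[OF assms(1)])
  show "\<forall>\<^sub>F y in at x. f y = g y" using assms(2) unfolding eventually_at_filter by (rule eventually_mono) simp
  show "f x = g x" using assms(2) by (rule eventually_nhds_x_imp_x)
qed simp

text \<open>The chart expressions compose only where \<open>f\<close> lands in the chart at
  \<open>q\<close>. Continuity of \<open>f\<close> at \<open>x\<close> makes this hold near
  \<open>x\<close>, which is enough for a derivative.\<close>

lemma has_derivative_local_rep_compose:
  fixes C :: "('m::t2_space, 'e::banach) charts" and D :: "('n::t2_space, 'f::banach) charts"
    and E :: "('k, 'l::real_normed_vector) charts"
  assumes C: "smooth_manifold C" and D: "smooth_manifold D"
    and x: "x \<in> chart_dom C p" "isCont f x" "f x \<in> chart_dom D q"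
    and f: "(local_rep C D p q f has_derivative f') (at (chart_map C p x))"
    and g: "(local_rep D E q r g has_derivative g') (at (chart_map D q (f x)))"
  shows "(local_rep C E p r (g \<circ> f) has_derivative (\<lambda>v. g' (f' v))) (at (chart_map C p x))"
proof -
  have g': "(local_rep D E q r g has_derivative g') (at (local_rep C D p q f (chart_map C p x)))"
    using g local_rep_map[OF C x(1)] by metis
  show ?thesis
  proof (rule has_derivative_eventually_cong[OF has_derivative_compose[OF f g']])
    have "\<forall>\<^sub>F z in nhds x. f z \<in> chart_dom D q"
      by (rule isCont_eventually_nhds[OF x(2)]) (rule eventually_nhds_in_open[OF open_chart_dom[OF D] x(3)])
    from eventually_chart_inv[OF C x(1) this]
    show "\<forall>\<^sub>F y in nhds (chart_map C p x). local_rep D E q r g (local_rep C D p q f y) = local_rep C E p r (g \<circ> f) y"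
      by (rule eventually_mono) (auto simp: local_rep_def chart_inv_map[OF D])
  qed
qed

lemma has_vector_derivative_curve_compose:
  fixes D :: "('n::t2_space, 'f::banach) charts" and E :: "('k, 'l::real_normed_vector) charts"
  assumes D: "smooth_manifold D" and c: "isCont c (t::real)" "c t \<in> chart_dom D q"
    and v: "((\<lambda>s. chart_map D q (c s)) has_vector_derivative v) (at t)"
    and g: "(local_rep D E q r g has_derivative g') (at (chart_map D q (c t)))"
  shows "((\<lambda>s. chart_map E r (g (c s))) has_vector_derivative g' v) (at t)"
proof -
  have "((\<lambda>s. local_rep D E q r g (chart_map D q (c s))) has_vector_derivative g' v) (at t)"
    by (rule has_vector_derivative_compose_fder[where f = "local_rep D E q r g" and c = "\<lambda>s. chart_map D q (c s)", OF g v])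
  moreover have "\<forall>\<^sub>F s in nhds t. local_rep D E q r g (chart_map D q (c s)) = chart_map E r (g (c s))"
    using isCont_eventually_nhds[OF c(1) eventually_nhds_in_open[OF open_chart_dom[OF D] c(2)]]
    by (rule eventually_mono) (rule local_rep_map[OF D])
  ultimately show ?thesis
    unfolding has_vector_derivative_def by (rule has_derivative_eventually_cong)
qed

lemma smooth_map_isCont: "smooth_map C D f \<Longrightarrow> isCont f x"
  unfolding smooth_map_def by (simp add: continuous_on_eq_continuous_at)

lemma smooth_map_local_rep:
  fixes C :: "('m::t2_space, 'e::banach) charts" and D :: "('n::t2_space, 'f::banach) charts"
  assumes C: "smooth_manifold C" and D: "smooth_manifold D" and f: "smooth_map C D f"
  shows "open (chart_map C p ` (chart_dom C p \<inter> f -` chart_dom D q))"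
    and "smooth_on (chart_map C p ` (chart_dom C p \<inter> f -` chart_dom D q)) (local_rep C D p q f)"
proof -
  have "open (f -` chart_dom D q)"
    using f open_chart_dom[OF D] unfolding smooth_map_def by (simp add: open_vimage)
  then show "open (chart_map C p ` (chart_dom C p \<inter> f -` chart_dom D q))"
    by (rule open_chart_map_image[OF C])
  show "smooth_on (chart_map C p ` (chart_dom C p \<inter> f -` chart_dom D q)) (local_rep C D p q f)"
    using f unfolding smooth_map_def local_rep_def by blast
qed

lemma smooth_map_has_derivative:
  fixes C :: "('m::t2_space, 'e::banach) charts" and D :: "('n::t2_space, 'f::banach) charts"
  assumes "smooth_manifold C" "smooth_manifold D" "smooth_map C D f" "x \<in> chart_dom C p" "f x \<in> chart_dom D q"
  shows "(local_rep C D p q f has_derivative fder (local_rep C D p q f) (chart_map C p x)) (at (chart_map C p x))"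
  by (rule smooth_on_has_derivative[OF smooth_map_local_rep(2)[OF assms(1-3)]]) (use assms in auto)

lemma fder_local_rep_compose:
  fixes C :: "('m::t2_space, 'e::banach) charts" and D :: "('n::t2_space, 'f::banach) charts"
    and E :: "('k::t2_space, 'l::banach) charts"
  assumes CDE: "smooth_manifold C" "smooth_manifold D" "smooth_manifold E"
    and f: "smooth_map C D f" and g: "smooth_map D E g"
    and x: "x \<in> chart_dom C p" "f x \<in> chart_dom D q" "g (f x) \<in> chart_dom E r"
  shows "fder (local_rep C E p r (g \<circ> f)) (chart_map C p x) v =
    fder (local_rep D E q r g) (chart_map D q (f x)) (fder (local_rep C D p q f) (chart_map C p x) v)"
  using fder_eqI[OF has_derivative_local_rep_compose[OF CDE(1,2) x(1) smooth_map_isCont[OF f] x(2)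
      smooth_map_has_derivative[OF CDE(1,2) f x(1,2)] smooth_map_has_derivative[OF CDE(2,3) g x(2,3)]]] by metis

lemma fder_local_rep_id:
  fixes C :: "('m::t2_space, 'e::banach) charts"
  assumes C: "smooth_manifold C" and x: "x \<in> chart_dom C p"
  shows "fder (local_rep C C p p id) (chart_map C p x) v = v"
proof -
  have "(local_rep C C p p id has_derivative (\<lambda>v. v)) (at (chart_map C p x))"
  proof (rule has_derivative_eventually_cong[OF has_derivative_ident])
    show "\<forall>\<^sub>F y in nhds (chart_map C p x). y = local_rep C C p p id y"
      using eventually_nhds_in_open[OF open_chart_im[OF C], of "chart_map C p x" p] x
      by (auto elim!: eventually_mono simp: local_rep_def chart_inv_map[OF C])
  qed
  then show ?thesis by (simp add: fder_eqI)
qed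

lemma smooth_map_curve:
  fixes c :: "real \<Rightarrow> 'm::t2_space"
  shows "smooth_map vector_space_charts C c \<longleftrightarrow>
    continuous_on UNIV c \<and> (\<forall>q. smooth_on (c -` chart_dom C q) (\<lambda>s. chart_map C q (c s)))"
proof -
  have "inv_into UNIV id = (id :: real \<Rightarrow> real)" using inv_id by blast
  then show ?thesis
    by (simp add: smooth_map_def vector_space_charts_def chart_dom_def chart_map_def chart_inv_def o_def id_def)
qed

text \<open>The inverse of a product chart is an \<open>inv_into\<close> on a product set and splits
  into the two inverses only on the image of the chart. Hence the explicit domain \<open>W\<close>,
  whose openness is established alongside.\<close>

lemma smooth_map_prod_charts:
  fixes C :: "('m::t2_space, 'e::banach) charts" and D :: "('n::t2_space, 'f::banach) charts"
    and E :: "('k::t2_space, 'l::banach) charts" and p q r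
  assumes C: "smooth_manifold C" and D: "smooth_manifold D" and E: "smooth_manifold E"
    and f: "smooth_map (prod_charts C D) E (\<lambda>(a, b). f a b)"
  defines "W \<equiv> {z. fst z \<in> chart_im C p \<and> snd z \<in> chart_im D q \<and>
      f (chart_inv C p (fst z)) (chart_inv D q (snd z)) \<in> chart_dom E r}"
  shows "open W" "smooth_on W (\<lambda>z. chart_map E r (f (chart_inv C p (fst z)) (chart_inv D q (snd z))))"
proof -
  let ?A = "{ab. f (fst ab) (snd ab) \<in> chart_dom E r}"
  have cont: "continuous_on UNIV (\<lambda>(a, b). f a b)" using f unfolding smooth_map_def by blast
  then have oA: "open ?A"
    using open_vimage[OF open_chart_dom[OF E] cont, of r] by (simp add: vimage_def case_prod_beta)
  have W: "W = (chart_im C p \<times> chart_im D q) \<inter> (\<lambda>z. (chart_inv C p (fst z), chart_inv D q (snd z))) -` ?A"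
    unfolding W_def by auto
  have "continuous_on (chart_im C p \<times> chart_im D q) (\<lambda>z. (chart_inv C p (fst z), chart_inv D q (snd z)))"
    by (intro continuous_on_Pair
        continuous_on_compose2[OF homeomorphism_cont2[OF chart_homeo[OF C]] continuous_on_fst[OF continuous_on_id]]
        continuous_on_compose2[OF homeomorphism_cont2[OF chart_homeo[OF D]] continuous_on_snd[OF continuous_on_id]])
      auto
  then show oW: "open W"
    unfolding W using oA open_chart_im[OF C] open_chart_im[OF D] by (intro continuous_open_preimage open_Times)
  have inv: "chart_inv (prod_charts C D) (p, q) (chart_map C p a, chart_map D q b) = (a, b)"
    if "a \<in> chart_dom C p" "b \<in> chart_dom D q" for a b
  proof -
    have "inj_on (map_prod (chart_map C p) (chart_map D q)) (chart_dom C p \<times> chart_dom D q)"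
      using inj_on_chart_map[OF C, of p] inj_on_chart_map[OF D, of q] by (rule map_prod_inj_on)
    from inv_into_f_f[OF this, of "(a, b)"] show ?thesis
      using that by (simp add: chart_inv_def prod_charts_def chart_dom_def chart_map_def)
  qed
  let ?S = "chart_map (prod_charts C D) (p, q) ` (chart_dom (prod_charts C D) (p, q) \<inter> (\<lambda>(a, b). f a b) -` chart_dom E r)"
  have pc: "chart_map (prod_charts C D) (p, q) = map_prod (chart_map C p) (chart_map D q)"
    "chart_dom (prod_charts C D) (p, q) = chart_dom C p \<times> chart_dom D q"
    by (simp_all add: prod_charts_def chart_dom_def chart_map_def)
  have S: "W \<subseteq> ?S"
  proof
    fix z assume "z \<in> W"
    then obtain a b where z: "z = (chart_map C p a, chart_map D q b)" and ab: "a \<in> chart_dom C p" "b \<in> chart_dom D q"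
      and "f (chart_inv C p (fst z)) (chart_inv D q (snd z)) \<in> chart_dom E r"
      unfolding W_def by (cases z) auto
    then have "f a b \<in> chart_dom E r" by (simp add: chart_inv_map[OF C] chart_inv_map[OF D])
    then show "z \<in> ?S" unfolding pc z using ab by (intro image_eqI[of _ _ "(a, b)"]) auto
  qed
  have "smooth_on ?S (chart_map E r \<circ> (\<lambda>(a, b). f a b) \<circ> chart_inv (prod_charts C D) (p, q))"
    using f unfolding smooth_map_def by blast
  then have "smooth_on W (chart_map E r \<circ> (\<lambda>(a, b). f a b) \<circ> chart_inv (prod_charts C D) (p, q))"
    using S by (rule smooth_on_subset)
  then show "smooth_on W (\<lambda>z. chart_map E r (f (chart_inv C p (fst z)) (chart_inv D q (snd z))))"
  proof (rule smooth_on_cong[OF oW])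
    fix z assume "z \<in> W"
    then obtain a b where z: "z = (chart_map C p a, chart_map D q b)" and ab: "a \<in> chart_dom C p" "b \<in> chart_dom D q"
      unfolding W_def by (cases z) auto
    then show "(chart_map E r \<circ> (\<lambda>(a, b). f a b) \<circ> chart_inv (prod_charts C D) (p, q)) z =
        chart_map E r (f (chart_inv C p (fst z)) (chart_inv D q (snd z)))"
      by (simp add: inv chart_inv_map[OF C] chart_inv_map[OF D])
  qed
qed


lemma smooth_map_prod_right:
  fixes C :: "('m::t2_space, 'e::banach) charts" and D :: "('n::t2_space, 'f::banach) charts"
    and E :: "('k::t2_space, 'l::banach) charts"
  assumes CDE: "smooth_manifold C" "smooth_manifold D" "smooth_manifold E"
    and f: "smooth_map (prod_charts C D) E (\<lambda>(a, b). f a b)"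
  shows "smooth_map D E (f a)"
proof -
  have "continuous_on UNIV (\<lambda>(a, b). f a b)" using f unfolding smooth_map_def by blast
  then have "continuous_on UNIV (\<lambda>b. (\<lambda>(a, b). f a b) (a, b))"
    by (rule continuous_on_compose2) (auto intro!: continuous_intros)
  then have cont: "continuous_on UNIV (f a)" by simp
  have "smooth_on (chart_map D q ` (chart_dom D q \<inter> f a -` chart_dom E r)) (chart_map E r \<circ> f a \<circ> chart_inv D q)" for q r
  proof -
    let ?S = "chart_map D q ` (chart_dom D q \<inter> f a -` chart_dom E r)"
    have oS: "open ?S"
      using open_chart_map_image[OF CDE(2) open_vimage[OF open_chart_dom[OF CDE(3)] cont]] .
    have pr: "smooth_on ?S (\<lambda>y. (chart_map C a a, y))"
      by (intro smooth_on_Pair[OF oS] smooth_on_const smooth_on_id)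
    have sub: "(\<lambda>y. (chart_map C a a, y)) ` ?S \<subseteq> {z. fst z \<in> chart_im C a \<and> snd z \<in> chart_im D q \<and> f (chart_inv C a (fst z)) (chart_inv D q (snd z)) \<in> chart_dom E r}"
      by (auto simp: chart_inv_map[OF CDE(1)] chart_inv_map[OF CDE(2)] chart_dom_self[OF CDE(1)])
    from smooth_on_compose[OF fin_dim_prod[OF manifold_fin_dim[OF CDE(1)] manifold_fin_dim[OF CDE(2)]] oS sub
          smooth_map_prod_charts(2)[OF CDE f, of a q r] pr]
    show ?thesis
      by (simp add: o_def chart_inv_map[OF CDE(1)] chart_dom_self[OF CDE(1)])
  qed
  then show ?thesis unfolding smooth_map_def using cont by blast
qed

lemma smooth_map_prod_left:
  fixes C :: "('m::t2_space, 'e::banach) charts" and D :: "('n::t2_space, 'f::banach) charts"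
    and E :: "('k::t2_space, 'l::banach) charts"
  assumes CDE: "smooth_manifold C" "smooth_manifold D" "smooth_manifold E"
    and f: "smooth_map (prod_charts C D) E (\<lambda>(a, b). f a b)"
  shows "smooth_map C E (\<lambda>a. f a b)"
proof -
  have "continuous_on UNIV (\<lambda>(a, b). f a b)" using f unfolding smooth_map_def by blast
  then have "continuous_on UNIV (\<lambda>a. (\<lambda>(a, b). f a b) (a, b))"
    by (rule continuous_on_compose2) (auto intro!: continuous_intros)
  then have cont: "continuous_on UNIV (\<lambda>a. f a b)" by simp
  have "smooth_on (chart_map C p ` (chart_dom C p \<inter> (\<lambda>a. f a b) -` chart_dom E r)) (chart_map E r \<circ> (\<lambda>a. f a b) \<circ> chart_inv C p)" for p r
  proof -
    let ?S = "chart_map C p ` (chart_dom C p \<inter> (\<lambda>a. f a b) -` chart_dom E r)"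
    have oS: "open ?S"
      using open_chart_map_image[OF CDE(1) open_vimage[OF open_chart_dom[OF CDE(3)] cont]] .
    have pr: "smooth_on ?S (\<lambda>x. (x, chart_map D b b))"
      by (intro smooth_on_Pair[OF oS] smooth_on_const smooth_on_id)
    have sub: "(\<lambda>x. (x, chart_map D b b)) ` ?S \<subseteq> {z. fst z \<in> chart_im C p \<and> snd z \<in> chart_im D b \<and> f (chart_inv C p (fst z)) (chart_inv D b (snd z)) \<in> chart_dom E r}"
      by (auto simp: chart_inv_map[OF CDE(1)] chart_inv_map[OF CDE(2)] chart_dom_self[OF CDE(2)])
    from smooth_on_compose[OF fin_dim_prod[OF manifold_fin_dim[OF CDE(1)] manifold_fin_dim[OF CDE(2)]] oS sub
          smooth_map_prod_charts(2)[OF CDE f, of p b r] pr]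
    show ?thesis
      by (simp add: o_def chart_inv_map[OF CDE(2)] chart_dom_self[OF CDE(2)])
  qed
  then show ?thesis unfolding smooth_map_def using cont by blast
qed

section \<open>Ordinary differential equations\<close>

text \<open>Picard iteration. The solution is recorded on an open interval beginning at the initial
  time and without its initial value: a two-sided solution through the identity of the group is
  later obtained by a shift in time and a left translation.\<close>

lemma autonomous_ode_local_solution:
  fixes V :: "'a::banach \<Rightarrow> 'a"
  assumes r: "r > 0" and K: "K \<ge> 0"
    and bd: "\<And>x. x \<in> cball x0 r \<Longrightarrow> norm (V x) \<le> K"
    and lip: "\<And>x y. x \<in> cball x0 r \<Longrightarrow> y \<in> cball x0 r \<Longrightarrow> norm (V x - V y) \<le> K * norm (x - y)"
  obtains T y where "T > 0" "\<And>t. t \<in> {0<..<T} \<Longrightarrow> y t \<in> cball x0 r"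
    "\<And>t. t \<in> {0<..<T} \<Longrightarrow> (y has_vector_derivative V (y t)) (at t)"
proof -
  \<comment> \<open>The first bound keeps the integral over [0, T] within \<open>r\<close>, the
    second makes the contraction factor \<open>T * K\<close> at most 1/2. The denominators contain
    \<open>K + 1\<close> to allow \<open>K = 0\<close>.\<close>
  define T where "T = min (r / (K + 1)) (1 / (2 * (K + 1)))"
  have T: "T > 0" unfolding T_def using r K by simp
  have TK: "T * K \<le> r" "T * K \<le> 1/2"
  proof -
    have "T * K \<le> T * (K + 1)" using T by (simp add: mult_left_mono)
    moreover have "T * (K + 1) \<le> r / (K + 1) * (K + 1)" "T * (K + 1) \<le> 1 / (2 * (K + 1)) * (K + 1)"
      unfolding T_def using K by (intro mult_right_mono; simp)+
    moreover have "r / (K + 1) * (K + 1) = r" "1 / (2 * (K + 1)) * (K + 1) = 1/2" using K by auto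
    ultimately show "T * K \<le> r" "T * K \<le> 1/2" by linarith+
  qed
  have Vc: "continuous_on (cball x0 r) V"
  proof (rule lipschitz_on_continuous_on)
    show "K-lipschitz_on (cball x0 r) V" using lip K by (auto intro!: lipschitz_onI simp: dist_norm)
  qed
  \<comment> \<open>Clamping time to [0, T] extends the iterates to the whole line, so that the
    complete space of bounded continuous functions on \<open>real\<close> can be used.\<close>
  define cl where "cl = (\<lambda>t::real. max 0 (min T t))"
  have cl: "cl t \<in> {0..T}" for t unfolding cl_def using T by auto
  have clc: "continuous_on UNIV cl" unfolding cl_def by (intro continuous_intros)
  define S :: "(real \<Rightarrow>\<^sub>C 'a) set" where "S = PiC UNIV (\<lambda>_. cball x0 r)"
  have S: "f \<in> S \<longleftrightarrow> (\<forall>t. apply_bcontfun f t \<in> cball x0 r)" for f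
    unfolding S_def mem_PiC_iff by auto
  have Vf: "continuous_on A (\<lambda>s. V (apply_bcontfun f s))" if "f \<in> S" for f A
    by (rule continuous_on_compose2[OF Vc]) (use that S in auto)
  have Vint: "(\<lambda>s. V (apply_bcontfun f s)) integrable_on {0..t}" if "f \<in> S" for f t
    by (rule integrable_continuous_real[OF Vf[OF that]])
  define I where "I = (\<lambda>(f :: real \<Rightarrow>\<^sub>C 'a) t. x0 + integral {0..cl t} (\<lambda>s. V (apply_bcontfun f s)))"
  have Idist: "norm (I f t - x0) \<le> r" if f: "f \<in> S" for f t
  proof -
    have "norm (integral {0..cl t} (\<lambda>s. V (apply_bcontfun f s))) \<le> K * (cl t - 0)"
      by (rule integral_bound) (use cl[of t] Vf[OF f] bd f S in auto)
    also have "\<dots> \<le> K * T" using cl[of t] K by (simp add: mult_left_mono)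
    finally show ?thesis using TK by (simp add: I_def mult.commute)
  qed
  have Icont: "continuous_on UNIV (I f)" if f: "f \<in> S" for f
  proof -
    have "continuous_on {0..T} (\<lambda>u. integral {0..u} (\<lambda>s. V (apply_bcontfun f s)))"
      by (rule indefinite_integral_continuous_1[OF Vint[OF f]])
    then have "continuous_on UNIV (\<lambda>t. integral {0..cl t} (\<lambda>s. V (apply_bcontfun f s)))"
      by (rule continuous_on_compose2[OF _ clc]) (use cl in auto)
    then show ?thesis unfolding I_def by (intro continuous_intros)
  qed
  have Ib: "I f \<in> bcontfun" if f: "f \<in> S" for f
  proof (rule bcontfun_normI[OF Icont[OF f]])
    fix t
    have "norm (I f t) \<le> norm x0 + norm (I f t - x0)"
      using norm_triangle_ineq[of x0 "I f t - x0"] by simp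
    then show "norm (I f t) \<le> norm x0 + r" using Idist[OF f, of t] by linarith
  qed
  define \<Phi> where "\<Phi> = (\<lambda>f. Bcontfun (I f))"
  have \<Phi>: "apply_bcontfun (\<Phi> f) = I f" if "f \<in> S" for f
    unfolding \<Phi>_def using Ib[OF that] by (simp add: Bcontfun_inverse)
  have "\<exists>!f. f \<in> S \<and> \<Phi> f = f"
  proof (rule Banach_fix)
    show "complete S"
      using closed_PiC[of UNIV "\<lambda>_. cball x0 r"] unfolding S_def by (simp add: complete_eq_closed)
    have "const_bcontfun x0 \<in> S" using S r by (simp add: const_bcontfun.rep_eq)
    then show "S \<noteq> {}" by blast
    show "0 \<le> (1/2::real)" "1/2 < (1::real)" by auto
    show "\<Phi> ` S \<subseteq> S"
      using Idist by (auto simp: S \<Phi> dist_norm norm_minus_commute)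
    show "dist (\<Phi> f) (\<Phi> g) \<le> 1/2 * dist f g" if f: "f \<in> S" and g: "g \<in> S" for f g
    proof (rule dist_bound)
      fix t
      have "I f t - I g t = integral {0..cl t} (\<lambda>s. V (apply_bcontfun f s) - V (apply_bcontfun g s))"
        unfolding I_def by (simp add: integral_diff[OF Vint[OF f] Vint[OF g]])
      moreover have "norm \<dots> \<le> (K * dist f g) * (cl t - 0)"
      proof (rule integral_bound)
        show "norm (V (apply_bcontfun f s) - V (apply_bcontfun g s)) \<le> K * dist f g" for s
        proof -
          have "norm (V (apply_bcontfun f s) - V (apply_bcontfun g s)) \<le> K * norm (apply_bcontfun f s - apply_bcontfun g s)"
            using lip f g S by blast
          also have "\<dots> \<le> K * dist f g"
            using dist_bounded[of f s g] K by (intro mult_left_mono) (auto simp: dist_norm)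
          finally show ?thesis .
        qed
      qed (use cl[of t] Vf f g in \<open>auto intro!: continuous_intros\<close>)
      moreover have "(K * dist f g) * (cl t - 0) \<le> (K * dist f g) * T"
        using cl[of t] K by (intro mult_left_mono) auto
      moreover have "(T * K) * dist f g \<le> 1/2 * dist f g" using TK by (intro mult_right_mono) auto
      ultimately show "dist (apply_bcontfun (\<Phi> f) t) (apply_bcontfun (\<Phi> g) t) \<le> 1/2 * dist f g"
        by (simp add: \<Phi> f g dist_norm mult_ac)
    qed
  qed
  then obtain f where f: "f \<in> S" "\<Phi> f = f" by blast
  define y where "y = apply_bcontfun f"
  have y: "y t = x0 + integral {0..cl t} (\<lambda>s. V (y s))" for t
    using \<Phi>[OF f(1)] f(2) unfolding y_def I_def by metis
  have "(y has_vector_derivative V (y t)) (at t)" if t: "t \<in> {0<..<T}" for t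
  proof -
    have "((\<lambda>u. integral {0..u} (\<lambda>s. V (y s))) has_vector_derivative V (y t)) (at t within {0..T})"
      by (rule integral_has_vector_derivative) (use t Vf[OF f(1)] in \<open>auto simp: y_def\<close>)
    then have "((\<lambda>u. integral {0..u} (\<lambda>s. V (y s))) has_vector_derivative V (y t)) (at t within {0<..<T})"
      by (rule has_vector_derivative_within_subset) auto
    then have "((\<lambda>u. integral {0..u} (\<lambda>s. V (y s))) has_vector_derivative V (y t)) (at t)"
      using at_within_open[OF t open_greaterThanLessThan] by simp
    from has_vector_derivative_add[OF has_vector_derivative_const[of x0] this]
    have "((\<lambda>u. x0 + integral {0..u} (\<lambda>s. V (y s))) has_vector_derivative V (y t)) (at t)" by simp
    then show ?thesis
    proof (rule has_vector_derivative_transform_within_open[where S = "{0<..<T}"])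
      show "x0 + integral {0..u} (\<lambda>s. V (y s)) = y u" if "u \<in> {0<..<T}" for u
        using y[of u] that by (simp add: cl_def)
    qed (use t in auto)
  qed
  moreover have "y t \<in> cball x0 r" for t using f(1) S y_def by auto
  ultimately show ?thesis using that[OF T] by blast
qed

text \<open>Smoothness gives continuity of x \<mapsto> DV(x) b for each fixed b. Bounding these
  values near \<open>x0\<close> for the finitely many basis vectors bounds the operator norm there,
  and the mean value inequality applies on the convex ball.\<close>

lemma smooth_on_locally_lipschitz:
  fixes V :: "'a::real_normed_vector \<Rightarrow> 'b::real_normed_vector"
  assumes fd: "fin_dim TYPE('a)" and U: "open U" "x0 \<in> U" and V: "smooth_on U V"
  obtains r K where "r > 0" "K \<ge> 0" "cball x0 r \<subseteq> U" "\<And>x. x \<in> cball x0 r \<Longrightarrow> norm (V x) \<le> K"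
    "\<And>x y. x \<in> cball x0 r \<Longrightarrow> y \<in> cball x0 r \<Longrightarrow> norm (V x - V y) \<le> K * norm (x - y)"
proof -
  obtain B :: "'a set" and c where c: "finite B" "\<And>b. bounded_linear (\<lambda>x. c x b)"
    and cx: "\<And>x. x = (\<Sum>b\<in>B. c x b *\<^sub>R b)" using fin_dim_coords[OF fd] by blast
  have near: "\<forall>\<^sub>F x in nhds x0. norm (f x) < norm (f x0) + 1"
    if "continuous_on U f" for f :: "'a \<Rightarrow> 'b"
  proof -
    have "isCont (\<lambda>x. norm (f x)) x0"
      using that U by (simp add: continuous_on_eq_continuous_at)
    then show ?thesis
      by (rule isCont_eventually_nhds) (rule eventually_nhds_in_open[of "{..<norm (f x0) + 1}", simplified], simp)
  qed
  have "\<forall>\<^sub>F x in nhds x0. x \<in> U" using U by (rule eventually_nhds_in_open)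
  moreover have "\<forall>\<^sub>F x in nhds x0. norm (V x) < norm (V x0) + 1"
    by (rule near[OF smooth_on_continuous_on[OF V]])
  moreover have "\<forall>\<^sub>F x in nhds x0. \<forall>b\<in>B. norm (fder V x b) < norm (fder V x0 b) + 1"
    using c(1) near[OF smooth_on_continuous_on[OF smooth_on_deriv[OF V]]] by (simp add: eventually_ball_finite)
  ultimately have "\<forall>\<^sub>F x in nhds x0. x \<in> U \<and> norm (V x) < norm (V x0) + 1 \<and>
      (\<forall>b\<in>B. norm (fder V x b) < norm (fder V x0 b) + 1)" by eventually_elim auto
  then obtain d where d: "d > 0" "\<And>x. dist x x0 < d \<Longrightarrow> x \<in> U \<and> norm (V x) < norm (V x0) + 1 \<and>
      (\<forall>b\<in>B. norm (fder V x b) < norm (fder V x0 b) + 1)" unfolding eventually_nhds_metric by blast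
  define r where "r = d / 2"
  have r: "r > 0" and rd: "dist x x0 < d" if "x \<in> cball x0 r" for x
    using d(1) that unfolding r_def by (auto simp: dist_commute)
  define K1 where "K1 = (\<Sum>b\<in>B. onorm (\<lambda>x. c x b) * (norm (fder V x0 b) + 1))"
  define K where "K = max K1 (norm (V x0) + 1)"
  have K: "K \<ge> 0" unfolding K_def by (simp add: le_max_iff_disj)
  have on: "onorm (fder V x) \<le> K" if x: "x \<in> cball x0 r" for x
  proof (rule onorm_bound[OF K])
    fix v
    have lin: "linear (fder V x)"
      using smooth_on_has_derivative[OF V] d(2)[OF rd[OF x]] has_derivative_linear by blast
    have "norm (fder V x v) = norm (\<Sum>b\<in>B. c v b *\<^sub>R fder V x b)"
      using linear_coords[OF lin cx[of v]] by simp
    also have "\<dots> \<le> (\<Sum>b\<in>B. (onorm (\<lambda>x. c x b) * norm v) * (norm (fder V x0 b) + 1))"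
    proof (rule sum_norm_le)
      fix b assume b: "b \<in> B"
      have "\<bar>c v b\<bar> \<le> onorm (\<lambda>x. c x b) * norm v" using onorm[OF c(2)[of b], of v] by simp
      moreover have "norm (fder V x b) \<le> norm (fder V x0 b) + 1" using d(2)[OF rd[OF x]] b by force
      ultimately show "norm (c v b *\<^sub>R fder V x b) \<le> (onorm (\<lambda>x. c x b) * norm v) * (norm (fder V x0 b) + 1)"
        by (simp add: mult_mono)
    qed
    also have "\<dots> = K1 * norm v" unfolding K1_def sum_distrib_right by (simp add: mult_ac)
    also have "\<dots> \<le> K * norm v" unfolding K_def by (intro mult_right_mono) auto
    finally show "norm (fder V x v) \<le> K * norm v" .
  qed
  have "norm (V x - V y) \<le> K * norm (x - y)" if "x \<in> cball x0 r" "y \<in> cball x0 r" for x y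
  proof (rule differentiable_bound[where S = "cball x0 r" and f' = "fder V"])
    show "(V has_derivative fder V x) (at x within cball x0 r)" if "x \<in> cball x0 r" for x
      using smooth_on_has_derivative[OF V] d(2)[OF rd[OF that]] has_derivative_at_withinI by blast
  qed (use that on in auto)
  moreover have "norm (V x) \<le> K" if "x \<in> cball x0 r" for x
    using d(2)[OF rd[OF that]] unfolding K_def by linarith
  moreover have "cball x0 r \<subseteq> U" using d(2) rd by blast
  moreover have "r > 0" using d(1) by (simp add: r_def)
  ultimately show ?thesis using that K by blast
qed

text \<open>Bootstrapping: if \<open>y\<close> is k times continuously differentiable, then so is
  the composition of \<open>V\<close> with \<open>y\<close>, which is the derivative of
  \<open>y\<close>.\<close>

lemma smooth_on_ode_solution:
  fixes y :: "real \<Rightarrow> 'a::real_normed_vector"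
  assumes fd: "fin_dim TYPE('a)" and I: "open I" and yU: "y ` I \<subseteq> U" and V: "smooth_on U V"
    and y: "\<And>s. s \<in> I \<Longrightarrow> (y has_vector_derivative V (y s)) (at s)"
  shows "smooth_on I y"
proof -
  have d: "fder y s = (\<lambda>h. h *\<^sub>R V (y s))" if "s \<in> I" for s
    using fder_eqI[OF y[OF that, unfolded has_vector_derivative_def]] .
  have "Ck_on k I y" for k
  proof (induction k)
    case 0
    show ?case using y by (auto intro!: continuous_at_imp_continuous_on has_vector_derivative_continuous)
  next
    case (Suc k)
    have "Ck_on k I (\<lambda>s. V (y s))"
      using V Suc unfolding smooth_on_def by (blast intro: Ck_on_compose[OF fd I yU])
    then have "Ck_on k I (\<lambda>s. h *\<^sub>R V (y s))" for h
      by (rule Ck_on_bounded_linear_compose[OF bounded_linear_scaleR_right I])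
    then have "Ck_on k I (\<lambda>s. fder y s h)" for h
      using Ck_on_cong[OF I, of "\<lambda>s. h *\<^sub>R V (y s)" "\<lambda>s. fder y s h" k] d by simp
    then show ?case
      using y unfolding has_vector_derivative_def by (auto intro: differentiableI)
  qed
  then show ?thesis unfolding smooth_on_def by blast
qed

section \<open>Curves with vanishing velocity\<close>

text \<open>The chart in which the velocity vanishes may vary with \<open>t\<close>. A change of
  charts transfers the vanishing to one chart near each time, which gives local constancy;
  connectedness of \<open>I\<close> does the rest.\<close>

lemma curve_velocity_zero_imp_const:
  fixes C :: "('m::t2_space, 'e::banach) charts" and c :: "real \<Rightarrow> 'm"
  assumes C: "smooth_manifold C" and I: "open I" "connected I" "a \<in> I" "b \<in> I"
    and c: "\<And>t. t \<in> I \<Longrightarrow> isCont c t"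
    and z: "\<And>t. t \<in> I \<Longrightarrow> \<exists>q. c t \<in> chart_dom C q \<and> ((\<lambda>s. chart_map C q (c s)) has_vector_derivative 0) (at t)"
  shows "c a = c b"
proof (rule connected_local_const[OF I(2-4)], intro ballI)
  fix t assume t: "t \<in> I"
  have "\<forall>\<^sub>F s in nhds t. c s \<in> chart_dom C (c t)"
    by (rule isCont_eventually_nhds[OF c[OF t]])
      (rule eventually_nhds_in_open[OF open_chart_dom[OF C] chart_dom_self[OF C]])
  moreover have "\<forall>\<^sub>F s in nhds t. s \<in> I" using I(1) t by (rule eventually_nhds_in_open)
  ultimately have "\<forall>\<^sub>F s in nhds t. c s \<in> chart_dom C (c t) \<and> s \<in> I" by eventually_elim auto
  then obtain e where e: "e > 0" "\<And>s. dist s t < e \<Longrightarrow> c s \<in> chart_dom C (c t) \<and> s \<in> I"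
    unfolding eventually_nhds_metric by blast
  have der: "((\<lambda>s. chart_map C (c t) (c s)) has_vector_derivative 0) (at s)" if "s \<in> ball t e" for s
  proof -
    have s: "c s \<in> chart_dom C (c t)" "s \<in> I" using e(2)[of s] that by (auto simp: dist_commute)
    then obtain q where q: "c s \<in> chart_dom C q" "((\<lambda>s. chart_map C q (c s)) has_vector_derivative 0) (at s)"
      using z by blast
    have d: "(local_rep C C q (c t) id has_derivative fder (local_rep C C q (c t) id) (chart_map C q (c s))) (at (chart_map C q (c s)))"
      by (rule smooth_map_has_derivative[OF C C smooth_map_id[OF C] q(1)]) (simp add: s)
    have "((\<lambda>s. chart_map C (c t) (id (c s))) has_vector_derivative
        fder (local_rep C C q (c t) id) (chart_map C q (c s)) 0) (at s)"
      by (rule has_vector_derivative_curve_compose[OF C c[OF s(2)] q d])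
    then show ?thesis using linear_0[OF has_derivative_linear[OF d]] by simp
  qed
  have loc: "c s = c t" if s: "s \<in> ball t e" for s
  proof -
    have "chart_map C (c t) (c s) = chart_map C (c t) (c t)"
    proof (rule has_vector_derivative_zero_constant[of "ball t e" "\<lambda>s. chart_map C (c t) (c s)"])
      fix k assume k: "\<And>s. s \<in> ball t e \<Longrightarrow> chart_map C (c t) (c s) = k"
      show ?thesis using k[OF s] k[of t] e(1) by simp
    qed (use der in \<open>auto intro: has_vector_derivative_at_within\<close>)
    then show ?thesis
      using inj_on_chart_map[OF C, of "c t"] e(2)[of s] s chart_dom_self[OF C]
      by (auto dest!: inj_onD simp: dist_commute)
  qed
  have "\<forall>\<^sub>F s in at t. c t = c s"
    unfolding eventually_at using e(1) loc by (metis dist_commute mem_ball)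
  then show "\<forall>\<^sub>F s in at t within I. c t = c s"
    by (rule filter_leD[OF at_le, rotated]) auto
qed

section \<open>One-parameter subgroups\<close>

locale lie_grp =
  fixes G :: "'g::t2_space monoid" (structure) and CG :: "('g, 'h::banach) charts"
  assumes lie: "lie_group G CG"
begin

lemma carrier_UNIV [simp]: "carrier G = UNIV"
  and CG: "smooth_manifold CG"
  and smooth_mult: "smooth_map (prod_charts CG CG) CG (\<lambda>(a, b). a \<otimes> b)"
  and smooth_inv: "smooth_map CG CG (\<lambda>a. inv a)"
  using lie unfolding lie_group_def by blast+

sublocale group G
  using lie unfolding lie_group_def by blast

lemma grp [simp]: "(a \<otimes> b) \<otimes> c = a \<otimes> (b \<otimes> c)" "\<one> \<otimes> a = a" "a \<otimes> \<one> = a"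
  "inv a \<otimes> a = \<one>" "a \<otimes> inv a = \<one>" "inv a \<otimes> (a \<otimes> b) = b" "a \<otimes> (inv a \<otimes> b) = b"
  "inv (a \<otimes> b) = inv b \<otimes> inv a" "inv (inv a) = a"
  by (simp_all add: m_assoc inv_mult_group flip: m_assoc[of "inv a" a b] m_assoc[of a "inv a" b])

lemma smooth_mult_left: "smooth_map CG CG (\<lambda>b. a \<otimes> b)"
  by (rule smooth_map_prod_right[OF CG CG CG smooth_mult])

lemma smooth_mult_right: "smooth_map CG CG (\<lambda>a. a \<otimes> b)"
  by (rule smooth_map_prod_left[OF CG CG CG smooth_mult])

abbreviation e0 :: 'h where "e0 \<equiv> chart_map CG \<one> \<one>"

lemma e0_im: "e0 \<in> chart_im CG \<one>"
  using chart_dom_self[OF CG] by blast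

text \<open>The left factor is taken near \<open>q\<close> and the right one near the identity.
  Differentiating in the right factor at \<open>e0\<close> yields left-invariant fields; for
  \<open>q = \<one>\<close>, differentiating in the left factor at \<open>e0\<close> yields
  right-invariant ones.\<close>

definition mult_rep :: "'g \<Rightarrow> 'h \<times> 'h \<Rightarrow> 'h" where
  "mult_rep q z = chart_map CG q (chart_inv CG q (fst z) \<otimes> chart_inv CG \<one> (snd z))"

definition mult_rep_dom :: "'g \<Rightarrow> ('h \<times> 'h) set" where
  "mult_rep_dom q = {z. fst z \<in> chart_im CG q \<and> snd z \<in> chart_im CG \<one> \<and>
      chart_inv CG q (fst z) \<otimes> chart_inv CG \<one> (snd z) \<in> chart_dom CG q}"

lemma open_mult_rep_dom: "open (mult_rep_dom q)"
  and smooth_mult_rep: "smooth_on (mult_rep_dom q) (mult_rep q)"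
  unfolding mult_rep_dom_def mult_rep_def by (rule smooth_map_prod_charts[OF CG CG CG smooth_mult])+

lemma chart_inv_e0 [simp]: "chart_inv CG \<one> e0 = \<one>"
  by (rule chart_inv_map[OF CG chart_dom_self[OF CG]])

lemma mult_rep_dom_e0: "y \<in> chart_im CG q \<Longrightarrow> (y, e0) \<in> mult_rep_dom q"
  by (simp add: mult_rep_dom_def e0_im chart_inv_dom[OF CG])

text \<open>The left-invariant field of \<open>X\<close> in the chart at \<open>q\<close>, written
  as a partial derivative of the jointly smooth multiplication so that its smoothness in the base
  point is immediate.\<close>

definition left_field_rep :: "'g \<Rightarrow> 'h \<Rightarrow> 'h \<Rightarrow> 'h" where
  "left_field_rep q X y = fder (mult_rep q) (y, e0) (0, X)"

lemma smooth_left_field_rep: "smooth_on (chart_im CG q) (left_field_rep q X)"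
proof -
  have "smooth_on (chart_im CG q) (\<lambda>y. (y, e0))"
    by (intro smooth_on_Pair open_chart_im[OF CG] smooth_on_id smooth_on_const)
  from smooth_on_compose[OF fin_dim_prod[OF manifold_fin_dim[OF CG] manifold_fin_dim[OF CG]] open_chart_im[OF CG] _
      smooth_on_deriv[OF smooth_mult_rep[of q], of "(0, X)"] this]
  show ?thesis unfolding left_field_rep_def using mult_rep_dom_e0 by blast
qed

lemma left_mult_has_derivative:
  assumes a: "a \<in> chart_dom CG q"
  shows "(local_rep CG CG \<one> q (\<lambda>b. a \<otimes> b) has_derivative (\<lambda>X. left_field_rep q X (chart_map CG q a))) (at e0)"
proof -
  have aim: "chart_map CG q a \<in> chart_im CG q" using a by blast
  have "((\<lambda>x. (chart_map CG q a, x)) has_derivative (\<lambda>X. (0, X))) (at e0)"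
    by (auto intro!: derivative_eq_intros)
  from has_derivative_compose[OF this smooth_on_has_derivative[OF smooth_mult_rep mult_rep_dom_e0[OF aim]]]
  show ?thesis
    by (simp add: left_field_rep_def local_rep_def mult_rep_def o_def chart_inv_map[OF CG a])
qed

text \<open>Both partial derivatives are the identity because \<open>\<one>\<close> is neutral on
  either side, and a differential is the sum of its partial ones.\<close>

lemma mult_rep_has_derivative_e0:
  "(mult_rep \<one> has_derivative (\<lambda>(X, Y). X + Y)) (at (e0, e0))"
proof -
  have d: "(mult_rep \<one> has_derivative fder (mult_rep \<one>) (e0, e0)) (at (e0, e0))"
    by (rule smooth_on_has_derivative[OF smooth_mult_rep mult_rep_dom_e0[OF e0_im]])
  have ev: "\<forall>\<^sub>F x in nhds e0. x \<in> chart_im CG \<one>"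
    by (rule eventually_nhds_in_open[OF open_chart_im[OF CG] e0_im])
  have "((\<lambda>x. mult_rep \<one> (x, e0)) has_derivative (\<lambda>X. fder (mult_rep \<one>) (e0, e0) (X, 0))) (at e0)"
    by (rule has_derivative_compose[where f = "\<lambda>x. (x, e0)", OF _ d]) (auto intro!: derivative_eq_intros)
  moreover have "((\<lambda>x. mult_rep \<one> (x, e0)) has_derivative (\<lambda>X. X)) (at e0)"
    by (rule has_derivative_eventually_cong[OF has_derivative_ident])
      (use ev in \<open>auto elim!: eventually_mono simp: mult_rep_def chart_map_inv[OF CG]\<close>)
  ultimately have 1: "fder (mult_rep \<one>) (e0, e0) (X, 0) = X" for X
    using has_derivative_unique by metis
  have "((\<lambda>x. mult_rep \<one> (e0, x)) has_derivative (\<lambda>X. fder (mult_rep \<one>) (e0, e0) (0, X))) (at e0)"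
    by (rule has_derivative_compose[where f = "\<lambda>x. (e0, x)", OF _ d]) (auto intro!: derivative_eq_intros)
  moreover have "((\<lambda>x. mult_rep \<one> (e0, x)) has_derivative (\<lambda>X. X)) (at e0)"
    by (rule has_derivative_eventually_cong[OF has_derivative_ident])
      (use ev in \<open>auto elim!: eventually_mono simp: mult_rep_def chart_map_inv[OF CG]\<close>)
  ultimately have 2: "fder (mult_rep \<one>) (e0, e0) (0, X) = X" for X
    using has_derivative_unique by metis
  have "fder (mult_rep \<one>) (e0, e0) (X, Y) = X + Y" for X Y
    using linear_add[OF has_derivative_linear[OF d], of "(X, 0)" "(0, Y)"] 1 2 by simp
  then have "fder (mult_rep \<one>) (e0, e0) = (\<lambda>(X, Y). X + Y)" by auto
  then show ?thesis using d by simp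
qed

lemma curve_mult_derivative:
  assumes a: "isCont a (t::real)" "a t = \<one>" "((\<lambda>s. chart_map CG \<one> (a s)) has_vector_derivative X) (at t)"
    and b: "isCont b t" "b t = \<one>" "((\<lambda>s. chart_map CG \<one> (b s)) has_vector_derivative Y) (at t)"
  shows "((\<lambda>s. chart_map CG \<one> (a s \<otimes> b s)) has_vector_derivative X + Y) (at t)"
proof -
  let ?c = "\<lambda>s. (chart_map CG \<one> (a s), chart_map CG \<one> (b s))"
  have "(?c has_vector_derivative (X, Y)) (at t)" by (rule has_vector_derivative_Pair[OF a(3) b(3)])
  moreover have "(mult_rep \<one> has_derivative (\<lambda>(X, Y). X + Y)) (at (?c t))"
    using mult_rep_has_derivative_e0 a(2) b(2) by simp
  ultimately have "((\<lambda>s. mult_rep \<one> (?c s)) has_vector_derivative X + Y) (at t)"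
    using has_vector_derivative_compose_fder[of "mult_rep \<one>" "\<lambda>(X, Y). X + Y" ?c t "(X, Y)"] by simp
  moreover have "\<forall>\<^sub>F s in nhds t. mult_rep \<one> (?c s) = chart_map CG \<one> (a s \<otimes> b s)"
  proof -
    have o: "open (chart_dom CG \<one>)" "\<one> \<in> chart_dom CG \<one>"
      by (rule open_chart_dom[OF CG]) (rule chart_dom_self[OF CG])
    have "\<forall>\<^sub>F s in nhds t. a s \<in> chart_dom CG \<one>" "\<forall>\<^sub>F s in nhds t. b s \<in> chart_dom CG \<one>"
      using isCont_eventually_nhds[OF a(1)] isCont_eventually_nhds[OF b(1)] eventually_nhds_in_open[OF o] a(2) b(2)
      by auto
    then show ?thesis
      by eventually_elim (simp add: mult_rep_def chart_inv_map[OF CG])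
  qed
  ultimately show ?thesis
    unfolding has_vector_derivative_def by (rule has_derivative_eventually_cong)
qed

text \<open>Smoothness of the inversion gives differentiability; the value follows by
  differentiating \<open>a s \<otimes> inv (a s) = \<one>\<close> with the product rule.\<close>

lemma curve_inv_derivative:
  assumes a: "isCont a (t::real)" "a t = \<one>" "((\<lambda>s. chart_map CG \<one> (a s)) has_vector_derivative X) (at t)"
  shows "((\<lambda>s. chart_map CG \<one> (inv (a s))) has_vector_derivative - X) (at t)"
proof -
  have d: "(local_rep CG CG \<one> \<one> (\<lambda>a. inv a) has_derivative fder (local_rep CG CG \<one> \<one> (\<lambda>a. inv a)) (chart_map CG \<one> (a t))) (at (chart_map CG \<one> (a t)))"
    by (rule smooth_map_has_derivative[OF CG CG smooth_inv]) (simp_all add: a chart_dom_self[OF CG])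
  define Z where "Z = fder (local_rep CG CG \<one> \<one> (\<lambda>a. inv a)) (chart_map CG \<one> (a t)) X"
  have Z: "((\<lambda>s. chart_map CG \<one> (inv (a s))) has_vector_derivative Z) (at t)"
    unfolding Z_def
    by (rule has_vector_derivative_curve_compose[OF CG a(1) _ a(3) d]) (simp add: a chart_dom_self[OF CG])
  have "isCont (\<lambda>s. inv (a s)) t"
    using a(1) smooth_map_isCont[OF smooth_inv] by (rule isCont_o2)
  from curve_mult_derivative[OF a this _ Z]
  have "((\<lambda>s. e0) has_vector_derivative X + Z) (at t)" using a(2) by simp
  then have "X + Z = 0" using vector_derivative_unique_at has_vector_derivative_const by blast
  then have "Z = - X" by (simp add: add_eq_0_iff)
  then show ?thesis using Z by simp
qed

section \<open>Integral curves of left-invariant vector fields\<close>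

text \<open>The equation saying that the velocity at \<open>u t\<close> is the left-invariant field
  of \<open>X\<close>, pulled back to the identity by left translation. In this form invariance
  under left translation is a cancellation, and only the chart at \<open>\<one>\<close>
  occurs.\<close>

definition integral_curve :: "(real \<Rightarrow> 'g) \<Rightarrow> 'h \<Rightarrow> real \<Rightarrow> bool" where
  "integral_curve u X t \<longleftrightarrow> isCont u t \<and>
     ((\<lambda>s. chart_map CG \<one> (inv (u t) \<otimes> u s)) has_vector_derivative X) (at t)"

lemma isCont_mult_left: "isCont u t \<Longrightarrow> isCont (\<lambda>s. a \<otimes> u s) t"
  by (rule isCont_o2[OF _ smooth_map_isCont[OF smooth_mult_left]])

lemma isCont_inv: "isCont u t \<Longrightarrow> isCont (\<lambda>s. inv (u s)) t"
  by (rule isCont_o2[OF _ smooth_map_isCont[OF smooth_inv]])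

lemma isCont_mult: "isCont u (t::real) \<Longrightarrow> isCont v t \<Longrightarrow> isCont (\<lambda>s. u s \<otimes> v s) t"
proof -
  assume "isCont u t" "isCont v t"
  then have "isCont (\<lambda>s. (u s, v s)) t" by (rule continuous_Pair)
  from isCont_o2[OF this smooth_map_isCont[OF smooth_mult]] show ?thesis by simp
qed

lemma integral_curve_left: "integral_curve u X t \<Longrightarrow> integral_curve (\<lambda>s. a \<otimes> u s) X t"
  unfolding integral_curve_def by (auto intro: isCont_mult_left)

text \<open>Together with \<open>integral_curveI\<close> this exchanges the pulled-back condition
  for the differential equation y' = \<open>left_field_rep q X y\<close> in a chart, the form in
  which existence and smoothness are proved.\<close>

lemma integral_curve_chart:
  assumes u: "integral_curve u X t" and q: "u t \<in> chart_dom CG q"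
  shows "((\<lambda>s. chart_map CG q (u s)) has_vector_derivative left_field_rep q X (chart_map CG q (u t))) (at t)"
proof -
  have "((\<lambda>s. chart_map CG q (u t \<otimes> (inv (u t) \<otimes> u s))) has_vector_derivative left_field_rep q X (chart_map CG q (u t))) (at t)"
  proof (rule has_vector_derivative_curve_compose[OF CG, where c = "\<lambda>s. inv (u t) \<otimes> u s" and q = "\<one>"
        and g = "\<lambda>b. u t \<otimes> b" and v = X and g' = "\<lambda>X. left_field_rep q X (chart_map CG q (u t))"])
    show "isCont (\<lambda>s. inv (u t) \<otimes> u s) t" using u isCont_mult_left unfolding integral_curve_def by blast
    show "((\<lambda>s. chart_map CG \<one> (inv (u t) \<otimes> u s)) has_vector_derivative X) (at t)"
      using u unfolding integral_curve_def by blast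
    show "(local_rep CG CG \<one> q (\<lambda>b. u t \<otimes> b) has_derivative (\<lambda>X. left_field_rep q X (chart_map CG q (u t)))) (at (chart_map CG \<one> (inv (u t) \<otimes> u t)))"
      using left_mult_has_derivative[OF q] by simp
  qed (simp add: chart_dom_self[OF CG])
  then show ?thesis by simp
qed

lemma integral_curveI:
  assumes u: "isCont u t" and q: "u t \<in> chart_dom CG q"
    and d: "((\<lambda>s. chart_map CG q (u s)) has_vector_derivative left_field_rep q X (chart_map CG q (u t))) (at t)"
  shows "integral_curve u X t"
proof -
  let ?a = "u t"
  have dl: "(local_rep CG CG q \<one> (\<lambda>b. inv ?a \<otimes> b) has_derivative
      fder (local_rep CG CG q \<one> (\<lambda>b. inv ?a \<otimes> b)) (chart_map CG q ?a)) (at (chart_map CG q ?a))"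
    by (rule smooth_map_has_derivative[OF CG CG smooth_mult_left q]) (simp add: chart_dom_self[OF CG])
  have "fder (local_rep CG CG q \<one> (\<lambda>b. inv ?a \<otimes> b)) (chart_map CG q ?a) (left_field_rep q X (chart_map CG q ?a)) =
      fder (local_rep CG CG q \<one> (\<lambda>b. inv ?a \<otimes> b)) (chart_map CG q ?a) (fder (local_rep CG CG \<one> q (\<lambda>b. ?a \<otimes> b)) e0 X)"
    using fder_eqI[OF left_mult_has_derivative[OF q]] by simp
  also have "\<dots> = fder (local_rep CG CG \<one> \<one> ((\<lambda>b. inv ?a \<otimes> b) \<circ> (\<lambda>b. ?a \<otimes> b))) e0 X"
    using fder_local_rep_compose[OF CG CG CG smooth_mult_left smooth_mult_left, of \<one> \<one> ?a q "inv ?a" \<one> X] q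
    by (simp add: chart_dom_self[OF CG])
  also have "(\<lambda>b. inv ?a \<otimes> b) \<circ> (\<lambda>b. ?a \<otimes> b) = id" by (simp add: fun_eq_iff)
  also have "fder (local_rep CG CG \<one> \<one> id) e0 X = X"
    by (rule fder_local_rep_id[OF CG chart_dom_self[OF CG]])
  finally show ?thesis
    using has_vector_derivative_curve_compose[OF CG u q d dl] u unfolding integral_curve_def by simp
qed

text \<open>This takes the place of a uniqueness theorem for differential equations. At time
  \<open>t\<close> the curve \<open>u s \<otimes> inv (v s)\<close> is the image of
  \<open>?w\<close> under left translation by \<open>u t\<close> and right translation by
  \<open>inv (v t)\<close>. The curve \<open>?w\<close> passes through the identity with velocity
  \<open>X + - X\<close>.\<close>

lemma integral_curve_unique:
  assumes I: "open I" "connected I" "a \<in> I" "b \<in> I"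
    and u: "\<And>t. t \<in> I \<Longrightarrow> integral_curve u X t" and v: "\<And>t. t \<in> I \<Longrightarrow> integral_curve v X t"
  shows "u a \<otimes> inv (v a) = u b \<otimes> inv (v b)"
proof (rule curve_velocity_zero_imp_const[OF CG I])
  fix t assume t: "t \<in> I"
  have ut: "isCont u t" "((\<lambda>s. chart_map CG \<one> (inv (u t) \<otimes> u s)) has_vector_derivative X) (at t)"
    and vt: "isCont v t" "((\<lambda>s. chart_map CG \<one> (inv (v t) \<otimes> v s)) has_vector_derivative X) (at t)"
    using u[OF t] v[OF t] unfolding integral_curve_def by auto
  show "isCont (\<lambda>s. u s \<otimes> inv (v s)) t" by (intro isCont_mult isCont_inv ut vt)
  let ?w = "\<lambda>s. (inv (u t) \<otimes> u s) \<otimes> inv (inv (v t) \<otimes> v s)"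
  have "((\<lambda>s. chart_map CG \<one> (?w s)) has_vector_derivative X + - X) (at t)"
    by (intro curve_mult_derivative curve_inv_derivative isCont_inv isCont_mult_left ut vt) simp_all
  then have w: "((\<lambda>s. chart_map CG \<one> (?w s)) has_vector_derivative 0) (at t)" by simp
  let ?q = "u t \<otimes> inv (v t)"
  let ?f = "(\<lambda>b. b \<otimes> inv (v t)) \<circ> (\<lambda>b. u t \<otimes> b)"
  have sm: "(local_rep CG CG \<one> (u t) (\<lambda>b. u t \<otimes> b) has_derivative fder (local_rep CG CG \<one> (u t) (\<lambda>b. u t \<otimes> b)) e0) (at e0)"
    "(local_rep CG CG (u t) ?q (\<lambda>b. b \<otimes> inv (v t)) has_derivative
      fder (local_rep CG CG (u t) ?q (\<lambda>b. b \<otimes> inv (v t))) (chart_map CG (u t) (u t \<otimes> \<one>))) (at (chart_map CG (u t) (u t \<otimes> \<one>)))"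
    by (rule smooth_map_has_derivative[OF CG CG]; simp add: smooth_mult_left smooth_mult_right chart_dom_self[OF CG])+
  obtain f' where f': "(local_rep CG CG \<one> ?q ?f has_derivative f') (at e0)"
    using has_derivative_local_rep_compose[OF CG CG chart_dom_self[OF CG] smooth_map_isCont[OF smooth_mult_left] _ sm]
    by (auto simp: chart_dom_self[OF CG])
  have "((\<lambda>s. chart_map CG ?q (?f (?w s))) has_vector_derivative f' 0) (at t)"
  proof (rule has_vector_derivative_curve_compose[OF CG _ _ w, where g = ?f and g' = f'])
    show "isCont ?w t" by (intro isCont_mult isCont_inv isCont_mult_left ut vt)
    have wt: "?w t = \<one>" by simp
    show "?w t \<in> chart_dom CG \<one>" unfolding wt by (rule chart_dom_self[OF CG])
    show "(local_rep CG CG \<one> ?q ?f has_derivative f') (at (chart_map CG \<one> (?w t)))"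
      unfolding wt by (rule f')
  qed
  then have "((\<lambda>s. chart_map CG ?q (u s \<otimes> inv (v s))) has_vector_derivative 0) (at t)"
    using linear_0[OF has_derivative_linear[OF f']] by (simp add: o_def)
  then show "\<exists>q. u t \<otimes> inv (v t) \<in> chart_dom CG q \<and>
      ((\<lambda>s. chart_map CG q (u s \<otimes> inv (v s))) has_vector_derivative 0) (at t)"
    using chart_dom_self[OF CG] by blast
qed

lemma integral_curve_smooth:
  assumes "\<And>t. integral_curve u X t"
  shows "smooth_map vector_space_charts CG u"
  unfolding smooth_map_curve
proof (intro conjI allI)
  have c: "isCont u t" for t using assms unfolding integral_curve_def by blast
  then show cont: "continuous_on UNIV u" by (simp add: continuous_at_imp_continuous_on)
  show "smooth_on (u -` chart_dom CG q) (\<lambda>s. chart_map CG q (u s))" for q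
  proof (rule smooth_on_ode_solution[OF manifold_fin_dim[OF CG] _ _ smooth_left_field_rep[of q X]])
    show "open (u -` chart_dom CG q)" using open_vimage[OF open_chart_dom[OF CG] cont] .
    show "(\<lambda>s. chart_map CG q (u s)) ` (u -` chart_dom CG q) \<subseteq> chart_im CG q" by auto
  qed (use integral_curve_chart[OF assms] in auto)
qed

text \<open>Since \<open>inv (c t) \<otimes> c s = c (s - t)\<close>, the condition at
  \<open>t\<close> is the one at 0 shifted in time.\<close>

lemma homomorphism_integral_curve:
  assumes "\<And>s t. c (s + t) = c s \<otimes> c t" "isCont c (0::real)"
    "((\<lambda>s. chart_map CG \<one> (c s)) has_vector_derivative X) (at 0)"
  shows "integral_curve c X t"
proof -
  have c: "inv (c t) \<otimes> c s = c (s - t)" for s using assms(1)[of t "s - t"] by simp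
  have sh: "((\<lambda>s. s - t) has_vector_derivative 1) (at t)" by (auto intro!: derivative_eq_intros)
  have "((\<lambda>s. chart_map CG \<one> (c s)) has_derivative (\<lambda>h. h *\<^sub>R X)) (at (t - t))"
    using assms(3) by (simp add: has_vector_derivative_def)
  from has_vector_derivative_compose_fder[OF this sh]
  have "((\<lambda>s. chart_map CG \<one> (inv (c t) \<otimes> c s)) has_vector_derivative X) (at t)" by (simp add: c)
  moreover have "isCont (\<lambda>s. c (s - t)) t"
    by (rule isCont_o2[where g = c]) (use assms(2) in \<open>auto intro!: continuous_intros\<close>)
  then have "isCont (\<lambda>s. c t \<otimes> c (s - t)) t" by (rule isCont_mult_left)
  then have "isCont c t" using assms(1)[of t] by (simp flip: assms(1))
  ultimately show ?thesis unfolding integral_curve_def by simp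
qed

section \<open>Existence and uniqueness of one-parameter subgroups\<close>

text \<open>The homomorphism property spreads continuity and the derivative from time 0 to all
  times, and the resulting differential equation upgrades them to smoothness.\<close>

lemma one_parameter_subgroupI:
  assumes "\<And>s t. c (s + t) = c s \<otimes> c t" "isCont c (0::real)"
    "((\<lambda>s. chart_map CG \<one> (c s)) has_vector_derivative X) (at 0)"
  shows "one_parameter_subgroup G CG X c"
proof -
  have c0: "c 0 = \<one>" using assms(1)[of 0 0] by simp
  have "velocity CG c 0 = X"
    using assms(3) by (simp add: velocity_def c0 o_def vector_derivative_at)
  then show ?thesis
    unfolding one_parameter_subgroup_def
    using integral_curve_smooth[OF homomorphism_integral_curve[OF assms]] assms(1) c0 by blast
qed

lemma one_parameter_subgroupD:
  assumes "one_parameter_subgroup G CG X c"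
  shows "c (s + t) = c s \<otimes> c t" "c 0 = \<one>" "isCont c 0" "((\<lambda>s. chart_map CG \<one> (c s)) has_vector_derivative X) (at 0)"
proof -
  show c: "c (s + t) = c s \<otimes> c t" "c 0 = \<one>" using assms unfolding one_parameter_subgroup_def by auto
  have sm: "smooth_map vector_space_charts CG c" using assms unfolding one_parameter_subgroup_def by blast
  then show "isCont c 0" by (rule smooth_map_isCont)
  have "smooth_on (c -` chart_dom CG \<one>) (\<lambda>s. chart_map CG \<one> (c s))" using sm unfolding smooth_map_curve by blast
  from smooth_on_has_derivative[OF this, of 0]
  have "(\<lambda>s. chart_map CG \<one> (c s)) differentiable (at 0)"
    using c chart_dom_self[OF CG] by (auto intro: differentiableI)
  then have "((\<lambda>s. chart_map CG \<one> (c s)) has_vector_derivative vector_derivative (\<lambda>s. chart_map CG \<one> (c s)) (at 0)) (at 0)"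
    using vector_derivative_works by blast
  moreover have "vector_derivative (\<lambda>s. chart_map CG \<one> (c s)) (at 0) = X"
    using assms c(2) unfolding one_parameter_subgroup_def velocity_def by (simp add: o_def)
  ultimately show "((\<lambda>s. chart_map CG \<one> (c s)) has_vector_derivative X) (at 0)" by simp
qed

lemma one_parameter_subgroup_unique:
  assumes "one_parameter_subgroup G CG X c" "one_parameter_subgroup G CG X d"
  shows "c = d"
proof
  fix t
  have "integral_curve c X s" "integral_curve d X s" for s
    using homomorphism_integral_curve[OF one_parameter_subgroupD(1,3,4)[OF assms(1)]]
      homomorphism_integral_curve[OF one_parameter_subgroupD(1,3,4)[OF assms(2)]] by auto
  then have "c t \<otimes> inv (d t) = c 0 \<otimes> inv (d 0)"
    by (intro integral_curve_unique[of UNIV t 0 c X d]) simp_all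
  also have "\<dots> = \<one>"
    by (simp add: one_parameter_subgroupD(2)[OF assms(1)] one_parameter_subgroupD(2)[OF assms(2)])
  finally have "(c t \<otimes> inv (d t)) \<otimes> d t = d t" by (simp del: grp(1))
  then show "c t = d t" by simp
qed

lemma local_integral_curve:
  obtains e c where "e > 0" "c 0 = \<one>" "\<And>t::real. \<bar>t\<bar> < e \<Longrightarrow> integral_curve c X t"
proof -
  obtain r K where rK: "r > 0" "K \<ge> 0" "cball e0 r \<subseteq> chart_im CG \<one>"
    "\<And>x. x \<in> cball e0 r \<Longrightarrow> norm (left_field_rep \<one> X x) \<le> K"
    "\<And>x y. x \<in> cball e0 r \<Longrightarrow> y \<in> cball e0 r \<Longrightarrow> norm (left_field_rep \<one> X x - left_field_rep \<one> X y) \<le> K * norm (x - y)"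
    using smooth_on_locally_lipschitz[OF manifold_fin_dim[OF CG] open_chart_im[OF CG] e0_im smooth_left_field_rep] by metis
  obtain T y where T: "T > 0" and yb: "\<And>t. t \<in> {0<..<T} \<Longrightarrow> y t \<in> cball e0 r"
    and y: "\<And>t. t \<in> {0<..<T} \<Longrightarrow> (y has_vector_derivative left_field_rep \<one> X (y t)) (at t)"
    using autonomous_ode_local_solution[OF rK(1,2,4,5)] by blast
  define u where "u = (\<lambda>t. chart_inv CG \<one> (y t))"
  have u: "integral_curve u X t" if t: "t \<in> {0<..<T}" for t
  proof (rule integral_curveI[where q = "\<one>"])
    have yim: "y t \<in> chart_im CG \<one>" using yb[OF t] rK(3) by blast
    have "isCont y t" using y[OF t] has_vector_derivative_continuous by blast
    then show "isCont u t" unfolding u_def using isCont_chart_inv[OF CG yim] by (rule isCont_o2)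
    show "u t \<in> chart_dom CG \<one>" unfolding u_def by (rule chart_inv_dom[OF CG yim])
    have "chart_map CG \<one> (u s) = y s" if "s \<in> {0<..<T}" for s
      unfolding u_def using chart_map_inv[OF CG] yb[OF that] rK(3) by blast
    then show "((\<lambda>s. chart_map CG \<one> (u s)) has_vector_derivative left_field_rep \<one> X (chart_map CG \<one> (u t))) (at t)"
      using has_vector_derivative_transform_within_open[OF y[OF t] open_greaterThanLessThan t, of "\<lambda>s. chart_map CG \<one> (u s)"] t by simp
  qed
  \<comment> \<open>The solution is based at the interior time T/2 and moved to the identity by left
    translation, so that it exists on both sides of 0.\<close>
  define c where "c = (\<lambda>s. inv (u (T/2)) \<otimes> u (s + T/2))"
  have "integral_curve c X t" if t: "\<bar>t\<bar> < T/2" for t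
  proof -
    have t': "t + T/2 \<in> {0<..<T}" using t by auto
    have ut: "isCont u (t + T/2)" "((\<lambda>s. chart_map CG \<one> (inv (u (t + T/2)) \<otimes> u s)) has_derivative (\<lambda>h. h *\<^sub>R X)) (at (t + T/2))"
      using u[OF t'] unfolding integral_curve_def has_vector_derivative_def by auto
    have sh: "((\<lambda>s. s + T/2) has_vector_derivative 1) (at t)" by (auto intro!: derivative_eq_intros)
    have "integral_curve (\<lambda>s. u (s + T/2)) X t"
      unfolding integral_curve_def
      using has_vector_derivative_compose_fder[OF ut(2) sh] isCont_o2[of t "\<lambda>s. s + T/2" u] ut(1)
      by (auto intro!: continuous_intros)
    then show ?thesis unfolding c_def by (rule integral_curve_left)
  qed
  moreover have "c 0 = \<one>" by (simp add: c_def)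
  ultimately show ?thesis using that[of "T/2" c] T by simp
qed

text \<open>The local solution is a homomorphism for small times: c(s + t) and c(s) c(t) are
  integral curves in t that agree at t = 0. In place of a continuation argument it is extended by
  C(t) = c(t/N)^N with N so large that t/N is small.\<close>

lemma one_parameter_subgroup_exists: "\<exists>c. one_parameter_subgroup G CG X c"
proof -
  obtain e c where e: "e > 0" and c0: "c 0 = \<one>" and c: "\<And>t::real. \<bar>t\<bar> < e \<Longrightarrow> integral_curve c X t"
    using local_integral_curve by blast
  have hom: "c (s + t) = c s \<otimes> c t" if s: "\<bar>s\<bar> < e/2" and t: "\<bar>t\<bar> < e/2" for s t
  proof -
    let ?I = "{-(e/2)<..<e/2}"
    have sh: "((\<lambda>t. s + t) has_vector_derivative 1) (at t)" for t by (auto intro!: derivative_eq_intros)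
    have "integral_curve (\<lambda>t. c (s + t)) X t" if "t \<in> ?I" for t
    proof -
      have "\<bar>s + t\<bar> < e" using s that by auto
      then have ut: "isCont c (s + t)" "((\<lambda>r. chart_map CG \<one> (inv (c (s + t)) \<otimes> c r)) has_derivative (\<lambda>h. h *\<^sub>R X)) (at (s + t))"
        using c unfolding integral_curve_def has_vector_derivative_def by auto
      then show ?thesis
        unfolding integral_curve_def
        using has_vector_derivative_compose_fder[OF ut(2) sh] isCont_o2[of t "\<lambda>t. s + t" c]
        by (auto intro!: continuous_intros)
    qed
    moreover have "integral_curve (\<lambda>t. c s \<otimes> c t) X t" if "t \<in> ?I" for t
      by (rule integral_curve_left[OF c]) (use that in auto)
    ultimately have "c (s + t) \<otimes> inv (c s \<otimes> c t) = c (s + 0) \<otimes> inv (c s \<otimes> c 0)"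
      by (intro integral_curve_unique[of ?I]) (use t e in auto)
    then have "(c (s + t) \<otimes> inv (c s \<otimes> c t)) \<otimes> (c s \<otimes> c t) = c s \<otimes> c t" by (simp add: c0 del: grp(1) grp(8))
    then show ?thesis by (simp del: grp(8))
  qed
  have pow: "c (real j * x) = c x [^] j" if "real j * \<bar>x\<bar> < e/2" for j x
    using that
  proof (induction j)
    case 0
    then show ?case by (simp add: c0)
  next
    case (Suc j)
    have "real (Suc j) * \<bar>x\<bar> = real j * \<bar>x\<bar> + \<bar>x\<bar>" by (simp add: algebra_simps)
    moreover have "0 \<le> real j * \<bar>x\<bar>" by simp
    ultimately have j: "real j * \<bar>x\<bar> < e/2" "\<bar>x\<bar> < e/2"
      using Suc.prems abs_ge_zero[of x] by linarith+
    have "c (real j * x + x) = c (real j * x) \<otimes> c x"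
      by (rule hom) (use j in \<open>simp_all add: abs_mult\<close>)
    then show ?case using Suc.IH[OF j(1)] by (simp add: algebra_simps)
  qed
  \<comment> \<open>Both sides are the same power of c(t/(N M)), the value on the common
    refinement.\<close>
  have indep: "c (t / real N) [^] N = c (t / real M) [^] M"
    if N: "N > 0" "\<bar>t\<bar> / real N < e/2" and M: "M > 0" "\<bar>t\<bar> / real M < e/2" for t N M
  proof -
    have "c (t / real N) = c (t / (real N * real M)) [^] M"
      using pow[of M "t / (real N * real M)"] N M by (simp add: abs_mult field_simps)
    moreover have "c (t / real M) = c (t / (real N * real M)) [^] N"
      using pow[of N "t / (real N * real M)"] N M by (simp add: abs_mult field_simps)
    ultimately show ?thesis by (simp add: nat_pow_pow mult.commute)
  qed
  define N where "N = (\<lambda>t::real. SOME n::nat. n > 0 \<and> \<bar>t\<bar> / real n < e/2)"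
  define C where "C = (\<lambda>t. c (t / real (N t)) [^] N t)"
  have ex: "\<exists>n::nat. n > 0 \<and> \<bar>t\<bar> / real n < d" if "d > 0" for t d :: real
  proof -
    obtain n :: nat where n: "real n > \<bar>t\<bar> / d" using reals_Archimedean2 by blast
    moreover have "\<bar>t\<bar> / d \<ge> 0" using that by simp
    ultimately have "real n > 0" by linarith
    then show ?thesis using n that by (intro exI[of _ n]) (auto simp: field_simps)
  qed
  have N: "N t > 0" "\<bar>t\<bar> / real (N t) < e/2" for t
    using someI_ex[OF ex[of "e/2" t]] e unfolding N_def by auto
  have C: "C t = c (t / real n) [^] n" if "n > 0" "\<bar>t\<bar> / real n < e/2" for t n
    unfolding C_def by (rule indep[OF N that])
  have Cc: "C t = c t" if "\<bar>t\<bar> < e/2" for t using C[of 1 t] that by simp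
  have "C (s + t) = C s \<otimes> C t" for s t
  proof -
    obtain n :: nat where n: "n > 0" "(\<bar>s\<bar> + \<bar>t\<bar>) / real n < e/2" using ex[of "e/2" "\<bar>s\<bar> + \<bar>t\<bar>"] e by auto
    have b: "\<bar>s\<bar> / real n < e/2" "\<bar>t\<bar> / real n < e/2" "\<bar>s + t\<bar> / real n < e/2"
      by (rule le_less_trans[OF _ n(2)]; rule divide_right_mono; simp add: abs_triangle_ineq)+
    \<comment> \<open>Both orders are recorded because together they show that the two factors
      commute, as the power of a product below requires.\<close>
    have h: "c (s / real n + t / real n) = c (s / real n) \<otimes> c (t / real n)"
      "c (t / real n + s / real n) = c (t / real n) \<otimes> c (s / real n)"
      by (rule hom; use b in simp)+
    have "C (s + t) = c (s / real n + t / real n) [^] n" using C[OF n(1) b(3)] by (simp add: add_divide_distrib)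
    also have "\<dots> = c (s / real n) [^] n \<otimes> c (t / real n) [^] n"
      unfolding h(1) by (rule pow_mult_distrib) (use h in \<open>simp_all add: add.commute\<close>)
    also have "\<dots> = C s \<otimes> C t" using C[OF n(1) b(1)] C[OF n(1) b(2)] by simp
    finally show ?thesis .
  qed
  moreover have ev: "\<forall>\<^sub>F t in nhds 0. c t = C t"
    unfolding eventually_nhds_metric using e Cc by (intro exI[of _ "e/2"]) (simp add: dist_real_def)
  moreover have "isCont C 0"
    using c[of 0] e isCont_cong[OF ev] unfolding integral_curve_def by simp
  moreover have "((\<lambda>s. chart_map CG \<one> (C s)) has_vector_derivative X) (at 0)"
  proof -
    have "((\<lambda>s. chart_map CG \<one> (c s)) has_derivative (\<lambda>h. h *\<^sub>R X)) (at 0)"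
      using c[of 0] e c0 unfolding integral_curve_def has_vector_derivative_def by simp
    then show ?thesis
      unfolding has_vector_derivative_def
      by (rule has_derivative_eventually_cong) (use ev in \<open>auto elim: eventually_mono\<close>)
  qed
  ultimately show ?thesis using one_parameter_subgroupI by blast
qed

text \<open>The subgroup with initial velocity \<open>s *\<^sub>R X\<close> is t \<mapsto> c(s t),
  whose value at 1 is c(s). Uniqueness resolves the definite description in
  \<open>lie_exp\<close>.\<close>

lemma lie_exp_one_parameter_subgroup: "one_parameter_subgroup G CG X (\<lambda>s. lie_exp G CG (s *\<^sub>R X))"
proof -
  obtain c where c: "one_parameter_subgroup G CG X c" using one_parameter_subgroup_exists by blast
  have "lie_exp G CG (s *\<^sub>R X) = c s" for s
  proof -
    have "one_parameter_subgroup G CG (s *\<^sub>R X) (\<lambda>t. c (s * t))"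
    proof (rule one_parameter_subgroupI)
      show "c (s * (a + b)) = c (s * a) \<otimes> c (s * b)" for a b
        using one_parameter_subgroupD(1)[OF c] by (simp add: distrib_left)
      show "isCont (\<lambda>t. c (s * t)) 0"
        by (rule isCont_o2[where g = c]) (use one_parameter_subgroupD(3)[OF c] in \<open>auto intro!: continuous_intros\<close>)
      have "((\<lambda>t. s * t) has_vector_derivative s) (at 0)" by (auto intro!: derivative_eq_intros)
      moreover have "((\<lambda>s. chart_map CG \<one> (c s)) has_derivative (\<lambda>h. h *\<^sub>R X)) (at (s * 0))"
        using one_parameter_subgroupD(4)[OF c] by (simp add: has_vector_derivative_def)
      ultimately show "((\<lambda>t. chart_map CG \<one> (c (s * t))) has_vector_derivative s *\<^sub>R X) (at 0)"
        using has_vector_derivative_compose_fder by blast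
    qed
    then have "(THE c. one_parameter_subgroup G CG (s *\<^sub>R X) c) = (\<lambda>t. c (s * t))"
      using one_parameter_subgroup_unique by (intro the_equality) blast+
    then show ?thesis unfolding lie_exp_def by simp
  qed
  then show ?thesis using c by simp
qed

end

section \<open>The Lie bracket in the chart at the identity\<close>

context lie_grp
begin

lemma left_field_rep_e0: "left_field_rep \<one> X e0 = X"
  using fder_eqI[OF mult_rep_has_derivative_e0] by (simp add: left_field_rep_def)

text \<open>\<open>left_invariant_field\<close> at a point is expressed in the preferred chart of
  that point, which varies. The change of charts in \<open>vf_in_chart\<close> undoes this by the
  chain rule and leaves a smooth expression in a single chart.\<close>

lemma vf_in_chart_left_invariant:
  assumes y: "y \<in> chart_im CG \<one>"
  shows "vf_in_chart CG \<one> (left_invariant_field G CG X) y = left_field_rep \<one> X y"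
proof -
  let ?a = "chart_inv CG \<one> y"
  have a: "?a \<in> chart_dom CG \<one>" by (rule chart_inv_dom[OF CG y])
  have "vf_in_chart CG \<one> (left_invariant_field G CG X) y =
      fder (local_rep CG CG ?a \<one> id) (chart_map CG ?a ?a) (fder (local_rep CG CG \<one> ?a (\<lambda>b. ?a \<otimes> b)) e0 X)"
    by (simp add: vf_in_chart_def left_invariant_field_def tangent_map_def local_rep_def Let_def)
  also have "\<dots> = fder (local_rep CG CG \<one> \<one> (id \<circ> (\<lambda>b. ?a \<otimes> b))) e0 X"
    using fder_local_rep_compose[OF CG CG CG smooth_mult_left smooth_map_id[OF CG], of \<one> \<one> ?a ?a \<one> X] a
    by (simp add: chart_dom_self[OF CG])
  also have "\<dots> = left_field_rep \<one> X y"
    using fder_eqI[OF left_mult_has_derivative[OF a, of]] by (simp add: chart_map_inv[OF CG y])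
  finally show ?thesis .
qed

lemma lie_bracket_eq:
  "lie_bracket G CG X Z = fder (left_field_rep \<one> Z) e0 X - fder (left_field_rep \<one> X) e0 Z"
proof -
  have "fder (vf_in_chart CG \<one> (left_invariant_field G CG Y)) e0 = fder (left_field_rep \<one> Y) e0" for Y
    by (rule frechet_derivative_cong_open[OF open_chart_im[OF CG] e0_im]) (rule vf_in_chart_left_invariant)
  then show ?thesis
    by (simp add: lie_bracket_def vf_bracket_def Let_def vf_in_chart_left_invariant[OF e0_im] left_field_rep_e0)
qed

end

section \<open>Smooth actions and action fields\<close>

lemma fder_partial_fst:
  fixes f :: "'a::real_normed_vector \<times> 'b::real_normed_vector \<Rightarrow> 'c::real_normed_vector"
  assumes "(f has_derivative f') (at (x, y))"
  shows "((\<lambda>x. f (x, y)) has_derivative (\<lambda>X. f' (X, 0))) (at x)"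
  by (rule has_derivative_compose[where f = "\<lambda>x. (x, y)", OF _ assms]) (auto intro!: derivative_eq_intros)

lemma fder_partial_snd:
  fixes f :: "'a::real_normed_vector \<times> 'b::real_normed_vector \<Rightarrow> 'c::real_normed_vector"
  assumes "(f has_derivative f') (at (x, y))"
  shows "((\<lambda>y. f (x, y)) has_derivative (\<lambda>w. f' (0, w))) (at y)"
  by (rule has_derivative_compose[where f = "\<lambda>y. (x, y)", OF _ assms]) (auto intro!: derivative_eq_intros)

locale smooth_action = lie_grp G CG
  for G :: "'g::t2_space monoid" (structure) and CG :: "('g, 'h::banach) charts" +
  fixes CM :: "('m::t2_space, 'e::banach) charts" and act :: "'g \<Rightarrow> 'm \<Rightarrow> 'm"
  assumes CM: "smooth_manifold CM"
    and action: "group_action G UNIV act"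
    and smooth_act: "smooth_map (prod_charts CG CM) CM (\<lambda>(a, p). act a p)"
begin

lemma act_one [simp]: "act \<one> p = p"
  using group_action.id_eq_one[OF action] by (metis UNIV_I restrict_apply')

lemma act_mult: "act (a \<otimes> b) p = act a (act b p)"
  using group_action.composition_rule[OF action] by simp

lemma smooth_act_right: "smooth_map CM CM (act a)"
  by (rule smooth_map_prod_right[OF CG CM CM smooth_act])

lemma smooth_act_left: "smooth_map CG CM (\<lambda>a. act a p)"
  by (rule smooth_map_prod_left[OF CG CM CM smooth_act])

definition act_rep :: "'m \<Rightarrow> 'h \<times> 'e \<Rightarrow> 'e" where
  "act_rep p z = chart_map CM p (act (chart_inv CG \<one> (fst z)) (chart_inv CM p (snd z)))"

definition act_rep_dom :: "'m \<Rightarrow> ('h \<times> 'e) set" where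
  "act_rep_dom p = {z. fst z \<in> chart_im CG \<one> \<and> snd z \<in> chart_im CM p \<and>
      act (chart_inv CG \<one> (fst z)) (chart_inv CM p (snd z)) \<in> chart_dom CM p}"

lemma open_act_rep_dom: "open (act_rep_dom p)"
  and smooth_act_rep: "smooth_on (act_rep_dom p) (act_rep p)"
  unfolding act_rep_dom_def act_rep_def by (rule smooth_map_prod_charts[OF CG CM CM smooth_act])+

lemma fin_dim_pair: "fin_dim TYPE('h \<times> 'e)"
  by (rule fin_dim_prod[OF manifold_fin_dim[OF CG] manifold_fin_dim[OF CM]])

lemma act_rep_dom_e0: "y \<in> chart_im CM p \<Longrightarrow> (e0, y) \<in> act_rep_dom p"
  by (simp add: act_rep_dom_def e0_im chart_inv_dom[OF CM])

lemma act_rep_e0: "y \<in> chart_im CM p \<Longrightarrow> act_rep p (e0, y) = y"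
  by (simp add: act_rep_def chart_map_inv[OF CM])

lemma act_rep_map:
  "a \<in> chart_dom CG \<one> \<Longrightarrow> x \<in> chart_dom CM p \<Longrightarrow> act_rep p (chart_map CG \<one> a, chart_map CM p x) = chart_map CM p (act a x)"
  by (simp add: act_rep_def chart_inv_map[OF CG] chart_inv_map[OF CM])

lemma act_rep_has_derivative:
  "z \<in> act_rep_dom p \<Longrightarrow> (act_rep p has_derivative fder (act_rep p) z) (at z)"
  by (rule smooth_on_has_derivative[OF smooth_act_rep])

text \<open>The action field of \<open>X\<close> in the chart at \<open>p\<close> (see
  \<open>action_field_eq\<close>). As a partial derivative of the joint action it can be
  differentiated in the base point without going through \<open>lie_exp\<close>.\<close>

definition field_rep :: "'m \<Rightarrow> 'h \<Rightarrow> 'e \<Rightarrow> 'e" where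
  "field_rep p X y = fder (act_rep p) (e0, y) (X, 0)"

lemma smooth_field_rep: "smooth_on (chart_im CM p) (field_rep p X)"
proof -
  have pr: "smooth_on (chart_im CM p) (\<lambda>y. (e0, y))"
    by (intro smooth_on_Pair open_chart_im[OF CM] smooth_on_id smooth_on_const)
  have sub: "(\<lambda>y. (e0, y)) ` chart_im CM p \<subseteq> act_rep_dom p"
    using act_rep_dom_e0 by blast
  show ?thesis
    using smooth_on_compose[OF fin_dim_pair open_chart_im[OF CM] sub smooth_on_deriv[OF smooth_act_rep] pr]
    unfolding field_rep_def .
qed

lemma field_rep_linear:
  assumes "y \<in> chart_im CM p" shows "linear (\<lambda>X. field_rep p X y)"
proof -
  have "linear (fder (act_rep p) (e0, y))"
    by (rule has_derivative_linear[OF act_rep_has_derivative[OF act_rep_dom_e0[OF assms]]])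
  moreover have "linear (\<lambda>X::'h. (X, 0::'e))" by (auto intro!: linearI)
  ultimately have "linear (fder (act_rep p) (e0, y) \<circ> (\<lambda>X. (X, 0)))" using linear_compose by blast
  then show ?thesis by (simp add: o_def field_rep_def)
qed

lemma fder_act_rep_snd:
  assumes y: "y \<in> chart_im CM p" shows "fder (act_rep p) (e0, y) (0, w) = w"
proof -
  have "((\<lambda>y. (e0, y)) has_derivative (\<lambda>w. (0, w))) (at y)" by (auto intro!: derivative_eq_intros)
  from has_derivative_compose[OF this act_rep_has_derivative[OF act_rep_dom_e0[OF y]]]
  have "((\<lambda>y. act_rep p (e0, y)) has_derivative (\<lambda>w. fder (act_rep p) (e0, y) (0, w))) (at y)" .
  moreover have "((\<lambda>y. act_rep p (e0, y)) has_derivative (\<lambda>w. w)) (at y)"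
    by (rule has_derivative_eventually_cong[OF has_derivative_ident])
      (use eventually_nhds_in_open[OF open_chart_im[OF CM] y] in \<open>auto elim!: eventually_mono simp: act_rep_e0\<close>)
  ultimately show ?thesis using has_derivative_unique by metis
qed

lemma fder_act_rep:
  assumes y: "y \<in> chart_im CM p" shows "fder (act_rep p) (e0, y) (X, w) = field_rep p X y + w"
proof -
  have "linear (fder (act_rep p) (e0, y))"
    by (rule has_derivative_linear[OF act_rep_has_derivative[OF act_rep_dom_e0[OF y]]])
  from linear_add[OF this, of "(X, 0)" "(0, w)"] show ?thesis
    by (simp add: fder_act_rep_snd[OF y] field_rep_def)
qed

text \<open>By \<open>act (c u) m = act (c (u - s)) (act (c s) m)\<close> the derivative is moved to
  time 0, where it is the derivative of \<open>act_rep\<close> in the group direction at the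
  identity.\<close>

lemma act_curve_derivative:
  assumes c: "one_parameter_subgroup G CG X c" and m: "act (c s) m \<in> chart_dom CM p"
  shows "((\<lambda>s. chart_map CM p (act (c s) m)) has_vector_derivative
    field_rep p X (chart_map CM p (act (c s) m))) (at s)"
proof -
  let ?x = "act (c s) m" and ?b = "\<lambda>u. c (u - s)"
  have y: "chart_map CM p ?x \<in> chart_im CM p" using m by blast
  have sh: "((\<lambda>u. u - s) has_vector_derivative 1) (at s)" by (auto intro!: derivative_eq_intros)
  have "((\<lambda>u. chart_map CG \<one> (c u)) has_derivative (\<lambda>h. h *\<^sub>R X)) (at (s - s))"
    using one_parameter_subgroupD(4)[OF c] by (simp add: has_vector_derivative_def)
  from has_vector_derivative_compose_fder[OF this sh]
  have "((\<lambda>u. chart_map CG \<one> (?b u)) has_vector_derivative X) (at s)" by simp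
  from has_vector_derivative_Pair[OF this has_vector_derivative_const[of "chart_map CM p ?x"]]
  have pr: "((\<lambda>u. (chart_map CG \<one> (?b u), chart_map CM p ?x)) has_vector_derivative (X, 0)) (at s)" .
  have "(act_rep p has_derivative fder (act_rep p) (e0, chart_map CM p ?x)) (at (chart_map CG \<one> (?b s), chart_map CM p ?x))"
    using act_rep_has_derivative[OF act_rep_dom_e0[OF y]] one_parameter_subgroupD(2)[OF c] by simp
  from has_vector_derivative_compose_fder[OF this pr]
  have "((\<lambda>u. act_rep p (chart_map CG \<one> (?b u), chart_map CM p ?x)) has_vector_derivative
      field_rep p X (chart_map CM p ?x)) (at s)" by (simp add: field_rep_def)
  moreover have "\<forall>\<^sub>F u in nhds s. act_rep p (chart_map CG \<one> (?b u), chart_map CM p ?x) = chart_map CM p (act (c u) m)"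
  proof -
    have "isCont ?b s"
      by (rule isCont_o2[where g = c]) (use one_parameter_subgroupD(3)[OF c] in \<open>auto intro!: continuous_intros\<close>)
    from isCont_eventually_nhds[OF this, of "\<lambda>a. a \<in> chart_dom CG \<one>"]
    have "\<forall>\<^sub>F u in nhds s. ?b u \<in> chart_dom CG \<one>"
      using eventually_nhds_in_open[OF open_chart_dom[OF CG] chart_dom_self[OF CG]] one_parameter_subgroupD(2)[OF c] by simp
    moreover have "act (?b u) ?x = act (c u) m" for u
      using one_parameter_subgroupD(1)[OF c, of "u - s" s] by (simp flip: act_mult)
    ultimately show ?thesis by (auto elim!: eventually_mono simp: act_rep_map m)
  qed
  ultimately show ?thesis
    unfolding has_vector_derivative_def by (rule has_derivative_eventually_cong)
qed

lemma act_curve_isCont: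
  assumes c: "one_parameter_subgroup G CG X c" shows "isCont (\<lambda>s. act (c s) m) s"
proof -
  have "smooth_map vector_space_charts CG c" using c unfolding one_parameter_subgroup_def by blast
  from isCont_o2[OF smooth_map_isCont[OF this] smooth_map_isCont[OF smooth_act_left]] show ?thesis .
qed

lemma lie_exp_0: "lie_exp G CG 0 = \<one>"
  using one_parameter_subgroupD(2)[OF lie_exp_one_parameter_subgroup] by simp

lemma action_field_eq: "action_field G CG CM act X p = field_rep p X (chart_map CM p p)"
proof -
  have "act (lie_exp G CG (0 *\<^sub>R X)) p = p" by (simp add: lie_exp_0)
  then show ?thesis
    using act_curve_derivative[OF lie_exp_one_parameter_subgroup, of 0 X p p] chart_dom_self[OF CM]
    unfolding action_field_def velocity_def by (simp add: o_def vector_derivative_at lie_exp_0)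
qed

lemma action_field_linear: "linear (\<lambda>X. action_field G CG CM act X p)"
  unfolding action_field_eq using field_rep_linear chart_dom_self[OF CM] by blast

text \<open>The velocity of the orbit curve at time t is the image of its velocity at 0 under the
  differential of \<open>act (?c t)\<close>, hence zero, and the curve is constant. This places the
  kernel of the evaluation of action fields at \<open>p\<close> inside the isotropy algebra.\<close>

lemma action_field_zero_imp_lie_exp_stabilizer:
  assumes X: "action_field G CG CM act X p = 0"
  shows "lie_exp G CG (s *\<^sub>R X) \<in> stabilizer G act p"
proof -
  let ?c = "\<lambda>s. lie_exp G CG (s *\<^sub>R X)"
  have c: "one_parameter_subgroup G CG X ?c" by (rule lie_exp_one_parameter_subgroup)
  have "act (?c s) p = act (?c 0) p"
  proof (rule curve_velocity_zero_imp_const[OF CM open_UNIV])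
    show "isCont (\<lambda>s. act (?c s) p) t" for t by (rule act_curve_isCont[OF c])
    fix t
    let ?b = "\<lambda>s. act (?c (s - t)) p"
    have b: "((\<lambda>s. chart_map CM p (act (?c s) p)) has_vector_derivative 0) (at (t - t))"
      using act_curve_derivative[OF c, of 0 p p] X chart_dom_self[OF CM]
      by (simp add: lie_exp_0 action_field_eq)
    have "((\<lambda>s. s - t) has_vector_derivative 1) (at t)" by (auto intro!: derivative_eq_intros)
    from has_vector_derivative_compose_fder[OF b[unfolded has_vector_derivative_def] this]
    have b': "((\<lambda>s. chart_map CM p (?b s)) has_vector_derivative 0) (at t)" by simp
    have cb: "isCont ?b t"
      by (rule isCont_o2[where g = "\<lambda>s. act (?c s) p"]) (auto intro!: continuous_intros act_curve_isCont[OF c])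
    let ?q = "act (?c t) p"
    have bt: "?b t = p" by (simp add: lie_exp_0)
    have d: "(local_rep CM CM p ?q (act (?c t)) has_derivative fder (local_rep CM CM p ?q (act (?c t))) (chart_map CM p p)) (at (chart_map CM p p))"
      by (rule smooth_map_has_derivative[OF CM CM smooth_act_right]) (simp_all add: chart_dom_self[OF CM])
    have "((\<lambda>s. chart_map CM ?q (act (?c t) (?b s))) has_vector_derivative
        fder (local_rep CM CM p ?q (act (?c t))) (chart_map CM p p) 0) (at t)"
      by (rule has_vector_derivative_curve_compose[OF CM cb _ b']) (simp_all only: bt d chart_dom_self[OF CM])
    moreover have "act (?c t) (?b s) = act (?c s) p" for s
      using one_parameter_subgroupD(1)[OF c, of t "s - t"] by (simp flip: act_mult)
    ultimately have "((\<lambda>s. chart_map CM ?q (act (?c s) p)) has_vector_derivative 0) (at t)"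
      by (simp add: linear_0[OF has_derivative_linear[OF d]])
    then show "\<exists>q. act (?c t) p \<in> chart_dom CM q \<and> ((\<lambda>s. chart_map CM q (act (?c s) p)) has_vector_derivative 0) (at t)"
      using chart_dom_self[OF CM] by blast
  qed auto
  then show ?thesis by (simp add: stabilizer_def lie_exp_0)
qed

lemma field_rep_has_derivative:
  assumes y: "y \<in> chart_im CM p"
  shows "(field_rep p X has_derivative (\<lambda>w. fder (\<lambda>z. fder (act_rep p) z (X, 0)) (e0, y) (0, w))) (at y)"
  unfolding field_rep_def
  by (rule fder_partial_snd[OF smooth_on_has_derivative[OF smooth_on_deriv[OF smooth_act_rep] act_rep_dom_e0[OF y]]])

text \<open>By symmetry of second derivatives, the group derivative and the derivative in the point
  may be exchanged. The bracket formula and the Killing equation both rest on this.\<close>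

lemma fder_field_rep_eq:
  assumes y: "y \<in> chart_im CM p"
  shows "((\<lambda>x. fder (act_rep p) (x, y) (0, w)) has_derivative (\<lambda>X. fder (field_rep p X) y w)) (at e0)"
proof -
  have "((\<lambda>x. fder (act_rep p) (x, y) (0, w)) has_derivative
      (\<lambda>X. fder (\<lambda>z. fder (act_rep p) z (0, w)) (e0, y) (X, 0))) (at e0)"
    by (rule fder_partial_fst[OF smooth_on_has_derivative[OF smooth_on_deriv[OF smooth_act_rep] act_rep_dom_e0[OF y]]])
  moreover have "fder (\<lambda>z. fder (act_rep p) z (0, w)) (e0, y) (X, 0) = fder (field_rep p X) y w" for X
    using smooth_on_symmetric_second_derivative[OF open_act_rep_dom act_rep_dom_e0[OF y] smooth_act_rep, of "(0, w)" "(X, 0)"]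
      fder_eqI[OF field_rep_has_derivative[OF y, of X]] by simp
  ultimately show ?thesis by simp
qed

text \<open>Differentiate \<open>act (a \<otimes> b) m = act a (act b m)\<close> at
  \<open>b = \<one>\<close> in direction \<open>Z\<close>, where \<open>m\<close> has coordinate
  \<open>y\<close>. On the left \<open>a\<close> moves along the left-invariant field of
  \<open>Z\<close>; on the right the differential of \<open>act a\<close> is applied to the action
  field of \<open>Z\<close>.\<close>

lemma field_rep_equivariance:
  assumes y: "y \<in> chart_im CM p"
  shows "\<forall>\<^sub>F x in nhds e0. fder (act_rep p) (x, y) (left_field_rep \<one> Z x, 0) = fder (act_rep p) (x, y) (0, field_rep p Z y)"
proof -
  have cont: "isCont (\<lambda>x. (x, y)) e0" by (intro continuous_intros)
  have ev: "\<forall>\<^sub>F x in nhds e0. (x, y) \<in> act_rep_dom p"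
    by (rule isCont_eventually_nhds[OF cont]) (rule eventually_nhds_in_open[OF open_act_rep_dom act_rep_dom_e0[OF y]])
  moreover have "fder (act_rep p) (x, y) (left_field_rep \<one> Z x, 0) = fder (act_rep p) (x, y) (0, field_rep p Z y)"
    if xy: "(x, y) \<in> act_rep_dom p" for x
  proof -
    have x: "x \<in> chart_im CG \<one>" using xy by (simp add: act_rep_dom_def)
    have m0: "mult_rep \<one> (x, e0) = x" by (simp add: mult_rep_def chart_map_inv[OF CG x])
    have "((\<lambda>x'. mult_rep \<one> (x, x')) has_derivative (\<lambda>Z. left_field_rep \<one> Z x)) (at e0)"
      unfolding left_field_rep_def
      by (rule has_derivative_compose[where f = "\<lambda>x'. (x, x')", OF _ smooth_on_has_derivative[OF smooth_mult_rep mult_rep_dom_e0[OF x]]])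
        (auto intro!: derivative_eq_intros)
    from has_derivative_Pair[OF this has_derivative_const[of y]]
    have 1: "((\<lambda>x'. (mult_rep \<one> (x, x'), y)) has_derivative (\<lambda>Z. (left_field_rep \<one> Z x, 0))) (at e0)" .
    have "(act_rep p has_derivative fder (act_rep p) (x, y)) (at (mult_rep \<one> (x, e0), y))"
      unfolding m0 by (rule act_rep_has_derivative[OF xy])
    from has_derivative_compose[OF 1 this]
    have L: "((\<lambda>x'. act_rep p (mult_rep \<one> (x, x'), y)) has_derivative
        (\<lambda>Z. fder (act_rep p) (x, y) (left_field_rep \<one> Z x, 0))) (at e0)" .
    have "((\<lambda>x'. act_rep p (x', y)) has_derivative (\<lambda>Z. field_rep p Z y)) (at e0)"
      unfolding field_rep_def by (rule fder_partial_fst[OF act_rep_has_derivative[OF act_rep_dom_e0[OF y]]])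
    from has_derivative_Pair[OF has_derivative_const[of x] this]
    have 2: "((\<lambda>x'. (x, act_rep p (x', y))) has_derivative (\<lambda>Z. (0, field_rep p Z y))) (at e0)" .
    have "(act_rep p has_derivative fder (act_rep p) (x, y)) (at (x, act_rep p (e0, y)))"
      unfolding act_rep_e0[OF y] by (rule act_rep_has_derivative[OF xy])
    from has_derivative_compose[OF 2 this]
    have R: "((\<lambda>x'. act_rep p (x, act_rep p (x', y))) has_derivative
        (\<lambda>Z. fder (act_rep p) (x, y) (0, field_rep p Z y))) (at e0)" .
    have "\<forall>\<^sub>F x' in nhds e0. (x, x') \<in> mult_rep_dom \<one>"
      by (rule isCont_eventually_nhds[where f = "\<lambda>x'. (x, x')"])
        (auto intro!: continuous_intros eventually_nhds_in_open[OF open_mult_rep_dom mult_rep_dom_e0[OF x]])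
    with ev have "\<forall>\<^sub>F x' in nhds e0. act_rep p (mult_rep \<one> (x, x'), y) = act_rep p (x, act_rep p (x', y))"
      by eventually_elim
        (auto simp: act_rep_def mult_rep_def mult_rep_dom_def act_rep_dom_def chart_inv_map[OF CG] chart_inv_map[OF CM] act_mult)
    from has_derivative_unique[OF has_derivative_eventually_cong[OF L this] R]
    show ?thesis by metis
  qed
  ultimately show ?thesis by (rule eventually_mono)
qed

text \<open>The right-hand side is minus the bracket of the two action fields in the convention of
  \<open>vf_bracket\<close>. Differentiating \<open>field_rep_equivariance\<close> at the identity
  in direction \<open>X\<close> gives \<open>key\<close>. Its term \<open>S X Z\<close>, a second
  derivative in the group variables, is symmetric and cancels when the identity with
  \<open>X\<close> and \<open>Z\<close> exchanged is subtracted.\<close>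

lemma action_field_bracket:
  "action_field G CG CM act (lie_bracket G CG X Z) p =
    fder (field_rep p X) (chart_map CM p p) (field_rep p Z (chart_map CM p p))
    - fder (field_rep p Z) (chart_map CM p p) (field_rep p X (chart_map CM p p))"
proof -
  let ?y = "chart_map CM p p"
  have y: "?y \<in> chart_im CM p" using chart_dom_self[OF CM] by blast
  define S where "S = (\<lambda>X Z. fder (\<lambda>z. fder (act_rep p) z (Z, 0)) (e0, ?y) (X, 0))"
  have S: "S X Z = S Z X" for X Z
    unfolding S_def by (rule smooth_on_symmetric_second_derivative[OF open_act_rep_dom act_rep_dom_e0[OF y] smooth_act_rep])
  have key: "S X Z + field_rep p (fder (left_field_rep \<one> Z) e0 X) ?y = fder (field_rep p X) ?y (field_rep p Z ?y)" for X Z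
  proof -
    have lin: "\<forall>\<^sub>F x in nhds e0. linear (\<lambda>w. fder (act_rep p) (x, ?y) (w, 0))"
    proof -
      have "\<forall>\<^sub>F x in nhds e0. (x, ?y) \<in> act_rep_dom p"
        by (rule isCont_eventually_nhds[where f = "\<lambda>x. (x, ?y)"])
          (auto intro!: continuous_intros eventually_nhds_in_open[OF open_act_rep_dom act_rep_dom_e0[OF y]])
      moreover have "linear (\<lambda>w. fder (act_rep p) (x, ?y) (w, 0))" if "(x, ?y) \<in> act_rep_dom p" for x
        by (rule has_derivative_linear[OF fder_partial_fst[OF act_rep_has_derivative[OF that]]])
      ultimately show ?thesis by (rule eventually_mono)
    qed
    have 1: "((\<lambda>x. fder (act_rep p) (x, ?y) (w, 0)) has_derivative (\<lambda>X. S X w)) (at e0)" for w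
      unfolding S_def
      by (rule fder_partial_fst[OF smooth_on_has_derivative[OF smooth_on_deriv[OF smooth_act_rep] act_rep_dom_e0[OF y]]])
    have "((\<lambda>x. fder (act_rep p) (x, ?y) (left_field_rep \<one> Z x, 0)) has_derivative
        (\<lambda>h. S h (left_field_rep \<one> Z e0) + fder (act_rep p) (e0, ?y) (fder (left_field_rep \<one> Z) e0 h, 0))) (at e0)"
      by (rule has_derivative_linear_family[OF manifold_fin_dim[OF CG] lin 1
            smooth_on_has_derivative[OF smooth_left_field_rep e0_im]])
    from has_derivative_unique[OF has_derivative_eventually_cong[OF this field_rep_equivariance[OF y]] fder_field_rep_eq[OF y]]
    show ?thesis unfolding left_field_rep_e0 field_rep_def[symmetric] by metis
  qed
  show ?thesis
    unfolding action_field_eq lie_bracket_eq linear_diff[OF field_rep_linear[OF y]]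
      key[of X Z, symmetric] key[of Z X, symmetric] S[of Z X] by simp
qed

end

section \<open>Inner products on finite-dimensional spaces\<close>

definition inner_form :: "('a::real_vector \<Rightarrow> 'a \<Rightarrow> real) \<Rightarrow> bool" where
  "inner_form \<beta> \<longleftrightarrow> bilinear \<beta> \<and> (\<forall>v w. \<beta> v w = \<beta> w v) \<and> (\<forall>v. v \<noteq> 0 \<longrightarrow> \<beta> v v > 0)"

definition orthonormal_set :: "('a::real_vector \<Rightarrow> 'a \<Rightarrow> real) \<Rightarrow> 'a set \<Rightarrow> bool" where
  "orthonormal_set \<beta> A \<longleftrightarrow> finite A \<and> (\<forall>a\<in>A. \<forall>b\<in>A. \<beta> a b = (if a = b then 1 else 0))"

lemma inner_form_linear:
  assumes "inner_form \<beta>"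
  shows "linear (\<lambda>v. \<beta> v w)" "linear (\<beta> v)"
  using assms unfolding inner_form_def bilinear_def by auto

lemma inner_form_sym: "inner_form \<beta> \<Longrightarrow> \<beta> v w = \<beta> w v"
  unfolding inner_form_def by blast

lemma inner_form_simps:
  assumes "inner_form \<beta>"
  shows "\<beta> (v + w) u = \<beta> v u + \<beta> w u" "\<beta> u (v + w) = \<beta> u v + \<beta> u w"
    "\<beta> (v - w) u = \<beta> v u - \<beta> w u" "\<beta> u (v - w) = \<beta> u v - \<beta> u w"
    "\<beta> (c *\<^sub>R v) u = c * \<beta> v u" "\<beta> u (c *\<^sub>R v) = c * \<beta> u v"
    "\<beta> (- v) u = - \<beta> v u" "\<beta> u (- v) = - \<beta> u v" "\<beta> 0 u = 0" "\<beta> u 0 = 0"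
  using inner_form_linear[OF assms]
  by (simp_all add: linear_add linear_diff linear_scale linear_neg linear_0
      linear_add[of "\<lambda>v. \<beta> v u"] linear_diff[of "\<lambda>v. \<beta> v u"] linear_scale[of "\<lambda>v. \<beta> v u"]
      linear_neg[of "\<lambda>v. \<beta> v u"] linear_0[of "\<lambda>v. \<beta> v u"])

lemma inner_form_sum:
  assumes "inner_form \<beta>"
  shows "\<beta> (\<Sum>i\<in>I. f i) u = (\<Sum>i\<in>I. \<beta> (f i) u)" "\<beta> u (\<Sum>i\<in>I. f i) = (\<Sum>i\<in>I. \<beta> u (f i))"
  using linear_sum[OF inner_form_linear(1)[OF assms]] linear_sum[OF inner_form_linear(2)[OF assms]] by auto

lemma inner_form_zero: "inner_form \<beta> \<Longrightarrow> (\<And>u. \<beta> z u = 0) \<Longrightarrow> z = 0"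
  unfolding inner_form_def by (metis less_irrefl)

lemma inner_form_eqI:
  assumes "inner_form \<beta>" "\<And>u. \<beta> v u = \<beta> w u" shows "v = w"
  using inner_form_zero[OF assms(1), of "v - w"] assms(2) by (simp add: inner_form_simps[OF assms(1)])

lemma orthonormal_expansion:
  assumes \<beta>: "inner_form \<beta>" and S: "orthonormal_set \<beta> A" and x: "x \<in> span A"
  shows "x = (\<Sum>a\<in>A. \<beta> x a *\<^sub>R a)"
proof -
  have fin: "finite A" using S unfolding orthonormal_set_def by blast
  obtain c where c: "x = (\<Sum>a\<in>A. c a *\<^sub>R a)" using x unfolding span_finite[OF fin] by blast
  have "\<beta> x b = c b" if b: "b \<in> A" for b
  proof -
    have "\<beta> x b = (\<Sum>a\<in>A. c a * \<beta> a b)"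
      unfolding c by (simp add: inner_form_sum[OF \<beta>] inner_form_simps[OF \<beta>])
    also have "\<dots> = (\<Sum>a\<in>A. if a = b then c a else 0)"
      using S b unfolding orthonormal_set_def by (intro sum.cong) auto
    also have "\<dots> = c b" using fin b by simp
    finally show ?thesis .
  qed
  then have "(\<Sum>a\<in>A. c a *\<^sub>R a) = (\<Sum>a\<in>A. \<beta> x a *\<^sub>R a)" by (intro sum.cong) auto
  then show ?thesis using c by simp
qed

text \<open>Gram-Schmidt. Linearly dependent \<open>A\<close> are covered: a vector equal to its
  projection \<open>p\<close> is dropped.\<close>

lemma orthonormal_set_exists:
  assumes \<beta>: "inner_form \<beta>" and "finite A"
  shows "\<exists>S. orthonormal_set \<beta> S \<and> span S = span A"
  using assms(2)
proof (induction A rule: finite_induct)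
  case empty
  show ?case by (rule exI[of _ "{}"]) (simp add: orthonormal_set_def)
next
  case (insert x A)
  then obtain S where S: "orthonormal_set \<beta> S" "span S = span A" by blast
  have fS: "finite S" using S unfolding orthonormal_set_def by blast
  define p where "p = (\<Sum>a\<in>S. \<beta> x a *\<^sub>R a)"
  have p: "p \<in> span S" unfolding p_def by (intro span_sum span_scale span_base)
  show ?case
  proof (cases "x = p")
    case True
    then have "span (insert x A) = span A" using p S(2) span_redundant by metis
    then show ?thesis using S by blast
  next
    case False
    define y where "y = x - p"
    have y: "\<beta> y y > 0" using False \<beta> unfolding y_def inner_form_def by simp
    have ya: "\<beta> y a = 0" "\<beta> a y = 0" if a: "a \<in> S" for a
    proof -
      have "\<beta> p a = (\<Sum>b\<in>S. \<beta> x b * \<beta> b a)"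
        unfolding p_def by (simp add: inner_form_sum[OF \<beta>] inner_form_simps[OF \<beta>])
      also have "\<dots> = (\<Sum>b\<in>S. if b = a then \<beta> x b else 0)"
        using S(1) a unfolding orthonormal_set_def by (intro sum.cong) auto
      also have "\<dots> = \<beta> x a" using fS a by simp
      finally show "\<beta> y a = 0" unfolding y_def by (simp add: inner_form_simps[OF \<beta>])
      then show "\<beta> a y = 0" using inner_form_sym[OF \<beta>] by metis
    qed
    define e where "e = (1 / sqrt (\<beta> y y)) *\<^sub>R y"
    have ee: "\<beta> e e = 1" unfolding e_def using y by (simp add: inner_form_simps[OF \<beta>] field_simps)
    have ea: "\<beta> e a = 0" "\<beta> a e = 0" if "a \<in> S" for a
      unfolding e_def using ya[OF that] by (simp_all add: inner_form_simps[OF \<beta>])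
    have eS: "e \<notin> S" using ea(1)[of e] ee by auto
    have "orthonormal_set \<beta> (insert e S)"
      using S(1) ee ea eS unfolding orthonormal_set_def by auto
    moreover have "span (insert e S) = span (insert x A)"
    proof (rule span_eq[THEN iffD2], intro conjI subsetI)
      fix z assume z: "z \<in> insert e S"
      have sub: "span S \<subseteq> span (insert x A)" unfolding S(2) by (rule span_mono) auto
      show "z \<in> span (insert x A)"
      proof (cases "z = e")
        case True
        have "x \<in> span (insert x A)" "p \<in> span (insert x A)" using p sub by (auto intro: span_base)
        then show ?thesis unfolding True e_def y_def by (intro span_scale span_diff)
      next
        case False
        then show ?thesis using z sub span_base by blast
      qed
    next
      fix z assume z: "z \<in> insert x A"
      have sub: "span S \<subseteq> span (insert e S)" by (rule span_mono) auto
      show "z \<in> span (insert e S)"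
      proof (cases "z = x")
        case True
        have "z = sqrt (\<beta> y y) *\<^sub>R e + p" unfolding True e_def using y by (simp add: y_def)
        moreover have "e \<in> span (insert e S)" "p \<in> span (insert e S)" using p sub by (auto intro: span_base)
        ultimately show ?thesis by (metis span_add span_scale)
      next
        case False
        then have "z \<in> span S" using z S(2) span_base by blast
        then show ?thesis using sub by blast
      qed
    qed
    ultimately show ?thesis by blast
  qed
qed

text \<open>The sum of l(a) a over an orthonormal basis represents \<open>l\<close>. This is the
  existence behind the definite description in \<open>christoffel\<close>.\<close>

lemma inner_form_riesz:
  fixes \<beta> :: "'a::real_normed_vector \<Rightarrow> 'a \<Rightarrow> real"
  assumes fd: "fin_dim TYPE('a)" and \<beta>: "inner_form \<beta>" and l: "linear l"
  shows "\<exists>z. \<forall>u. \<beta> z u = l u"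
proof -
  obtain B :: "'a set" where B: "finite B" "span B = UNIV" using fd unfolding fin_dim_def by blast
  obtain A where A: "orthonormal_set \<beta> A" "span A = UNIV"
    using orthonormal_set_exists[OF \<beta> B(1)] B(2) by metis
  have "\<beta> (\<Sum>a\<in>A. l a *\<^sub>R a) u = l u" for u
  proof -
    have u: "u = (\<Sum>a\<in>A. \<beta> u a *\<^sub>R a)" by (rule orthonormal_expansion[OF \<beta> A(1)]) (simp add: A)
    have "\<beta> (\<Sum>a\<in>A. l a *\<^sub>R a) u = (\<Sum>a\<in>A. \<beta> u a * l a)"
      by (simp add: inner_form_sum[OF \<beta>] inner_form_simps[OF \<beta>] inner_form_sym[OF \<beta>, of u] mult.commute)
    also have "\<dots> = l u" using linear_coords[OF l u] by simp
    finally show ?thesis .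
  qed
  then show ?thesis by blast
qed

lemma orthogonal_part_unique:
  assumes \<beta>: "inner_form \<beta>" and S: "subspace S" "u \<in> S" "v \<in> S"
    and "\<And>x. x \<in> S \<Longrightarrow> \<beta> (w - u) x = 0" "\<And>x. x \<in> S \<Longrightarrow> \<beta> (w - v) x = 0"
  shows "u = v"
proof -
  have "\<beta> (u - v) (u - v) = \<beta> (w - v) (u - v) - \<beta> (w - u) (u - v)"
    by (simp add: inner_form_simps[OF \<beta>])
  also have "\<dots> = 0" using assms(5,6) subspace_diff[OF S] by simp
  finally have "u - v = 0" using \<beta> unfolding inner_form_def by (metis less_irrefl)
  then show ?thesis by simp
qed

text \<open>Two applications of the product rule for linear families, one for each slot.\<close>

lemma has_derivative_bilinear_family:
  fixes B :: "'z::real_normed_vector \<Rightarrow> 'a::real_normed_vector \<Rightarrow> 'a \<Rightarrow> real"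
  assumes fd: "fin_dim TYPE('a)"
    and bil: "\<forall>\<^sub>F z in nhds z0. bilinear (B z)"
    and B': "\<And>v w. ((\<lambda>z. B z v w) has_derivative B' v w) (at z0)"
    and u: "(u has_derivative u') (at z0)" and v: "(v has_derivative v') (at z0)"
  shows "((\<lambda>z. B z (u z) (v z)) has_derivative
    (\<lambda>h. B' (u z0) (v z0) h + B z0 (u' h) (v z0) + B z0 (u z0) (v' h))) (at z0)"
proof -
  have ud: "((\<lambda>z. B z (u z) w) has_derivative (\<lambda>h. B' (u z0) w h + B z0 (u' h) w)) (at z0)" for w
    by (rule has_derivative_linear_family[OF fd, where L = "\<lambda>z v. B z v w", OF _ B' u])
      (use bil in \<open>auto elim!: eventually_mono simp: bilinear_def\<close>)
  have lin: "\<forall>\<^sub>F z in nhds z0. linear (B z (u z))"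
    using bil by (auto elim!: eventually_mono simp: bilinear_def)
  from has_derivative_linear_family[where L = "\<lambda>z w. B z (u z) w", OF fd lin ud v]
  show ?thesis .
qed

section \<open>Riemannian metrics in charts\<close>

definition metric_deriv ::
  "('m, 'e::real_normed_vector) charts \<Rightarrow> ('m \<Rightarrow> 'e \<Rightarrow> 'e \<Rightarrow> real) \<Rightarrow> 'm \<Rightarrow> 'e \<Rightarrow> 'e \<Rightarrow> 'e \<Rightarrow> real" where
  "metric_deriv C g p a b c = fder (\<lambda>y. chart_metric C g p y b c) (chart_map C p p) a"

locale riemannian =
  fixes C :: "('m::t2_space, 'e::banach) charts" and g :: "'m \<Rightarrow> 'e \<Rightarrow> 'e \<Rightarrow> real"
  assumes C: "smooth_manifold C" and g: "riemannian_metric C g"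
begin

lemma inner_form_metric: "inner_form (g p)"
  using g unfolding riemannian_metric_def inner_form_def by blast

lemmas metric_simps = inner_form_simps[OF inner_form_metric]

lemma metric_sym: "g p v w = g p w v"
  by (rule inner_form_sym[OF inner_form_metric])

lemma base_im: "chart_map C p p \<in> chart_im C p"
  using chart_dom_self[OF C] by blast

lemma chart_metric_eq:
  assumes "x \<in> chart_dom C p"
  shows "chart_metric C g p (chart_map C p x) v w =
    g x (fder (local_rep C C p x id) (chart_map C p x) v) (fder (local_rep C C p x id) (chart_map C p x) w)"
  by (simp add: chart_metric_def Let_def local_rep_def chart_inv_map[OF C assms])

lemma chart_metric_self: "chart_metric C g p (chart_map C p p) v w = g p v w"
  by (simp add: chart_metric_eq chart_dom_self[OF C] fder_local_rep_id[OF C])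

lemma chart_metric_bilinear:
  assumes "y \<in> chart_im C p" shows "bilinear (chart_metric C g p y)"
proof -
  obtain x where x: "y = chart_map C p x" "x \<in> chart_dom C p" using assms by blast
  have l: "linear (fder (local_rep C C p x id) (chart_map C p x))"
    by (rule has_derivative_linear[OF smooth_map_has_derivative[OF C C smooth_map_id[OF C] x(2)]])
      (simp add: chart_dom_self[OF C])
  have "linear (\<lambda>w. chart_metric C g p y v w)" for v
    unfolding x(1) chart_metric_eq[OF x(2)]
    using linear_compose[OF l inner_form_linear(2)[OF inner_form_metric]] by (simp add: o_def)
  moreover have "linear (\<lambda>v. chart_metric C g p y v w)" for w
    unfolding x(1) chart_metric_eq[OF x(2)]
    using linear_compose[OF l inner_form_linear(1)[OF inner_form_metric]] by (simp add: o_def)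
  ultimately show ?thesis unfolding bilinear_def by blast
qed

lemma chart_metric_has_derivative:
  "((\<lambda>y. chart_metric C g p y v w) has_derivative (\<lambda>a. metric_deriv C g p a v w)) (at (chart_map C p p))"
  unfolding metric_deriv_def
proof (rule smooth_on_has_derivative[OF _ base_im])
  show "smooth_on (chart_im C p) (\<lambda>y. chart_metric C g p y v w)"
    using g unfolding riemannian_metric_def by blast
qed

text \<open>The isometry condition refers to the preferred charts at \<open>x\<close> and
  \<open>f x\<close>. Passing to these charts before or after applying \<open>f\<close> gives the
  same differential, namely that of \<open>f\<close> from the chart at \<open>p\<close> to the chart
  at \<open>f x\<close>.\<close>

lemma chart_metric_isometry:
  assumes f: "is_isometry C g f" and x: "x \<in> chart_dom C p" "f x \<in> chart_dom C q"
  shows "chart_metric C g q (chart_map C q (f x)) (fder (local_rep C C p q f) (chart_map C p x) v)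
      (fder (local_rep C C p q f) (chart_map C p x) w) = chart_metric C g p (chart_map C p x) v w"
proof -
  have sf: "smooth_map C C f" using f unfolding is_isometry_def by blast
  have "fder (local_rep C C q (f x) id) (chart_map C q (f x)) (fder (local_rep C C p q f) (chart_map C p x) v) =
      fder (local_rep C C x (f x) f) (chart_map C x x) (fder (local_rep C C p x id) (chart_map C p x) v)" for v
    using fder_local_rep_compose[OF C C C sf smooth_map_id[OF C] x, of "f x" v]
      fder_local_rep_compose[OF C C C smooth_map_id[OF C] sf x(1), of x "f x" v]
    by (simp add: chart_dom_self[OF C])
  moreover have "tangent_map C C f x = fder (local_rep C C x (f x) f) (chart_map C x x)"
    by (simp add: tangent_map_def local_rep_def)
  ultimately show ?thesis
    using f unfolding is_isometry_def chart_metric_eq[OF x(1)] chart_metric_eq[OF x(2)] by metis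
qed

text \<open>Differentiates the isometry identity at a parameter \<open>zo\<close> where the
  differentials \<open>l\<close> are the identity. It serves three times: for the action on the
  manifold, and for left and right translations of the group.\<close>

lemma metric_deriv_isometry_family:
  fixes a :: "'z::real_normed_vector \<Rightarrow> 'e"
  assumes a: "(a has_derivative a') (at zo)" "a zo = chart_map C p p"
    and l: "\<And>v. ((\<lambda>z. l z v) has_derivative l' v) (at zo)" "\<And>v. l zo v = v"
    and iso: "\<forall>\<^sub>F z in nhds zo. chart_metric C g p (a z) (l z v) (l z w) = g p v w"
  shows "metric_deriv C g p (a' h) v w + g p (l' v h) w + g p v (l' w h) = 0"
proof -
  have "isCont a zo" using has_derivative_continuous[OF a(1)] .
  then have "\<forall>\<^sub>F z in nhds zo. a z \<in> chart_im C p"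
    by (rule isCont_eventually_nhds) (use a(2) base_im eventually_nhds_in_open[OF open_chart_im[OF C]] in simp)
  then have bil: "\<forall>\<^sub>F z in nhds zo. bilinear (chart_metric C g p (a z))"
    by (rule eventually_mono) (rule chart_metric_bilinear)
  have B': "((\<lambda>z. chart_metric C g p (a z) v w) has_derivative (\<lambda>h. metric_deriv C g p (a' h) v w)) (at zo)" for v w
    by (rule has_derivative_compose[OF a(1)]) (use chart_metric_has_derivative a(2) in simp)
  have "((\<lambda>z. chart_metric C g p (a z) (l z v) (l z w)) has_derivative
      (\<lambda>h. metric_deriv C g p (a' h) (l zo v) (l zo w) + chart_metric C g p (a zo) (l' v h) (l zo w)
        + chart_metric C g p (a zo) (l zo v) (l' w h))) (at zo)"
    by (rule has_derivative_bilinear_family[OF manifold_fin_dim[OF C] bil B' l(1) l(1)])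
  from has_derivative_unique[OF has_derivative_eventually_cong[OF this iso] has_derivative_const]
  show ?thesis by (simp add: a(2) l(2) chart_metric_self fun_eq_iff)
qed

lemma metric_deriv_sym: "metric_deriv C g p a b c = metric_deriv C g p a c b"
proof -
  have "chart_metric C g p y b c = chart_metric C g p y c b" for y
    unfolding chart_metric_def Let_def by (rule metric_sym)
  then show ?thesis unfolding metric_deriv_def by simp
qed

lemma metric_deriv_linear1: "linear (\<lambda>a. metric_deriv C g p a b c)"
  by (rule has_derivative_linear[OF chart_metric_has_derivative])

lemma metric_deriv_linear3: "linear (\<lambda>c. metric_deriv C g p a b c)"
proof (rule linearI)
  have ev: "\<forall>\<^sub>F y in nhds (chart_map C p p). bilinear (chart_metric C g p y)"
    using eventually_nhds_in_open[OF open_chart_im[OF C] base_im] by (rule eventually_mono) (rule chart_metric_bilinear)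
  show "metric_deriv C g p a b (c + d) = metric_deriv C g p a b c + metric_deriv C g p a b d" for c d
  proof -
    have "\<forall>\<^sub>F y in nhds (chart_map C p p). chart_metric C g p y b c + chart_metric C g p y b d = chart_metric C g p y b (c + d)"
      using ev by (rule eventually_mono) (simp add: bilinear_radd)
    from has_derivative_unique[OF has_derivative_eventually_cong[OF has_derivative_add[OF chart_metric_has_derivative chart_metric_has_derivative] this]
        chart_metric_has_derivative]
    show ?thesis by metis
  qed
  show "metric_deriv C g p a b (k *\<^sub>R c) = k *\<^sub>R metric_deriv C g p a b c" for k c
  proof -
    have "\<forall>\<^sub>F y in nhds (chart_map C p p). k *\<^sub>R chart_metric C g p y b c = chart_metric C g p y b (k *\<^sub>R c)"
      using ev by (rule eventually_mono) (simp add: bilinear_rmul)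
    from has_derivative_unique[OF has_derivative_eventually_cong[OF has_derivative_scaleR_right[OF chart_metric_has_derivative] this]
        chart_metric_has_derivative]
    show ?thesis by metis
  qed
qed

lemma metric_deriv_linear2: "linear (\<lambda>b. metric_deriv C g p a b c)"
  using metric_deriv_linear3 by (subst metric_deriv_sym)

text \<open>The Koszul expression is linear in \<open>u\<close> and therefore represented by a
  vector; uniqueness of this vector resolves the definite description.\<close>

lemma christoffel_metric:
  "g p (christoffel C g p v w) u =
    (metric_deriv C g p v w u + metric_deriv C g p w v u - metric_deriv C g p u v w) / 2"
proof -
  let ?l = "\<lambda>u. (metric_deriv C g p v w u + metric_deriv C g p w v u - metric_deriv C g p u v w) / 2"
  have "linear (\<lambda>u. (1/2) *\<^sub>R (metric_deriv C g p v w u + metric_deriv C g p w v u - metric_deriv C g p u v w))"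
    by (intro linear_compose_scale_right linear_compose_sub linear_compose_add metric_deriv_linear1 metric_deriv_linear3)
  then have lin: "linear ?l" by simp
  obtain z where z: "\<forall>u. g p z u = ?l u"
    using inner_form_riesz[OF manifold_fin_dim[OF C] inner_form_metric lin] by blast
  have "christoffel C g p v w = (THE z. \<forall>u. g p z u = ?l u)"
    unfolding christoffel_def metric_deriv_def Let_def ..
  also have "\<dots> = z"
  proof (rule the_equality)
    show "\<forall>u. g p z u = ?l u" by (rule z)
    show "z' = z" if "\<forall>u. g p z' u = ?l u" for z'
      by (rule inner_form_eqI[OF inner_form_metric[of p]]) (simp only: that z)
  qed
  finally show ?thesis using z by blast
qed

lemma christoffel_linear1: "linear (\<lambda>v. christoffel C g p v w)"
  by (rule linearI; rule inner_form_eqI[OF inner_form_metric[of p]])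
    (simp_all add: metric_simps christoffel_metric linear_add[OF metric_deriv_linear1] linear_add[OF metric_deriv_linear2]
      linear_scale[OF metric_deriv_linear1] linear_scale[OF metric_deriv_linear2] field_simps)

lemma christoffel_sym: "christoffel C g p v w = christoffel C g p w v"
  by (rule inner_form_eqI[OF inner_form_metric[of p]])
    (simp add: christoffel_metric metric_deriv_sym[of p _ v w])

lemma christoffel_linear2: "linear (\<lambda>w. christoffel C g p v w)"
  using christoffel_linear1 by (subst christoffel_sym)

end

section \<open>Isometric actions\<close>

locale isometric_smooth_action = smooth_action G CG CM act + riemannian CM g
  for G :: "'g::t2_space monoid" (structure) and CG :: "('g, 'h::banach) charts"
    and CM :: "('m::t2_space, 'e::banach) charts" and act :: "'g \<Rightarrow> 'm \<Rightarrow> 'm" and g :: "'m \<Rightarrow> 'e \<Rightarrow> 'e \<Rightarrow> real" +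
  assumes iso: "is_isometry CM g (act a)"
begin

abbreviation base :: "'m \<Rightarrow> 'e" where "base p \<equiv> chart_map CM p p"

abbreviation dfield :: "'m \<Rightarrow> 'h \<Rightarrow> 'e \<Rightarrow> 'e" where "dfield p X \<equiv> fder (field_rep p X) (base p)"

abbreviation fld :: "'m \<Rightarrow> 'h \<Rightarrow> 'e" where "fld p X \<equiv> action_field G CG CM act X p"

text \<open>The family of isometries is x \<mapsto> \<open>act (chart_inv CG \<one> x)\<close>. By
  \<open>fder_field_rep_eq\<close> its differentials at \<open>p\<close> have derivative
  \<open>dfield p X\<close> in direction \<open>X\<close>.\<close>

lemma killing_equation:
  "metric_deriv CM g p (fld p X) v w + g p (dfield p X v) w + g p v (dfield p X w) = 0"
proof -
  note y = base_im[of p]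
  have "metric_deriv CM g p (fder (act_rep p) (e0, base p) (X, 0)) v w + g p (dfield p X v) w + g p v (dfield p X w) = 0"
  proof (rule metric_deriv_isometry_family[where a = "\<lambda>x. act_rep p (x, base p)" and zo = e0
        and l = "\<lambda>x v. fder (act_rep p) (x, base p) (0, v)" and l' = "\<lambda>v X. dfield p X v"])
    show "((\<lambda>x. act_rep p (x, base p)) has_derivative (\<lambda>X. fder (act_rep p) (e0, base p) (X, 0))) (at e0)"
      by (rule fder_partial_fst[OF act_rep_has_derivative[OF act_rep_dom_e0[OF y]]])
    have "\<forall>\<^sub>F x in nhds e0. (x, base p) \<in> act_rep_dom p"
      by (rule isCont_eventually_nhds[where f = "\<lambda>x. (x, base p)"])
        (auto intro!: continuous_intros eventually_nhds_in_open[OF open_act_rep_dom act_rep_dom_e0[OF y]])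
    then show "\<forall>\<^sub>F x in nhds e0. chart_metric CM g p (act_rep p (x, base p)) (fder (act_rep p) (x, base p) (0, v))
        (fder (act_rep p) (x, base p) (0, w)) = g p v w"
    proof (rule eventually_mono)
      fix x assume x: "(x, base p) \<in> act_rep_dom p"
      let ?a = "chart_inv CG \<one> x"
      have ap: "act ?a p \<in> chart_dom CM p" using x by (simp add: act_rep_dom_def chart_inv_map[OF CM chart_dom_self[OF CM]])
      have "local_rep CM CM p p (act ?a) = (\<lambda>y. act_rep p (x, y))"
        by (simp add: local_rep_def act_rep_def fun_eq_iff)
      then have "fder (local_rep CM CM p p (act ?a)) (base p) = (\<lambda>v. fder (act_rep p) (x, base p) (0, v))"
        using fder_eqI[OF fder_partial_snd[OF act_rep_has_derivative[OF x]]] by simp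
      moreover have "act_rep p (x, base p) = chart_map CM p (act ?a p)"
        by (simp add: act_rep_def chart_inv_map[OF CM chart_dom_self[OF CM]])
      ultimately show "chart_metric CM g p (act_rep p (x, base p)) (fder (act_rep p) (x, base p) (0, v))
          (fder (act_rep p) (x, base p) (0, w)) = g p v w"
        using chart_metric_isometry[OF iso chart_dom_self[OF CM] ap, of v w] chart_metric_self by simp
    qed
  qed (use act_rep_e0[OF y] fder_act_rep_snd[OF y] fder_field_rep_eq[OF y] in auto)
  then show ?thesis by (simp add: action_field_eq field_rep_def)
qed

text \<open>The first argument on the left is \<open>\<nabla>\<^sub>X\<^sub>*X\<^sup>*\<close> at \<open>p\<close>.\<close>

lemma action_field_acceleration:
  "g p (dfield p X (fld p X) + christoffel CM g p (fld p X) (fld p X)) (fld p Z) = - g p (fld p (lie_bracket G CG X Z)) (fld p X)"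
proof -
  let ?V = "fld p X" and ?W = "fld p Z"
  have 1: "metric_deriv CM g p ?V ?V ?W = - g p (dfield p X ?V) ?W - g p ?V (dfield p X ?W)"
    using killing_equation[of p X ?V ?W] by simp
  have 2: "metric_deriv CM g p ?W ?V ?V = - 2 * g p (dfield p Z ?V) ?V"
    using killing_equation[of p Z ?V ?V] metric_sym[of p ?V "dfield p Z ?V"] by simp
  have 3: "fld p (lie_bracket G CG X Z) = dfield p X ?W - dfield p Z ?V"
    using action_field_bracket[of X Z p] by (simp add: action_field_eq)
  show ?thesis
    unfolding metric_simps christoffel_metric 1 2 3 using metric_sym[of p ?V "dfield p X ?W"] by (simp add: field_simps)
qed

end

text \<open>Left and right translations are two families of isometries through the identity.
  Differentiating them gives two equations with the same \<open>metric_deriv\<close> term, and by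
  \<open>lie_bracket_eq\<close> the difference of the remaining terms consists of brackets.\<close>

lemma (in lie_grp) lie_bracket_skew:
  assumes Q: "biinvariant_metric G CG Q"
  shows "Q \<one> (lie_bracket G CG X v) w + Q \<one> v (lie_bracket G CG X w) = 0"
proof -
  interpret riemannian CG Q
    using Q CG unfolding biinvariant_metric_def by unfold_locales auto
  have L: "is_isometry CG Q (\<lambda>b. a \<otimes> b)" and R: "is_isometry CG Q (\<lambda>b. b \<otimes> a)" for a
    using Q unfolding biinvariant_metric_def by auto
  have ev: "\<forall>\<^sub>F x in nhds e0. x \<in> chart_im CG \<one>"
    by (rule eventually_nhds_in_open[OF open_chart_im[OF CG] e0_im])
  have left: "metric_deriv CG Q \<one> X v w + Q \<one> (fder (left_field_rep \<one> v) e0 X) w + Q \<one> v (fder (left_field_rep \<one> w) e0 X) = 0"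
  proof (rule metric_deriv_isometry_family[where a = "\<lambda>x. x" and zo = e0 and a' = "\<lambda>X. X"
        and l = "\<lambda>x v. left_field_rep \<one> v x" and l' = "\<lambda>v X. fder (left_field_rep \<one> v) e0 X"])
    show "((\<lambda>z. left_field_rep \<one> v z) has_derivative fder (left_field_rep \<one> v) e0) (at e0)" for v
      by (rule smooth_on_has_derivative[OF smooth_left_field_rep e0_im])
    show "\<forall>\<^sub>F x in nhds e0. chart_metric CG Q \<one> x (left_field_rep \<one> v x) (left_field_rep \<one> w x) = Q \<one> v w"
      using ev
    proof (rule eventually_mono)
      fix x assume x: "x \<in> chart_im CG \<one>"
      let ?a = "chart_inv CG \<one> x"
      have a: "?a \<in> chart_dom CG \<one>" by (rule chart_inv_dom[OF CG x])
      have "fder (local_rep CG CG \<one> \<one> (\<lambda>b. ?a \<otimes> b)) e0 = (\<lambda>v. left_field_rep \<one> v x)"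
        using fder_eqI[OF left_mult_has_derivative[OF a]] by (simp add: chart_map_inv[OF CG x])
      then show "chart_metric CG Q \<one> x (left_field_rep \<one> v x) (left_field_rep \<one> w x) = Q \<one> v w"
        using chart_metric_isometry[OF L chart_dom_self[OF CG], of ?a \<one> \<one> v w] a chart_metric_self[of \<one> v w]
        by (simp add: chart_map_inv[OF CG x])
    qed
  qed (auto simp: left_field_rep_e0)
  \<comment> \<open>Here \<open>l\<close> is the right-invariant field of \<open>v\<close>. Its
    derivative in direction \<open>X\<close> equals that of the left-invariant field of
    \<open>X\<close> in direction \<open>v\<close>, since both are the mixed second derivative of
    the multiplication.\<close>
  have right: "metric_deriv CG Q \<one> X v w + Q \<one> (fder (left_field_rep \<one> X) e0 v) w + Q \<one> v (fder (left_field_rep \<one> X) e0 w) = 0"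
  proof (rule metric_deriv_isometry_family[where a = "\<lambda>x. x" and zo = e0 and a' = "\<lambda>X. X"
        and l = "\<lambda>x v. fder (mult_rep \<one>) (e0, x) (v, 0)" and l' = "\<lambda>v X. fder (left_field_rep \<one> X) e0 v"])
    show "fder (mult_rep \<one>) (e0, e0) (v, 0) = v" for v
      using fder_eqI[OF mult_rep_has_derivative_e0] by simp
    show "((\<lambda>x. fder (mult_rep \<one>) (e0, x) (v, 0)) has_derivative (\<lambda>X. fder (left_field_rep \<one> X) e0 v)) (at e0)" for v
    proof -
      note z = mult_rep_dom_e0[OF e0_im]
      have "((\<lambda>x. fder (mult_rep \<one>) (e0, x) (v, 0)) has_derivative
          (\<lambda>X. fder (\<lambda>z. fder (mult_rep \<one>) z (v, 0)) (e0, e0) (0, X))) (at e0)"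
        by (rule fder_partial_snd[OF smooth_on_has_derivative[OF smooth_on_deriv[OF smooth_mult_rep] z]])
      moreover have "((\<lambda>x. left_field_rep \<one> X x) has_derivative
          (\<lambda>v. fder (\<lambda>z. fder (mult_rep \<one>) z (0, X)) (e0, e0) (v, 0))) (at e0)" for X
        unfolding left_field_rep_def
        by (rule fder_partial_fst[OF smooth_on_has_derivative[OF smooth_on_deriv[OF smooth_mult_rep] z]])
      then have "fder (left_field_rep \<one> X) e0 v = fder (\<lambda>z. fder (mult_rep \<one>) z (0, X)) (e0, e0) (v, 0)" for X
        using fder_eqI by metis
      moreover have "fder (\<lambda>z. fder (mult_rep \<one>) z (0, X)) (e0, e0) (v, 0) = fder (\<lambda>z. fder (mult_rep \<one>) z (v, 0)) (e0, e0) (0, X)" for X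
        by (rule smooth_on_symmetric_second_derivative[OF open_mult_rep_dom z smooth_mult_rep])
      ultimately show ?thesis by simp
    qed
    show "\<forall>\<^sub>F x in nhds e0. chart_metric CG Q \<one> x (fder (mult_rep \<one>) (e0, x) (v, 0)) (fder (mult_rep \<one>) (e0, x) (w, 0)) = Q \<one> v w"
      using ev
    proof (rule eventually_mono)
      fix x assume x: "x \<in> chart_im CG \<one>"
      let ?a = "chart_inv CG \<one> x"
      have a: "?a \<in> chart_dom CG \<one>" by (rule chart_inv_dom[OF CG x])
      have d: "(e0, x) \<in> mult_rep_dom \<one>" using x a by (simp add: mult_rep_dom_def e0_im)
      have "local_rep CG CG \<one> \<one> (\<lambda>b. b \<otimes> ?a) = (\<lambda>y. mult_rep \<one> (y, x))"
        by (simp add: local_rep_def mult_rep_def fun_eq_iff)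
      then have "fder (local_rep CG CG \<one> \<one> (\<lambda>b. b \<otimes> ?a)) e0 = (\<lambda>v. fder (mult_rep \<one>) (e0, x) (v, 0))"
        using fder_eqI[OF fder_partial_fst[OF smooth_on_has_derivative[OF smooth_mult_rep d]]] by simp
      then show "chart_metric CG Q \<one> x (fder (mult_rep \<one>) (e0, x) (v, 0)) (fder (mult_rep \<one>) (e0, x) (w, 0)) = Q \<one> v w"
        using chart_metric_isometry[OF R[of ?a] chart_dom_self[OF CG, of \<one>], of \<one> v w] a chart_metric_self[of \<one> v w]
        by (simp add: chart_map_inv[OF CG x])
    qed
  qed auto
  show ?thesis
    using left right unfolding lie_bracket_eq metric_simps by simp
qed

section \<open>Twice differentiable maps\<close>

text \<open>The regularity that \<open>nabla_d\<close> uses at \<open>x\<close>: second derivatives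
  are asked for at the point itself and for one direction \<open>w\<close> at a time.\<close>

definition twice_differentiable_at ::
  "('a::real_normed_vector \<Rightarrow> 'b::real_normed_vector) \<Rightarrow> 'a \<Rightarrow> bool" where
  "twice_differentiable_at f x \<longleftrightarrow> (\<forall>\<^sub>F y in nhds x. f differentiable (at y)) \<and>
     (\<forall>w. (\<lambda>y. fder f y w) differentiable (at x))"

lemma differentiable_eventually_cong:
  "f differentiable (at x) \<Longrightarrow> \<forall>\<^sub>F y in nhds x. f y = g y \<Longrightarrow> g differentiable (at x)"
  unfolding differentiable_def using has_derivative_eventually_cong by blast

text \<open>A product rule with one factor merely continuous: as b(x) = 0, the term b(y) (h(y) -
  h(x)) is O(|y - x|) times o(1) and has derivative zero, so that b(y) h(x) alone
  contributes.\<close>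

lemma has_derivative_scaleR_vanishing:
  fixes b :: "'a::real_normed_vector \<Rightarrow> real" and h :: "'a \<Rightarrow> 'b::real_normed_vector"
  assumes b: "(b has_derivative b') (at x)" "b x = 0" and h: "isCont h x"
  shows "((\<lambda>y. b y *\<^sub>R h y) has_derivative (\<lambda>v. b' v *\<^sub>R h x)) (at x)"
proof -
  have bl: "bounded_linear b'" using b(1) by (rule has_derivative_bounded_linear)
  obtain K where K: "K > 0" "\<And>v. norm (b' v) \<le> norm v * K" using bounded_linear.pos_bounded[OF bl] by blast
  have lim: "((\<lambda>y. norm (b y - b x - b' (y - x)) / norm (y - x)) \<longlongrightarrow> 0) (at x)"
    using b(1) unfolding has_derivative_iff_norm by blast
  have hl: "((\<lambda>y. norm (h y - h x)) \<longlongrightarrow> 0) (at x)"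
    using h by (intro tendsto_norm_zero) (simp add: isCont_def LIM_zero)
  have "((\<lambda>y. b y *\<^sub>R (h y - h x)) has_derivative (\<lambda>v. 0)) (at x)"
    unfolding has_derivative_iff_norm
  proof (intro conjI bounded_linear_zero)
    have "((\<lambda>y. (norm (b y - b x - b' (y - x)) / norm (y - x) + K) * norm (h y - h x)) \<longlongrightarrow> (0 + K) * 0) (at x)"
      by (intro tendsto_mult tendsto_add lim hl tendsto_const)
    then have L: "((\<lambda>y. (norm (b y - b x - b' (y - x)) / norm (y - x) + K) * norm (h y - h x)) \<longlongrightarrow> 0) (at x)" by simp
    have le: "norm (norm (b y *\<^sub>R (h y - h x) - b x *\<^sub>R (h x - h x) - 0) / norm (y - x))
        \<le> (norm (b y - b x - b' (y - x)) / norm (y - x) + K) * norm (h y - h x)" if "y \<noteq> x" for y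
    proof -
      have n: "norm (y - x) > 0" using that by simp
      have "norm (b y) \<le> norm (b y - b x - b' (y - x)) + norm (b' (y - x))"
        using norm_triangle_ineq[of "b y - b x - b' (y - x)" "b' (y - x)"] b(2) by simp
      also have "\<dots> \<le> norm (b y - b x - b' (y - x)) + norm (y - x) * K" using K(2) by simp
      finally have "norm (b y) / norm (y - x) \<le> norm (b y - b x - b' (y - x)) / norm (y - x) + K"
        using n by (simp add: field_simps)
      from mult_right_mono[OF this, of "norm (h y - h x)"] show ?thesis by simp
    qed
    show "((\<lambda>y. norm (b y *\<^sub>R (h y - h x) - b x *\<^sub>R (h x - h x) - 0) / norm (y - x)) \<longlongrightarrow> 0) (at x)"
      by (rule Lim_null_comparison[OF _ L]) (use le in \<open>auto simp: eventually_at_filter\<close>)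
  qed
  from has_derivative_add[OF has_derivative_scaleR_left[OF b(1), of "h x"] this]
  show ?thesis by (simp add: algebra_simps)
qed

text \<open>From Dh(y) D\<Phi>(h(y)) w = w one gets Dh(y) w - w = Dh(y) (w - D\<Phi>(h(y)) w). The
  argument on the right is differentiable in y and vanishes at \<open>\<Phi> x0\<close>, where
  D\<Phi> is the identity. Hence continuity of Dh at this point already makes Dh(y) w differentiable
  there.\<close>

lemma local_inverse_twice_differentiable:
  fixes \<Phi> :: "'e::euclidean_space \<Rightarrow> 'e"
  assumes N: "open N" "x0 \<in> N" and \<Phi>: "smooth_on N \<Phi>" and id: "\<And>v. fder \<Phi> x0 v = v"
  obtains V h where "open V" "\<Phi> x0 \<in> V" "h (\<Phi> x0) = x0" "\<And>y. y \<in> V \<Longrightarrow> h y \<in> N \<and> \<Phi> (h y) = y"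
    "\<And>y. y \<in> V \<Longrightarrow> (h has_derivative fder h y) (at y)"
    "\<And>w. (\<lambda>y. fder h y w) differentiable (at (\<Phi> x0))"
proof -
  define f' where "f' = (\<lambda>x. Blinfun (fder \<Phi> x))"
  have f': "blinfun_apply (f' x) = fder \<Phi> x" if "x \<in> N" for x
    unfolding f'_def
    by (rule bounded_linear_Blinfun_apply[OF has_derivative_bounded_linear[OF smooth_on_has_derivative[OF \<Phi> that]]])
  have contf': "continuous_on N f'"
  proof (rule continuous_on_blinfun_componentwise)
    fix i :: 'e
    have "continuous_on N (\<lambda>x. fder \<Phi> x i)" by (rule smooth_on_continuous_on[OF smooth_on_deriv[OF \<Phi>]])
    then show "continuous_on N (\<lambda>x. blinfun_apply (f' x) i)"
      by (rule continuous_on_eq) (simp add: f')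
  qed
  have fid: "f' x0 = id_blinfun" by (rule blinfun_eqI) (simp add: f'[OF N(2)] id)
  obtain U' V h h' where UV: "open U'" "U' \<subseteq> N" "x0 \<in> U'" "open V" "\<Phi> x0 \<in> V" "homeomorphism U' V \<Phi> h"
    and h': "\<And>y. y \<in> V \<Longrightarrow> (h has_derivative (h' y)) (at y)"
    and h'inv: "\<And>y. y \<in> V \<Longrightarrow> h' y = inv_into UNIV (blinfun_apply (f' (h y)))"
    and bij: "\<And>y. y \<in> V \<Longrightarrow> bij (blinfun_apply (f' (h y)))"
  proof (rule inverse_function_theorem[OF N(1) _ contf' N(2), of \<Phi> id_blinfun])
    show "(\<Phi> has_derivative blinfun_apply (f' x)) (at x)" if "x \<in> N" for x
      using smooth_on_has_derivative[OF \<Phi> that] by (simp add: f'[OF that])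
    show "id_blinfun o\<^sub>L f' x0 = id_blinfun" by (rule blinfun_eqI) (simp add: fid)
  qed blast
  have hV: "h y \<in> N" "\<Phi> (h y) = y" if "y \<in> V" for y
    using UV(2,6) that unfolding homeomorphism_def by blast+
  have h0: "h (\<Phi> x0) = x0" using UV(3,6) unfolding homeomorphism_def by blast
  define y0 where "y0 = \<Phi> x0"
  have fh: "fder h y = h' y" if "y \<in> V" for y by (rule fder_eqI[OF h'[OF that]])
  have left: "fder h y (fder \<Phi> (h y) w) = w" if "y \<in> V" for y w
    using inv_f_f[OF bij_is_inj[OF bij[OF that]]] f'[OF hV(1)[OF that]] by (simp add: fh[OF that] h'inv[OF that])
  have right: "blinfun_apply (f' (h y)) (fder h y w) = w" if "y \<in> V" for y w
    using surj_f_inv_f[OF bij_is_surj[OF bij[OF that]]] by (simp add: fh[OF that] h'inv[OF that])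
  have id0: "fder h y0 w = w" for w
    using left[of y0 w] UV(5) by (simp add: y0_def h0 id)
  have hder: "(h has_derivative fder h y) (at y)" if "y \<in> V" for y using h'[OF that] fh[OF that] by simp
  have hcont: "isCont h y0" using hder UV(5) has_derivative_continuous unfolding y0_def by blast
  have "isCont f' x0" using contf' N by (simp add: continuous_on_eq_continuous_at)
  then have f'cont: "isCont (\<lambda>y. f' (h y)) y0"
    using isCont_o2[OF hcont, of f'] by (simp add: y0_def h0)
  have evV: "\<forall>\<^sub>F y in nhds y0. y \<in> V" using UV(4,5) unfolding y0_def by (rule eventually_nhds_in_open)
  have cont: "isCont (\<lambda>y. fder h y w) y0" for w
    unfolding isCont_def id0
  proof (rule tendstoI)
    fix e :: real assume e: "e > 0"
    \<comment> \<open>If D\<Phi>(h(y)) is within \<open>d\<close> of the identity, then |w - u|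
      \<le> d |u| for u = Dh(y) w. The bound 1/2 turns this into |u| \<le> 2 |w|, and the other
      bound makes 2 d |w| smaller than \<open>e\<close>.\<close>
    define d where "d = min (1/2) (e / (2 * (norm w + 1)))"
    have nw: "norm w + 1 > 0" by (simp add: add_nonneg_pos)
    have d: "d > 0" "d \<le> 1/2" using e nw unfolding d_def by (simp, intro min.cobounded1)
    have "d * (2 * (norm w + 1)) \<le> e / (2 * (norm w + 1)) * (2 * (norm w + 1))"
      using nw unfolding d_def by (intro mult_right_mono) auto
    moreover have "e / (2 * (norm w + 1)) * (2 * (norm w + 1)) = e" using nw by simp
    moreover have "d * (2 * (norm w + 1)) = 2 * d * norm w + 2 * d" by (simp add: algebra_simps)
    ultimately have de: "2 * d * norm w < e" using d by linarith
    have "\<forall>\<^sub>F y in nhds y0. dist (f' (h y)) id_blinfun < d"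
      using isCont_eventually_nhds[OF f'cont, of "\<lambda>T. dist T id_blinfun < d"] d
        eventually_nhds_in_open[of "ball id_blinfun d" "f' (h y0)"]
      by (simp add: y0_def h0 fid dist_commute)
    with evV have "\<forall>\<^sub>F y in nhds y0. dist (fder h y w) w < e"
    proof eventually_elim
      case (elim y)
      let ?u = "fder h y w"
      have "norm (w - ?u) = norm (blinfun_apply (f' (h y) - id_blinfun) ?u)"
        using right[OF elim(1)] by (simp add: minus_blinfun.rep_eq)
      also have "\<dots> \<le> norm (f' (h y) - id_blinfun) * norm ?u" by (rule norm_blinfun)
      also have "\<dots> \<le> d * norm ?u" using elim(2) by (intro mult_right_mono) (auto simp: dist_norm)
      finally have 1: "norm (w - ?u) \<le> d * norm ?u" .
      have "norm ?u \<le> norm w + norm (w - ?u)" using norm_triangle_ineq4[of w "w - ?u"] by simp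
      moreover have "d * norm ?u \<le> 1/2 * norm ?u" using d by (intro mult_right_mono) auto
      ultimately have "norm ?u \<le> 2 * norm w" using 1 by linarith
      then have "d * norm ?u \<le> d * (2 * norm w)" using d by (intro mult_left_mono) auto
      then show ?case using 1 de by (simp add: dist_norm norm_minus_commute)
    qed
    then show "\<forall>\<^sub>F y in at y0. dist (fder h y w) w < e"
      by (auto simp: eventually_at_filter elim: eventually_mono)
  qed
  have diff: "(\<lambda>y. fder h y w) differentiable (at y0)" for w
  proof -
    \<comment> \<open>The coordinates of the argument that vanishes at \<open>y0\<close>.\<close>
    define \<beta> where "\<beta> = (\<lambda>y b. (w - fder \<Phi> (h y) w) \<bullet> b)"
    have dB: "((\<lambda>y. fder \<Phi> (h y) w) has_derivative (\<lambda>v. fder (\<lambda>x. fder \<Phi> x w) (h y0) (fder h y0 v))) (at y0)"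
      by (rule has_derivative_compose[OF hder smooth_on_has_derivative[OF smooth_on_deriv[OF \<Phi>]]])
        (use UV(5) hV in \<open>auto simp: y0_def\<close>)
    have \<beta>: "((\<lambda>y. \<beta> y b) has_derivative (\<lambda>v. (0 - fder (\<lambda>x. fder \<Phi> x w) (h y0) (fder h y0 v)) \<bullet> b)) (at y0)" for b
      unfolding \<beta>_def by (intro has_derivative_inner_left has_derivative_diff has_derivative_const dB)
    have \<beta>0: "\<beta> y0 b = 0" for b by (simp add: \<beta>_def y0_def h0 id)
    have "((\<lambda>y. w + (\<Sum>b\<in>Basis. \<beta> y b *\<^sub>R fder h y b)) has_derivative
        (\<lambda>v. 0 + (\<Sum>b\<in>Basis. ((0 - fder (\<lambda>x. fder \<Phi> x w) (h y0) (fder h y0 v)) \<bullet> b) *\<^sub>R fder h y0 b))) (at y0)"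
      by (intro has_derivative_add has_derivative_const has_derivative_sum has_derivative_scaleR_vanishing \<beta> \<beta>0 cont)
    then have "(\<lambda>y. w + (\<Sum>b\<in>Basis. \<beta> y b *\<^sub>R fder h y b)) differentiable (at y0)" by (rule differentiableI)
    moreover have "\<forall>\<^sub>F y in nhds y0. w + (\<Sum>b\<in>Basis. \<beta> y b *\<^sub>R fder h y b) = fder h y w"
      using evV
    proof (rule eventually_mono)
      fix y assume y: "y \<in> V"
      have lin: "linear (fder h y)" by (rule has_derivative_linear[OF hder[OF y]])
      have 1: "fder h y (w - fder \<Phi> (h y) w) = (\<Sum>b\<in>Basis. \<beta> y b *\<^sub>R fder h y b)"
        by (rule linear_coords[OF lin]) (simp add: \<beta>_def euclidean_representation)
      have 2: "fder h y (w - fder \<Phi> (h y) w) = fder h y w - w"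
        using left[OF y] linear_diff[OF lin] by simp
      show "w + (\<Sum>b\<in>Basis. \<beta> y b *\<^sub>R fder h y b) = fder h y w"
        using trans[OF sym[OF 1] 2] by simp
    qed
    ultimately show ?thesis by (rule differentiable_eventually_cong)
  qed
  show thesis
    by (rule that[of V h]) (use UV hV h0 hder diff in \<open>auto simp: y0_def\<close>)
qed

text \<open>Near \<open>\<Phi> x0\<close> the map \<open>f\<close> is
  \<open>\<Psi> \<circ> h\<close> with \<open>h\<close> the local inverse of \<open>\<Phi>\<close>.
  The product rule for linear families differentiates D\<Psi>(h(y)) (Dh(y) w) once more.\<close>

lemma twice_differentiable_at_factor:
  fixes \<Phi> :: "'e::euclidean_space \<Rightarrow> 'e" and f :: "'e \<Rightarrow> 'f::real_normed_vector"
  assumes N: "open N" "x0 \<in> N" and \<Phi>: "smooth_on N \<Phi>" and id: "\<And>v. fder \<Phi> x0 v = v"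
    and \<Psi>: "smooth_on N \<Psi>" and f: "\<And>v. v \<in> N \<Longrightarrow> f (\<Phi> v) = \<Psi> v"
  shows "twice_differentiable_at f (\<Phi> x0)"
proof -
  obtain V h where V: "open V" "\<Phi> x0 \<in> V" and h0: "h (\<Phi> x0) = x0" and hV: "\<And>y. y \<in> V \<Longrightarrow> h y \<in> N \<and> \<Phi> (h y) = y"
    and hd: "\<And>y. y \<in> V \<Longrightarrow> (h has_derivative fder h y) (at y)"
    and hd2: "\<And>w. (\<lambda>y. fder h y w) differentiable (at (\<Phi> x0))"
    using local_inverse_twice_differentiable[OF N \<Phi> id] by blast
  have \<Psi>d: "(\<Psi> has_derivative fder \<Psi> (h y)) (at (h y))" if "y \<in> V" for y
    using smooth_on_has_derivative[OF \<Psi>] hV[OF that] by blast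
  have ev: "\<forall>\<^sub>F y in nhds z. y \<in> V" if "z \<in> V" for z using V(1) that by (rule eventually_nhds_in_open)
  have fd: "(f has_derivative (\<lambda>w. fder \<Psi> (h y) (fder h y w))) (at y)" if y: "y \<in> V" for y
  proof (rule has_derivative_eventually_cong[OF has_derivative_compose[OF hd[OF y] \<Psi>d[OF y]]])
    show "\<forall>\<^sub>F y in nhds y. \<Psi> (h y) = f y"
      using ev[OF y] by (rule eventually_mono) (use hV f in metis)
  qed
  have "(\<lambda>y. fder f y w) differentiable (at (\<Phi> x0))" for w
  proof -
    have lin: "\<forall>\<^sub>F y in nhds (\<Phi> x0). linear (fder \<Psi> (h y))"
      using ev[OF V(2)] by (rule eventually_mono) (rule has_derivative_linear[OF \<Psi>d])
    have L: "((\<lambda>y. fder \<Psi> (h y) v) has_derivative (\<lambda>u. fder (\<lambda>x. fder \<Psi> x v) (h (\<Phi> x0)) (fder h (\<Phi> x0) u))) (at (\<Phi> x0))" for v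
      by (rule has_derivative_compose[OF hd[OF V(2)] smooth_on_has_derivative[OF smooth_on_deriv[OF \<Psi>]]])
        (use hV V(2) in blast)
    from has_derivative_linear_family[OF fin_dim_euclidean lin L hd2[unfolded frechet_derivative_works]]
    have "(\<lambda>y. fder \<Psi> (h y) (fder h y w)) differentiable (at (\<Phi> x0))" by (rule differentiableI)
    moreover have "\<forall>\<^sub>F y in nhds (\<Phi> x0). fder \<Psi> (h y) (fder h y w) = fder f y w"
      using ev[OF V(2)] by (rule eventually_mono) (simp add: fder_eqI[OF fd])
    ultimately show ?thesis by (rule differentiable_eventually_cong)
  qed
  moreover have "\<forall>\<^sub>F y in nhds (\<Phi> x0). f differentiable (at y)"
    using ev[OF V(2)] by (rule eventually_mono) (use fd differentiableI in blast)
  ultimately show ?thesis unfolding twice_differentiable_at_def by blast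
qed

text \<open>Differentiate b' = Df(a) a' by the product rule for linear families. The derivatives of
  the image curve enter as data because in the applications they are known from
  equivariance.\<close>

lemma second_derivative_along_curve:
  fixes f :: "'a::real_normed_vector \<Rightarrow> 'b::real_normed_vector" and a :: "real \<Rightarrow> 'a"
  assumes fd: "fin_dim TYPE('a)" and f: "twice_differentiable_at f (a t)"
    and a: "\<forall>\<^sub>F s in nhds t. (a has_vector_derivative a' s) (at s)" "(a' has_vector_derivative a'') (at t)"
    and b: "\<forall>\<^sub>F s in nhds t. ((\<lambda>s. f (a s)) has_vector_derivative b' s) (at s)" "(b' has_vector_derivative b'') (at t)"
  shows "b' t = fder f (a t) (a' t)"
    and "b'' = fder (\<lambda>y. fder f y (a' t)) (a t) (a' t) + fder f (a t) a''"
proof -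
  have at: "(a has_vector_derivative a' t) (at t)" using a(1) by (rule eventually_nhds_x_imp_x)
  have ac: "isCont a t" using at by (rule has_vector_derivative_continuous)
  have fev: "\<forall>\<^sub>F s in nhds t. (f has_derivative fder f (a s)) (at (a s))"
    by (rule isCont_eventually_nhds[OF ac]) (use f in \<open>auto simp: twice_differentiable_at_def frechet_derivative_works elim: eventually_mono\<close>)
  have eq: "\<forall>\<^sub>F s in nhds t. fder f (a s) (a' s) = b' s"
    using a(1) b(1) fev
    by eventually_elim (use has_vector_derivative_compose_fder vector_derivative_unique_at in blast)
  then show "b' t = fder f (a t) (a' t)" using eventually_nhds_x_imp_x[OF eq] by simp
  have lin: "\<forall>\<^sub>F s in nhds t. linear (fder f (a s))" using fev by (rule eventually_mono) (rule has_derivative_linear)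
  have L: "((\<lambda>s. fder f (a s) v) has_derivative (\<lambda>h. fder (\<lambda>y. fder f y v) (a t) (h *\<^sub>R a' t))) (at t)" for v
    by (rule has_derivative_compose[OF at[unfolded has_vector_derivative_def]])
      (use f in \<open>simp add: twice_differentiable_at_def flip: frechet_derivative_works\<close>)
  have "((\<lambda>s. fder f (a s) (a' s)) has_derivative
      (\<lambda>h. fder (\<lambda>y. fder f y (a' t)) (a t) (h *\<^sub>R a' t) + fder f (a t) (h *\<^sub>R a''))) (at t)"
    by (rule has_derivative_linear_family[OF fd lin L a(2)[unfolded has_vector_derivative_def]])
  from fun_cong[OF has_derivative_unique[OF has_derivative_eventually_cong[OF this eq] b(2)[unfolded has_vector_derivative_def]], of 1]
  show "b'' = fder (\<lambda>y. fder f y (a' t)) (a t) (a' t) + fder f (a t) a''"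
    by simp
qed

section \<open>The second fundamental form of a map\<close>

lemma nabla_d_eq:
  "nabla_d C g D h f p v w =
    fder (\<lambda>y. fder (local_rep C D p (f p) f) y w) (chart_map C p p) v
    + christoffel D h (f p) (fder (local_rep C D p (f p) f) (chart_map C p p) v) (fder (local_rep C D p (f p) f) (chart_map C p p) w)
    - fder (local_rep C D p (f p) f) (chart_map C p p) (christoffel C g p v w)"
  by (simp add: nabla_d_def local_rep_def Let_def)

text \<open>For the second derivative, linearity in \<open>w\<close> passes from the first
  derivatives near the point to their derivatives by uniqueness. Bilinearity is what frees the trace
  from the chosen basis.\<close>

lemma nabla_d_bilinear:
  fixes C :: "('m::t2_space, 'e::banach) charts" and D :: "('n::t2_space, 'f::banach) charts"
  assumes C: "riemannian C g" and D: "riemannian D h"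
    and f: "twice_differentiable_at (local_rep C D p (f p) f) (chart_map C p p)"
  shows "bilinear (nabla_d C g D h f p)"
proof -
  interpret C: riemannian C g by fact
  interpret D: riemannian D h by fact
  let ?x = "chart_map C p p" and ?F = "local_rep C D p (f p) f"
  have "\<forall>\<^sub>F y in nhds ?x. (?F has_derivative fder ?F y) (at y)"
    using f unfolding twice_differentiable_at_def frechet_derivative_works by blast
  then have Fd: "\<forall>\<^sub>F y in nhds ?x. linear (fder ?F y)"
    by (rule eventually_mono) (rule has_derivative_linear)
  then have lin: "linear (fder ?F ?x)" by (rule eventually_nhds_x_imp_x)
  have F2: "((\<lambda>y. fder ?F y w) has_derivative fder (\<lambda>y. fder ?F y w) ?x) (at ?x)" for w
    using f unfolding twice_differentiable_at_def frechet_derivative_works by blast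
  have F2l: "linear (\<lambda>v. fder (\<lambda>y. fder ?F y w) ?x v)" for w by (rule has_derivative_linear[OF F2])
  have F2r: "linear (\<lambda>w. fder (\<lambda>y. fder ?F y w) ?x v)" for v
  proof (rule linearI)
    show "fder (\<lambda>y. fder ?F y (w + u)) ?x v = fder (\<lambda>y. fder ?F y w) ?x v + fder (\<lambda>y. fder ?F y u) ?x v" for w u
    proof -
      have "\<forall>\<^sub>F y in nhds ?x. fder ?F y w + fder ?F y u = fder ?F y (w + u)"
        using Fd by (rule eventually_mono) (simp add: linear_add)
      from fder_eqI[OF has_derivative_eventually_cong[OF has_derivative_add[OF F2 F2] this]] show ?thesis by simp
    qed
    show "fder (\<lambda>y. fder ?F y (k *\<^sub>R w)) ?x v = k *\<^sub>R fder (\<lambda>y. fder ?F y w) ?x v" for w k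
    proof -
      have "\<forall>\<^sub>F y in nhds ?x. k *\<^sub>R fder ?F y w = fder ?F y (k *\<^sub>R w)"
        using Fd by (rule eventually_mono) (simp add: linear_scale)
      from fder_eqI[OF has_derivative_eventually_cong[OF has_derivative_scaleR_right[OF F2] this]] show ?thesis by simp
    qed
  qed
  have "linear (nabla_d C g D h f p v)" for v
    unfolding nabla_d_eq
    using linear_compose[OF lin D.christoffel_linear2] linear_compose[OF C.christoffel_linear2 lin]
    by (intro linear_compose_add linear_compose_sub F2r) (simp_all add: o_def)
  moreover have "linear (\<lambda>v. nabla_d C g D h f p v w)" for w
    unfolding nabla_d_eq
    using linear_compose[OF lin D.christoffel_linear1] linear_compose[OF C.christoffel_linear1 lin]
    by (intro linear_compose_add linear_compose_sub F2l) (simp_all add: o_def)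
  ultimately show ?thesis unfolding bilinear_def by blast
qed

text \<open>\<open>second_derivative_along_curve\<close> is solved for the second derivative of
  \<open>f\<close>; the Christoffel terms complete \<open>a''\<close> and \<open>b''\<close> to
  covariant accelerations. What remains involves only the first derivative of
  \<open>f\<close>.\<close>

lemma nabla_d_curve:
  fixes C :: "('m::t2_space, 'e::banach) charts" and D :: "('n::t2_space, 'f::banach) charts"
  assumes C: "smooth_manifold C" and f: "twice_differentiable_at (local_rep C D p (f p) f) (chart_map C p p)"
    and p: "a t = p" and cont: "isCont a (t::real)"
    and a: "\<forall>\<^sub>F s in nhds t. ((\<lambda>s. chart_map C p (a s)) has_vector_derivative a' s) (at s)" "(a' has_vector_derivative a'') (at t)"
    and b: "\<forall>\<^sub>F s in nhds t. ((\<lambda>s. chart_map D (f p) (f (a s))) has_vector_derivative b' s) (at s)" "(b' has_vector_derivative b'') (at t)"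
  shows "fder (local_rep C D p (f p) f) (chart_map C p p) (a' t) = b' t" (is ?A)
    and "nabla_d C g D h f p (a' t) (a' t) = (b'' + christoffel D h (f p) (b' t) (b' t))
      - fder (local_rep C D p (f p) f) (chart_map C p p) (a'' + christoffel C g p (a' t) (a' t))" (is ?B)
proof -
  let ?F = "local_rep C D p (f p) f" and ?al = "\<lambda>s. chart_map C p (a s)"
  have dom: "\<forall>\<^sub>F s in nhds t. a s \<in> chart_dom C p"
    by (rule isCont_eventually_nhds[OF cont]) (use p chart_dom_self[OF C] in \<open>auto intro: eventually_nhds_in_open[OF open_chart_dom[OF C]]\<close>)
  \<comment> \<open>\<open>?F\<close> along the curve agrees with the image curve only while the
    curve stays in the chart. A derivative at \<open>s\<close> needs this near \<open>s\<close>,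
    hence the nested neighbourhoods.\<close>
  have b1: "\<forall>\<^sub>F s in nhds t. ((\<lambda>s. ?F (?al s)) has_vector_derivative b' s) (at s)"
  proof -
    have "\<forall>\<^sub>F s in nhds t. \<forall>\<^sub>F r in nhds s. a r \<in> chart_dom C p"
      using dom by (simp add: eventually_eventually)
    with b(1) show ?thesis
    proof eventually_elim
      case (elim s)
      have "\<forall>\<^sub>F r in nhds s. chart_map D (f p) (f (a r)) = ?F (?al r)"
        using elim(2) by (rule eventually_mono) (simp add: local_rep_map[OF C])
      with elim(1) show ?case unfolding has_vector_derivative_def by (rule has_derivative_eventually_cong)
    qed
  qed
  have f': "twice_differentiable_at ?F (?al t)" using f p by simp
  note s = second_derivative_along_curve[OF manifold_fin_dim[OF C] f' a b1 b(2)]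
  show ?A using s(1) p by simp
  have lin: "linear (fder ?F (chart_map C p p))"
    using f has_derivative_linear eventually_nhds_x_imp_x
    unfolding twice_differentiable_at_def frechet_derivative_works by fast
  show ?B
    unfolding nabla_d_eq linear_add[OF lin] using s p by simp
qed

text \<open>Expand the second slot in \<open>B\<close>, exchange the sums and contract the first
  slot over \<open>A\<close>; symmetry of \<open>g\<close> matches the coefficients.\<close>

lemma orthonormal_trace_eq:
  assumes g: "inner_form g" and A: "orthonormal_set g A" "span A = UNIV" and B: "orthonormal_set g B" "span B = UNIV"
    and \<beta>: "bilinear \<beta>"
  shows "(\<Sum>a\<in>A. \<beta> a a) = (\<Sum>b\<in>B. \<beta> b b)"
proof -
  have l: "linear (\<beta> v)" "linear (\<lambda>v. \<beta> v w)" for v w using \<beta> unfolding bilinear_def by auto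
  have exB: "v = (\<Sum>b\<in>B. g v b *\<^sub>R b)" for v by (rule orthonormal_expansion[OF g B(1)]) (simp add: B)
  have exA: "v = (\<Sum>a\<in>A. g v a *\<^sub>R a)" for v by (rule orthonormal_expansion[OF g A(1)]) (simp add: A)
  have "(\<Sum>a\<in>A. \<beta> a a) = (\<Sum>a\<in>A. \<Sum>b\<in>B. g a b *\<^sub>R \<beta> a b)"
    by (rule sum.cong[OF refl]) (rule linear_coords[OF l(1) exB])
  also have "\<dots> = (\<Sum>b\<in>B. \<Sum>a\<in>A. g b a *\<^sub>R \<beta> a b)"
    by (subst sum.swap) (simp add: inner_form_sym[OF g])
  also have "\<dots> = (\<Sum>b\<in>B. \<beta> b b)"
    by (rule sum.cong[OF refl]) (rule linear_coords[OF l(2) exA, symmetric])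
  finally show ?thesis .
qed

lemma orthonormal_basis_set:
  assumes b: "orthonormal_basis \<beta> V n b"
  shows "inj_on b {1..n}" "orthonormal_set \<beta> (b ` {1..n})" "span (b ` {1..n}) = V"
proof -
  have o: "\<And>i j. i \<in> {1..n} \<Longrightarrow> j \<in> {1..n} \<Longrightarrow> \<beta> (b i) (b j) = (if i = j then 1 else 0)"
    using b unfolding orthonormal_basis_def by blast
  show inj: "inj_on b {1..n}"
  proof (rule inj_onI)
    fix i j assume ij: "i \<in> {1..n}" "j \<in> {1..n}" "b i = b j"
    then have "\<beta> (b i) (b j) = 1" using o[of j j] by simp
    then show "i = j" using o[OF ij(1,2)] by (simp split: if_splits)
  qed
  show "orthonormal_set \<beta> (b ` {1..n})"
    unfolding orthonormal_set_def using o inj by (auto simp: inj_on_eq_iff)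
  show "span (b ` {1..n}) = V" using b unfolding orthonormal_basis_def by blast
qed

lemma orthonormal_basis_expansion:
  assumes "inner_form \<beta>" "orthonormal_basis \<beta> V n b" "x \<in> V"
  shows "x = (\<Sum>i=1..n. \<beta> x (b i) *\<^sub>R b i)"
  using orthonormal_expansion[OF assms(1) orthonormal_basis_set(2)[OF assms(2)], of x]
    orthonormal_basis_set(1,3)[OF assms(2)] assms(3) by (simp add: sum.reindex)

text \<open>The basis in \<open>tension_field\<close> is an arbitrary choice. It is orthonormal
  because \<open>b\<close> witnesses existence, and traces over two orthonormal bases agree.\<close>

lemma tension_field_orthonormal_basis:
  fixes C :: "('m::t2_space, 'e::euclidean_space) charts" and D :: "('n::t2_space, 'f::banach) charts"
  assumes rC: "riemannian C g" and rD: "riemannian D h"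
    and f: "twice_differentiable_at (local_rep C D p (f p) f) (chart_map C p p)"
    and b: "orthonormal_basis (g p) UNIV DIM('e) b"
  shows "tension_field C g D h f p = (\<Sum>i=1..DIM('e). nabla_d C g D h f p (b i) (b i))"
proof -
  interpret riemannian C g by fact
  define c where "c = (SOME b. orthonormal_basis (g p) UNIV DIM('e) b)"
  have c: "orthonormal_basis (g p) UNIV DIM('e) c" unfolding c_def using someI[of "orthonormal_basis (g p) UNIV DIM('e)", OF b] .
  have "(\<Sum>i=1..DIM('e). nabla_d C g D h f p (d i) (d i)) = (\<Sum>v\<in>d ` {1..DIM('e)}. nabla_d C g D h f p v v)"
    if "orthonormal_basis (g p) UNIV DIM('e) d" for d
    using orthonormal_basis_set(1)[OF that] by (simp add: sum.reindex)
  then show ?thesis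
    unfolding tension_field_def c_def[symmetric] Let_def
    using orthonormal_trace_eq[OF inner_form_metric orthonormal_basis_set(2,3)[OF c] orthonormal_basis_set(2,3)[OF b]
        nabla_d_bilinear[OF rC rD f]] b c by simp
qed

section \<open>The tension field\<close>

context isometric_smooth_action
begin

lemma lie_bracket_antisym: "lie_bracket G CG X Z = - lie_bracket G CG Z X"
  by (simp add: lie_bracket_eq)

text \<open>Linearity is read off from skewness: Q([Z, X], u) = - Q(X, [Z, u]) is linear in X for
  every u, and nondegeneracy transfers this to the bracket.\<close>

lemma lie_bracket_linear_left:
  assumes Q: "biinvariant_metric G CG Q"
  shows "linear (\<lambda>X. lie_bracket G CG X Z)"
proof -
  interpret Q: riemannian CG Q
    using Q CG unfolding biinvariant_metric_def by unfold_locales auto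
  note skew = lie_bracket_skew[OF Q]
  have add: "lie_bracket G CG Z (X + Y) = lie_bracket G CG Z X + lie_bracket G CG Z Y" for X Y
  proof (rule inner_form_eqI[OF Q.inner_form_metric[of \<one>]])
    fix u show "Q \<one> (lie_bracket G CG Z (X + Y)) u = Q \<one> (lie_bracket G CG Z X + lie_bracket G CG Z Y) u"
      using skew[of Z "X + Y" u] skew[of Z X u] skew[of Z Y u] by (simp add: Q.metric_simps)
  qed
  have scl: "lie_bracket G CG Z (k *\<^sub>R X) = k *\<^sub>R lie_bracket G CG Z X" for k X
  proof (rule inner_form_eqI[OF Q.inner_form_metric[of \<one>]])
    fix u
    have "Q \<one> (lie_bracket G CG Z (k *\<^sub>R X)) u = - (k * Q \<one> X (lie_bracket G CG Z u))"
      using skew[of Z "k *\<^sub>R X" u] by (simp add: Q.metric_simps)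
    moreover have "Q \<one> X (lie_bracket G CG Z u) = - Q \<one> (lie_bracket G CG Z X) u"
      using skew[of Z X u] by simp
    ultimately show "Q \<one> (lie_bracket G CG Z (k *\<^sub>R X)) u = Q \<one> (k *\<^sub>R lie_bracket G CG Z X) u"
      by (simp add: Q.metric_simps)
  qed
  show ?thesis
    unfolding lie_bracket_antisym[of _ Z] by (rule linearI) (simp_all add: add scl)
qed

text \<open>Up to \<open>\<hh>\<close> the sum is the trace of \<open>X \<mapsto> [X, Z]\<close> on \<open>\<nn>\<close>. It may be computed in a \<open>Q\<close>-orthonormal
  basis instead, where every summand vanishes.\<close>

lemma bracket_trace_zero:
  assumes Q: "biinvariant_metric G CG Q"
    and nn: "\<nn> = orth_complement (Q \<one>) (lie_algebra_of G CG (stabilizer G act p))"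
    and E: "\<And>\<mu>. \<mu> \<in> {1..n} \<Longrightarrow> E \<mu> \<in> \<nn>"
      "orthonormal_basis (g p) (orbit_tangent_space G CG CM act p) n (\<lambda>\<mu>. fld p (E \<mu>))"
  shows "(\<Sum>\<mu>=1..n. g p (fld p (lie_bracket G CG (E \<mu>) Z)) (fld p (E \<mu>))) = 0"
proof -
  interpret Q: riemannian CG Q
    using Q CG unfolding biinvariant_metric_def by unfold_locales auto
  let ?Q = "Q \<one>" and ?A = "\<lambda>X. lie_bracket G CG X Z"
  have linA: "linear ?A" by (rule lie_bracket_linear_left[OF Q])
  define \<epsilon> where "\<epsilon> = (\<lambda>\<mu> X. g p (fld p X) (fld p (E \<mu>)))"
  have \<epsilon>lin: "linear (\<epsilon> \<mu>)" for \<mu>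
    unfolding \<epsilon>_def using linear_compose[OF action_field_linear inner_form_linear(1)[OF inner_form_metric]]
    by (simp add: o_def)
  \<comment> \<open>\<open>X\<close> and its combination of the \<open>E \<mu>\<close> have the same
    action field at \<open>p\<close>. Their difference therefore lies in the isotropy algebra, to
    which \<open>\<nn>\<close> is orthogonal.\<close>
  have perp: "?Q (X - (\<Sum>\<mu>=1..n. \<epsilon> \<mu> X *\<^sub>R E \<mu>)) Y = 0" if Y: "Y \<in> \<nn>" for X Y
  proof -
    let ?R = "X - (\<Sum>\<mu>=1..n. \<epsilon> \<mu> X *\<^sub>R E \<mu>)"
    have "fld p X \<in> orbit_tangent_space G CG CM act p" unfolding orbit_tangent_space_def by blast
    from orthonormal_basis_expansion[OF inner_form_metric E(2) this]
    have "fld p ?R = 0"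
      by (simp add: linear_diff[OF action_field_linear] linear_sum[OF action_field_linear]
          linear_scale[OF action_field_linear] \<epsilon>_def)
    then have "?R \<in> lie_algebra_of G CG (stabilizer G act p)"
      unfolding lie_algebra_of_def using action_field_zero_imp_lie_exp_stabilizer by blast
    then have "?Q Y ?R = 0" using Y unfolding nn orth_complement_def by blast
    then show ?thesis using Q.metric_sym[of \<one> ?R Y] by simp
  qed
  obtain S where S: "orthonormal_set ?Q S" "span S = span (E ` {1..n})"
    using orthonormal_set_exists[OF Q.inner_form_metric, of "E ` {1..n}" \<one>] by blast
  have "subspace \<nn>"
    unfolding nn orth_complement_def by (rule subspaceI) (simp_all add: Q.metric_simps)
  moreover have "E ` {1..n} \<subseteq> \<nn>" using E(1) by blast
  ultimately have "span (E ` {1..n}) \<subseteq> \<nn>" by (rule span_minimal[rotated])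
  then have S_nn: "s \<in> \<nn>" if "s \<in> S" for s using S(2) that span_base by blast
  have E_exp: "E \<mu> = (\<Sum>s\<in>S. ?Q (E \<mu>) s *\<^sub>R s)" if "\<mu> \<in> {1..n}" for \<mu>
  proof (rule orthonormal_expansion[OF Q.inner_form_metric S(1)])
    show "E \<mu> \<in> span S" unfolding S(2) using that by (intro span_base imageI)
  qed
  \<comment> \<open>The \<open>\<epsilon> \<mu>\<close> are the functionals dual to the
    \<open>E \<mu>\<close> modulo the isotropy algebra. After exchanging sums, the inner sum
    represents [s, Z] in terms of the \<open>E \<mu>\<close>, and \<open>perp\<close> replaces it by
    [s, Z] itself in the product with \<open>s\<close>.\<close>
  have "(\<Sum>\<mu>=1..n. \<epsilon> \<mu> (?A (E \<mu>))) = (\<Sum>\<mu>=1..n. \<Sum>s\<in>S. ?Q (E \<mu>) s * \<epsilon> \<mu> (?A s))"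
  proof (rule sum.cong[OF refl])
    fix \<mu> assume \<mu>: "\<mu> \<in> {1..n}"
    have "linear (\<lambda>X. \<epsilon> \<mu> (?A X))" using linear_compose[OF linA \<epsilon>lin] by (simp add: o_def)
    from linear_coords[OF this E_exp[OF \<mu>]]
    show "\<epsilon> \<mu> (?A (E \<mu>)) = (\<Sum>s\<in>S. ?Q (E \<mu>) s * \<epsilon> \<mu> (?A s))" by simp
  qed
  also have "\<dots> = (\<Sum>s\<in>S. ?Q (\<Sum>\<mu>=1..n. \<epsilon> \<mu> (?A s) *\<^sub>R E \<mu>) s)"
    by (subst sum.swap) (simp add: inner_form_sum[OF Q.inner_form_metric] Q.metric_simps mult.commute)
  also have "\<dots> = (\<Sum>s\<in>S. 0)"
  proof (rule sum.cong[OF refl])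
    fix s assume s: "s \<in> S"
    have "?Q (\<Sum>\<mu>=1..n. \<epsilon> \<mu> (?A s) *\<^sub>R E \<mu>) s = ?Q (?A s) s"
      using perp[OF S_nn[OF s], of "?A s"] by (simp add: Q.metric_simps)
    moreover have "?Q (?A s) s = - ?Q (lie_bracket G CG Z s) s"
      by (subst lie_bracket_antisym) (simp add: Q.metric_simps)
    moreover have "?Q (lie_bracket G CG Z s) s = 0"
      using lie_bracket_skew[OF Q, of Z s s] Q.metric_sym[of \<one> s "lie_bracket G CG Z s"] by simp
    ultimately show "?Q (\<Sum>\<mu>=1..n. \<epsilon> \<mu> (?A s) *\<^sub>R E \<mu>) s = 0" by simp
  qed
  finally show ?thesis unfolding \<epsilon>_def by simp
qed

text \<open>The velocity of the orbit curve is the action field along the curve, so the second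
  derivative is that of the field in its own direction.\<close>

lemma act_curve_second_order:
  defines "c \<equiv> \<lambda>X s. lie_exp G CG (s *\<^sub>R X)"
  shows "\<forall>\<^sub>F s in nhds 0. ((\<lambda>s. chart_map CM p (act (c X s) p)) has_vector_derivative
      field_rep p X (chart_map CM p (act (c X s) p))) (at s)"
    and "((\<lambda>s. field_rep p X (chart_map CM p (act (c X s) p))) has_vector_derivative dfield p X (fld p X)) (at 0)"
proof -
  have c: "one_parameter_subgroup G CG X (c X)" unfolding c_def by (rule lie_exp_one_parameter_subgroup)
  have c0: "act (c X 0) p = p" by (simp add: c_def lie_exp_0)
  have "\<forall>\<^sub>F s in nhds 0. act (c X s) p \<in> chart_dom CM p"
    by (rule isCont_eventually_nhds[OF act_curve_isCont[OF c]])
      (use c0 chart_dom_self[OF CM] in \<open>auto intro: eventually_nhds_in_open[OF open_chart_dom[OF CM]]\<close>)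
  then show "\<forall>\<^sub>F s in nhds 0. ((\<lambda>s. chart_map CM p (act (c X s) p)) has_vector_derivative
      field_rep p X (chart_map CM p (act (c X s) p))) (at s)"
    by (rule eventually_mono) (rule act_curve_derivative[OF c])
  have "((\<lambda>s. chart_map CM p (act (c X s) p)) has_vector_derivative fld p X) (at 0)"
    using act_curve_derivative[OF c, of 0 p p] c0 chart_dom_self[OF CM] by (simp add: action_field_eq)
  moreover have "(field_rep p X has_derivative dfield p X) (at (chart_map CM p (act (c X 0) p)))"
    unfolding c0 by (rule smooth_on_has_derivative[OF smooth_field_rep base_im])
  ultimately show "((\<lambda>s. field_rep p X (chart_map CM p (act (c X s) p))) has_vector_derivative dfield p X (fld p X)) (at 0)"
    by (rule has_vector_derivative_compose_fder[rotated])
qed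

text \<open>The covariant acceleration at \<open>p\<close> of s \<mapsto> exp(s X) p, that is, the
  covariant derivative of the action field along itself.\<close>

definition orbit_acceleration :: "'m \<Rightarrow> 'h \<Rightarrow> 'e" where
  "orbit_acceleration p X = dfield p X (fld p X) + christoffel CM g p (fld p X) (fld p X)"

lemma orbit_acceleration_inner:
  "g p (orbit_acceleration p X) (fld p Z) = - g p (fld p (lie_bracket G CG X Z)) (fld p X)"
  unfolding orbit_acceleration_def by (rule action_field_acceleration)

lemma nabla_d_action_field:
  assumes f: "twice_differentiable_at (local_rep CM CM p (\<psi> p) \<psi>) (base p)"
    and eq: "\<And>a. \<psi> (act a p) = act a (\<psi> p)"
  shows "nabla_d CM g CM g \<psi> p (fld p X) (fld p X) = orbit_acceleration (\<psi> p) X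
    - fder (local_rep CM CM p (\<psi> p) \<psi>) (base p) (orbit_acceleration p X)"
proof -
  let ?c = "\<lambda>s. lie_exp G CG (s *\<^sub>R X)"
  have cp: "act (?c 0) x = x" for x by (simp add: lie_exp_0)
  have ct: "isCont (\<lambda>s. act (?c s) p) 0" by (rule act_curve_isCont[OF lie_exp_one_parameter_subgroup])
  \<comment> \<open>Folding with equivariance presents the orbit curve of \<open>\<psi> p\<close> as
    the image under \<open>\<psi>\<close> of the orbit curve of \<open>p\<close> with the same
    \<open>X\<close>.\<close>
  note n = nabla_d_curve(2)[OF CM f cp ct act_curve_second_order[of p X] act_curve_second_order[of "\<psi> p" X, folded eq]]
  show ?thesis
    using n[of g g] unfolding orbit_acceleration_def by (simp add: lie_exp_0 eq flip: action_field_eq)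
qed

end

section \<open>The map along the normal geodesic and near it\<close>

lemma geodesic_in_chart:
  fixes C :: "('m::t2_space, 'e::banach) charts" and t :: real
  assumes C: "smooth_manifold C" and \<gamma>: "is_geodesic C g \<gamma>"
  defines "k \<equiv> \<lambda>s. chart_map C (\<gamma> t) (\<gamma> s)"
  shows "\<forall>\<^sub>F s in nhds t. (k has_vector_derivative vector_derivative k (at s)) (at s)"
    and "((\<lambda>s. vector_derivative k (at s)) has_vector_derivative
      - christoffel C g (\<gamma> t) (velocity C \<gamma> t) (velocity C \<gamma> t)) (at t)"
    and "vector_derivative k (at t) = velocity C \<gamma> t"
    and "isCont \<gamma> t"
proof -
  have sm: "smooth_map vector_space_charts C \<gamma>" using \<gamma> unfolding is_geodesic_def by blast
  let ?I = "\<gamma> -` chart_dom C (\<gamma> t)"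
  have I: "open ?I" "t \<in> ?I"
    using sm open_vimage[OF open_chart_dom[OF C]] chart_dom_self[OF C] unfolding smooth_map_curve by auto
  have k: "smooth_on ?I k" using sm unfolding smooth_map_curve k_def by blast
  show "\<forall>\<^sub>F s in nhds t. (k has_vector_derivative vector_derivative k (at s)) (at s)"
    using eventually_nhds_in_open[OF I] by (rule eventually_mono) (rule smooth_on_velocity(1)[OF I(1) k])
  show v: "vector_derivative k (at t) = velocity C \<gamma> t" by (simp add: velocity_def k_def o_def)
  have "((\<lambda>s. vector_derivative k (at s)) has_vector_derivative vector_derivative (\<lambda>s. vector_derivative k (at s)) (at t)) (at t)"
    by (rule smooth_on_velocity(1)[OF I(1) smooth_on_velocity(2)[OF I(1) k] I(2)])
  moreover have "vector_derivative (\<lambda>s. vector_derivative k (at s)) (at t) = - christoffel C g (\<gamma> t) (velocity C \<gamma> t) (velocity C \<gamma> t)"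
    using \<gamma> unfolding is_geodesic_def Let_def k_def by (simp add: o_def eq_neg_iff_add_eq_0)
  ultimately show "((\<lambda>s. vector_derivative k (at s)) has_vector_derivative
      - christoffel C g (\<gamma> t) (velocity C \<gamma> t) (velocity C \<gamma> t)) (at t)" by simp
  show "isCont \<gamma> t" by (rule smooth_map_isCont[OF sm])
qed

text \<open>\<open>\<psi>\<close> carries \<open>\<gamma>\<close> to the reparametrization
  \<open>\<gamma> \<circ> \<rho>\<close>. As \<open>\<gamma>\<close> has no acceleration, that of
  \<open>\<gamma> \<circ> \<rho>\<close> is \<open>\<rho>''\<close> times the velocity: the part
  quadratic in \<open>\<rho>'\<close> cancels against the Christoffel term.\<close>

lemma nabla_d_geodesic:
  fixes C :: "('m::t2_space, 'e::banach) charts"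
  assumes r: "riemannian C g" and \<gamma>: "is_geodesic C g \<gamma>" and \<rho>: "smooth_on UNIV \<rho>"
    and \<psi>: "\<forall>\<^sub>F s in nhds t. \<psi> (\<gamma> s) = \<gamma> (\<rho> s)"
    and f: "twice_differentiable_at (local_rep C C (\<gamma> t) (\<gamma> (\<rho> t)) \<psi>) (chart_map C (\<gamma> t) (\<gamma> t))"
  shows "fder (local_rep C C (\<gamma> t) (\<gamma> (\<rho> t)) \<psi>) (chart_map C (\<gamma> t) (\<gamma> t)) (velocity C \<gamma> t)
      = vector_derivative \<rho> (at t) *\<^sub>R velocity C \<gamma> (\<rho> t)"
    and "\<exists>l. nabla_d C g C g \<psi> (\<gamma> t) (velocity C \<gamma> t) (velocity C \<gamma> t) = l *\<^sub>R velocity C \<gamma> (\<rho> t)"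
proof -
  interpret riemannian C g by fact
  have \<psi>t: "\<psi> (\<gamma> t) = \<gamma> (\<rho> t)" using \<psi> by (rule eventually_nhds_x_imp_x)
  let ?p = "\<gamma> t" and ?q = "\<gamma> (\<rho> t)" and ?T = "velocity C \<gamma> t" and ?U = "velocity C \<gamma> (\<rho> t)"
  define k where "k = (\<lambda>s. chart_map C ?q (\<gamma> s))"
  define k' where "k' s = vector_derivative k (at s)" for s
  define \<rho>' where "\<rho>' = (\<lambda>s. vector_derivative \<rho> (at s))"
  define \<rho>'' where "\<rho>'' = vector_derivative \<rho>' (at t)"
  have \<rho>1: "(\<rho> has_vector_derivative \<rho>' s) (at s)" for s
    unfolding \<rho>'_def by (rule smooth_on_velocity(1)[OF open_UNIV \<rho>]) simp
  have \<rho>2: "(\<rho>' has_vector_derivative \<rho>'') (at t)"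
    unfolding \<rho>''_def \<rho>'_def
    by (rule smooth_on_velocity(1)[OF open_UNIV smooth_on_velocity(2)[OF open_UNIV \<rho>]]) simp
  have \<rho>c: "isCont \<rho> s" for s using \<rho>1 by (rule has_vector_derivative_continuous)
  note kg = geodesic_in_chart[OF C \<gamma>, of "\<rho> t", folded k_def, folded k'_def]
  have cmp: "((\<lambda>s. h (\<rho> s)) has_vector_derivative \<rho>' s *\<^sub>R h') (at s)"
    if "(h has_vector_derivative h') (at (\<rho> s))" for h :: "real \<Rightarrow> 'e" and h' s
    using has_vector_derivative_compose_fder[OF that[unfolded has_vector_derivative_def] \<rho>1] .
  have b1: "\<forall>\<^sub>F s in nhds t. ((\<lambda>s. chart_map C ?q (\<psi> (\<gamma> s))) has_vector_derivative \<rho>' s *\<^sub>R k' (\<rho> s)) (at s)"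
  proof -
    have "\<forall>\<^sub>F s in nhds t. \<forall>\<^sub>F r in nhds s. \<psi> (\<gamma> r) = \<gamma> (\<rho> r)"
      using \<psi> by (simp add: eventually_eventually)
    with isCont_eventually_nhds[OF \<rho>c kg(1)] show ?thesis
    proof eventually_elim
      case (elim s)
      have "\<forall>\<^sub>F r in nhds s. k (\<rho> r) = chart_map C ?q (\<psi> (\<gamma> r))"
        using elim(2) by (rule eventually_mono) (simp add: k_def)
      with cmp[OF elim(1)] show ?case unfolding has_vector_derivative_def by (rule has_derivative_eventually_cong)
    qed
  qed
  have b2: "((\<lambda>s. \<rho>' s *\<^sub>R k' (\<rho> s)) has_vector_derivative
      \<rho>' t *\<^sub>R (\<rho>' t *\<^sub>R - christoffel C g ?q ?U ?U) + \<rho>'' *\<^sub>R k' (\<rho> t)) (at t)"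
    using \<rho>2 by (intro has_vector_derivative_scaleR cmp kg(2)) (simp add: has_real_derivative_iff_has_vector_derivative)
  have f': "twice_differentiable_at (local_rep C C ?p (\<psi> ?p) \<psi>) (chart_map C ?p ?p)" using f \<psi>t by simp
  note a = geodesic_in_chart[OF C \<gamma>, of t]
  note n = nabla_d_curve[OF C f' refl a(4,1,2) b1[folded \<psi>t] b2]
  show "fder (local_rep C C ?p ?q \<psi>) (chart_map C ?p ?p) ?T = vector_derivative \<rho> (at t) *\<^sub>R ?U"
    using n(1) by (simp add: a(3) kg(3) \<psi>t \<rho>'_def)
  have lin: "linear (fder (local_rep C C ?p ?q \<psi>) (chart_map C ?p ?p))"
    using f has_derivative_linear eventually_nhds_x_imp_x
    unfolding twice_differentiable_at_def frechet_derivative_works by fast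
  have "nabla_d C g C g \<psi> ?p ?T ?T = \<rho>'' *\<^sub>R ?U"
    using n(2)[of g g] by (simp add: a(3) kg(3) \<psi>t linear_0[OF lin] linear_scale[OF christoffel_linear1] linear_scale[OF christoffel_linear2])
  then show "\<exists>l. nabla_d C g C g \<psi> ?p ?T ?T = l *\<^sub>R ?U" by blast
qed

text \<open>Near \<open>\<gamma> t\<close> the map is, in the coordinates \<open>v \<mapsto> a(v) \<cdot> \<gamma>(s(v))\<close> given by a chart of the group and
  the parameter of the geodesic, simply \<open>v \<mapsto> a(v) \<cdot> \<gamma>(\<rho>(s(v)))\<close>.\<close>

lemma equivariant_map_twice_differentiable:
  fixes CM :: "('m::t2_space, 'e::euclidean_space) charts" and CG :: "('g::t2_space, 'h::banach) charts"
  assumes act: "isometric_smooth_action G CG CM act g"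
    and \<gamma>: "smooth_map vector_space_charts CM \<gamma>" and \<rho>: "smooth_on UNIV \<rho>" and J: "open J" "t \<in> J"
    and \<psi>: "\<And>a s. s \<in> J \<Longrightarrow> \<psi> (act a (\<gamma> s)) = act a (\<gamma> (\<rho> s))"
    and basis: "\<And>v. v = (\<Sum>\<mu>\<in>I. g (\<gamma> t) v (action_field G CG CM act (E \<mu>) (\<gamma> t)) *\<^sub>R action_field G CG CM act (E \<mu>) (\<gamma> t))
      + g (\<gamma> t) v (velocity CM \<gamma> t) *\<^sub>R velocity CM \<gamma> t" and fin: "finite I"
  shows "twice_differentiable_at (local_rep CM CM (\<gamma> t) (\<gamma> (\<rho> t)) \<psi>) (chart_map CM (\<gamma> t) (\<gamma> t))"
proof -
  interpret isometric_smooth_action G CG CM act g by fact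
  let ?p = "\<gamma> t" and ?q = "\<gamma> (\<rho> t)" and ?T = "velocity CM \<gamma> t"
  \<comment> \<open>The components of \<open>v\<close> in the frame of \<open>basis\<close> are sent
    to the Lie algebra along the \<open>E \<mu>\<close> by \<open>l1\<close> and to the parameter of
    the geodesic by \<open>l2\<close>. This makes the differential of \<open>\<Phi>\<close> at 0 the
    identity.\<close>
  define l1 where "l1 = (\<lambda>v. e0 + (\<Sum>\<mu>\<in>I. g ?p v (fld ?p (E \<mu>)) *\<^sub>R E \<mu>))"
  define l2 where "l2 = (\<lambda>v. t + g ?p v ?T)"
  have bl: "bounded_linear (\<lambda>v. g ?p v w)" for w
    using inner_form_linear(1)[OF inner_form_metric] by (rule linear_conv_bounded_linear[THEN iffD1])
  have l1s: "smooth_on UNIV l1" unfolding l1_def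
    by (intro smooth_on_add open_UNIV smooth_on_const smooth_on_bounded_linear bounded_linear_sum
        bounded_linear_compose[OF bounded_linear_scaleR_left bl])
  have l2s: "smooth_on UNIV l2" unfolding l2_def
    by (intro smooth_on_add open_UNIV smooth_on_const smooth_on_bounded_linear bl)
  have l0: "l1 0 = e0" "l2 0 = t" by (simp_all add: l1_def l2_def metric_simps)
  \<comment> \<open>Used twice: with the identity as \<open>\<sigma>\<close> for
    \<open>\<Phi>\<close> at \<open>?p\<close>, and with \<open>\<rho>\<close> for
    \<open>\<Psi>\<close> at \<open>?q\<close>.\<close>
  have main: "\<exists>N. open N \<and> 0 \<in> N \<and> smooth_on N (\<lambda>v. act_rep m (l1 v, chart_map CM m (\<gamma> (\<sigma> (l2 v))))) \<and>
      (\<forall>v\<in>N. l1 v \<in> chart_im CG \<one>\<^bsub>G\<^esub> \<and> \<gamma> (\<sigma> (l2 v)) \<in> chart_dom CM m \<and>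
        act (chart_inv CG \<one>\<^bsub>G\<^esub> (l1 v)) (\<gamma> (\<sigma> (l2 v))) \<in> chart_dom CM m)"
    if \<sigma>: "smooth_on UNIV \<sigma>" and m: "\<gamma> (\<sigma> t) = m" for \<sigma> m
  proof -
    have s: "smooth_on UNIV (\<lambda>v. \<sigma> (l2 v))"
      by (rule smooth_on_compose[OF fin_dim_euclidean open_UNIV _ \<sigma> l2s]) simp
    have gc: "continuous_on UNIV \<gamma>" and gs: "smooth_on (\<gamma> -` chart_dom CM m) (\<lambda>s. chart_map CM m (\<gamma> s))"
      using \<gamma> unfolding smooth_map_curve by auto
    have oI: "open (\<gamma> -` chart_dom CM m)" by (rule open_vimage[OF open_chart_dom[OF CM] gc])
    let ?N1 = "(\<lambda>v. \<sigma> (l2 v)) -` (\<gamma> -` chart_dom CM m)"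
    have oN1: "open ?N1" by (rule open_vimage[OF oI smooth_on_continuous_on[OF s]])
    let ?u = "\<lambda>v. (l1 v, chart_map CM m (\<gamma> (\<sigma> (l2 v))))"
    have u2: "smooth_on ?N1 (\<lambda>v. chart_map CM m (\<gamma> (\<sigma> (l2 v))))"
      by (rule smooth_on_compose[OF fin_dim_euclidean oN1 _ gs smooth_on_subset[OF s]]) auto
    have us: "smooth_on ?N1 ?u"
      by (rule smooth_on_Pair[OF oN1 smooth_on_subset[OF l1s] u2]) simp
    let ?N = "?N1 \<inter> ?u -` act_rep_dom m"
    have oN: "open ?N"
      by (rule continuous_open_preimage[OF smooth_on_continuous_on[OF us] oN1 open_act_rep_dom])
    have "smooth_on ?N (\<lambda>v. act_rep m (?u v))"
      by (rule smooth_on_compose[OF fin_dim_pair oN _ smooth_act_rep smooth_on_subset[OF us]]) auto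
    moreover have "0 \<in> ?N" using act_rep_dom_e0[OF base_im[of m]] by (simp add: l0 m chart_dom_self[OF CM])
    moreover have "l1 v \<in> chart_im CG \<one>\<^bsub>G\<^esub> \<and> \<gamma> (\<sigma> (l2 v)) \<in> chart_dom CM m \<and>
        act (chart_inv CG \<one>\<^bsub>G\<^esub> (l1 v)) (\<gamma> (\<sigma> (l2 v))) \<in> chart_dom CM m" if "v \<in> ?N" for v
    proof -
      have 1: "\<gamma> (\<sigma> (l2 v)) \<in> chart_dom CM m" and 2: "?u v \<in> act_rep_dom m" using that by simp_all
      show ?thesis using 1 2 by (simp add: act_rep_dom_def chart_inv_map[OF CM 1])
    qed
    ultimately show ?thesis using oN by blast
  qed
  define \<Phi> where "\<Phi> = (\<lambda>v. act_rep ?p (l1 v, chart_map CM ?p (\<gamma> (l2 v))))"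
  define \<Psi> where "\<Psi> = (\<lambda>v. act_rep ?q (l1 v, chart_map CM ?q (\<gamma> (\<rho> (l2 v)))))"
  obtain N1 where N1: "open N1" "0 \<in> N1" "smooth_on N1 \<Phi>" and
    N1': "\<And>v. v \<in> N1 \<Longrightarrow> l1 v \<in> chart_im CG \<one>\<^bsub>G\<^esub> \<and> \<gamma> (l2 v) \<in> chart_dom CM ?p \<and> act (chart_inv CG \<one>\<^bsub>G\<^esub> (l1 v)) (\<gamma> (l2 v)) \<in> chart_dom CM ?p"
    using main[OF smooth_on_id refl] unfolding \<Phi>_def by blast
  obtain N2 where N2: "open N2" "0 \<in> N2" "smooth_on N2 \<Psi>" and
    N2': "\<And>v. v \<in> N2 \<Longrightarrow> \<gamma> (\<rho> (l2 v)) \<in> chart_dom CM ?q"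
    using main[OF \<rho> refl] unfolding \<Psi>_def by blast
  define N where "N = N1 \<inter> N2 \<inter> l2 -` J"
  have N: "open N" "0 \<in> N"
    unfolding N_def using N1 N2 J open_vimage[OF J(1) smooth_on_continuous_on[OF l2s]] by (auto simp: l0)
  have \<Phi>0: "\<Phi> 0 = base ?p" by (simp add: \<Phi>_def l0 act_rep_e0[OF base_im])
  have "fder \<Phi> 0 v = v" for v
  proof -
    have d1: "(l1 has_derivative (\<lambda>v. 0 + (\<Sum>\<mu>\<in>I. g ?p v (fld ?p (E \<mu>)) *\<^sub>R E \<mu>))) (at 0)"
      unfolding l1_def
      by (intro has_derivative_add has_derivative_const has_derivative_sum has_derivative_scaleR_left
          bounded_linear_imp_has_derivative bl)
    have d2: "(l2 has_derivative (\<lambda>v. 0 + g ?p v ?T)) (at 0)"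
      unfolding l2_def by (intro has_derivative_add has_derivative_const bounded_linear_imp_has_derivative bl)
    have "smooth_on (\<gamma> -` chart_dom CM ?p) (\<lambda>s. chart_map CM ?p (\<gamma> s))" "open (\<gamma> -` chart_dom CM ?p)"
      using \<gamma> open_vimage[OF open_chart_dom[OF CM]] unfolding smooth_map_curve by auto
    from smooth_on_velocity(1)[OF this(2,1), of t]
    have "((\<lambda>s. chart_map CM ?p (\<gamma> s)) has_derivative (\<lambda>h. h *\<^sub>R ?T)) (at (l2 0))"
      by (simp add: chart_dom_self[OF CM] l0 velocity_def o_def has_vector_derivative_def)
    from has_derivative_Pair[OF d1 has_derivative_compose[OF d2 this]]
    have "((\<lambda>v. (l1 v, chart_map CM ?p (\<gamma> (l2 v)))) has_derivative
        (\<lambda>v. ((\<Sum>\<mu>\<in>I. g ?p v (fld ?p (E \<mu>)) *\<^sub>R E \<mu>), g ?p v ?T *\<^sub>R ?T))) (at 0)" by simp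
    moreover have "(act_rep ?p has_derivative fder (act_rep ?p) (e0, base ?p)) (at (l1 0, chart_map CM ?p (\<gamma> (l2 0))))"
      using act_rep_has_derivative[OF act_rep_dom_e0[OF base_im]] by (simp add: l0)
    ultimately have "(\<Phi> has_derivative (\<lambda>v. fder (act_rep ?p) (e0, base ?p)
        ((\<Sum>\<mu>\<in>I. g ?p v (fld ?p (E \<mu>)) *\<^sub>R E \<mu>), g ?p v ?T *\<^sub>R ?T))) (at 0)"
      unfolding \<Phi>_def by (rule has_derivative_compose)
    then have "fder \<Phi> 0 v = fld ?p (\<Sum>\<mu>\<in>I. g ?p v (fld ?p (E \<mu>)) *\<^sub>R E \<mu>) + g ?p v ?T *\<^sub>R ?T"
      by (simp add: fder_eqI fder_act_rep[OF base_im] action_field_eq)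
    also have "\<dots> = v"
      using basis[of v] by (simp add: linear_sum[OF action_field_linear] linear_scale[OF action_field_linear])
    finally show ?thesis .
  qed
  moreover have "local_rep CM CM ?p ?q \<psi> (\<Phi> v) = \<Psi> v" if v: "v \<in> N" for v
  proof -
    have 1: "l1 v \<in> chart_im CG \<one>\<^bsub>G\<^esub>" "\<gamma> (l2 v) \<in> chart_dom CM ?p" "act (chart_inv CG \<one>\<^bsub>G\<^esub> (l1 v)) (\<gamma> (l2 v)) \<in> chart_dom CM ?p"
      "\<gamma> (\<rho> (l2 v)) \<in> chart_dom CM ?q" "l2 v \<in> J"
      using v N1' N2' unfolding N_def by auto
    show ?thesis
      using \<psi>[OF 1(5), of "chart_inv CG \<one>\<^bsub>G\<^esub> (l1 v)"]
      by (simp add: \<Phi>_def \<Psi>_def act_rep_def chart_inv_map[OF CM] 1 local_rep_map[OF CM])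
  qed
  moreover have "smooth_on N \<Phi>" "smooth_on N \<Psi>"
    by (rule smooth_on_subset[OF N1(3)] smooth_on_subset[OF N2(3)]; auto simp: N_def)+
  ultimately show ?thesis
    using twice_differentiable_at_factor[OF N, of \<Phi> \<Psi> "local_rep CM CM ?p ?q \<psi>"] \<Phi>0 by simp
qed

theorem theoremB:
  fixes CM :: "('m::t2_space, 'e::euclidean_space) charts"
    and g :: "'m \<Rightarrow> 'e \<Rightarrow> 'e \<Rightarrow> real"
    and CG :: "('g::t2_space, 'h::banach) charts"
    and G :: "'g monoid"
    and act :: "'g \<Rightarrow> 'm \<Rightarrow> 'm"
    and L :: real
    and \<iota> :: "'m set \<Rightarrow> real"
    and \<gamma> :: "real \<Rightarrow> 'm"
    and H :: "'g set"
    and Q :: "'g \<Rightarrow> 'h \<Rightarrow> 'h \<Rightarrow> real"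
    and \<nn> :: "'h set"
    and n :: nat
    and k :: int
    and r :: "real \<Rightarrow> real"
    and \<psi> :: "'m \<Rightarrow> 'm"
    and t :: real
    and E F :: "nat \<Rightarrow> 'h"
  assumes M: "smooth_manifold CM" "compact (UNIV :: 'm set)" "riemannian_metric CM g"
    and G: "lie_group G CG" "compact (UNIV :: 'g set)"
    and act: "isometric_action G CG CM g act"
    and quotient: "L > 0" "orbit_space_isometry G CM g act L \<iota>"
    and geodesic: "normal_geodesic G CG CM g act \<gamma>"
      "\<iota> (orbit G act (\<gamma> 0)) = 0" "\<iota> (orbit G act (\<gamma> L)) = L"
    and weyl: "finite (carrier (weyl_group G act \<gamma>))"
    and isotropy: "\<And>s. (\<forall>i::int. s \<noteq> of_int i * L) \<Longrightarrow> stabilizer G act (\<gamma> s) = H"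
    and Q: "biinvariant_metric G CG Q"
    and nn: "\<nn> = orth_complement (Q \<one>\<^bsub>G\<^esub>) (lie_algebra_of G CG H)"
    and n: "n = dim \<nn>" "n + 1 = DIM('e)"
    and k: "admissible_degree G act \<gamma> L k"
    and psi: "kr_map G act \<gamma> L k r \<psi>"
    and t: "0 < t" "t < L"
    and E: "\<And>\<mu>. \<mu> \<in> {1..n} \<Longrightarrow> E \<mu> \<in> \<nn>"
      "orthonormal_basis (g (\<gamma> t)) (orbit_tangent_space G CG CM act (\<gamma> t)) n
         (\<lambda>\<mu>. action_field G CG CM act (E \<mu>) (\<gamma> t))"
    and F: "\<And>\<nu>. \<nu> \<in> {1..n} \<Longrightarrow> F \<nu> \<in> \<nn>"
      "orthonormal_basis (g (\<gamma> (r t))) (orbit_tangent_space G CG CM act (\<gamma> (r t))) n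
         (\<lambda>\<nu>. action_field G CG CM act (F \<nu>) (\<gamma> (r t)))"
  shows "orbit_tangential_part G CG CM g act (\<gamma> (r t)) (tension_field CM g CM g \<psi> (\<gamma> t)) =
    - (\<Sum>\<mu>=1..n. \<Sum>\<nu>=1..n.
         g (\<gamma> (r t)) (action_field G CG CM act (lie_bracket G CG (E \<mu>) (F \<nu>)) (\<gamma> (r t)))
                       (action_field G CG CM act (E \<mu>) (\<gamma> (r t)))
         *\<^sub>R action_field G CG CM act (F \<nu>) (\<gamma> (r t)))"
proof -
  have "carrier G = UNIV" using G(1) unfolding lie_group_def by blast
  then have "isometric_smooth_action G CG CM act g"
    using act G(1) M(1,3) unfolding isometric_action_def
    by (intro isometric_smooth_action.intro smooth_action.intro lie_grp.intro smooth_action_axioms.intro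
        riemannian.intro isometric_smooth_action_axioms.intro) auto
  then interpret isometric_smooth_action G CG CM act g .
  let ?p = "\<gamma> t" and ?q = "\<gamma> (r t)"
  let ?T = "velocity CM \<gamma> t" and ?U = "velocity CM \<gamma> (r t)"
  have geo: "is_geodesic CM g \<gamma>" and unit: "g (\<gamma> s) (velocity CM \<gamma> s) (velocity CM \<gamma> s) = 1"
    and normal: "g (\<gamma> s) (velocity CM \<gamma> s) (action_field G CG CM act X (\<gamma> s)) = 0" for s X
    using geodesic(1) unfolding normal_geodesic_def orbit_tangent_space_def by auto
  have rM: "riemannian CM g" by unfold_locales
  \<comment> \<open>\<open>r\<close> is constrained only on [0, L]; its smooth extension can be
    differentiated on the whole line and agrees with \<open>r\<close> near \<open>t\<close>.\<close>
  obtain \<rho> where \<rho>: "smooth_on UNIV \<rho>" "\<And>s. s \<in> {0..L} \<Longrightarrow> \<rho> s = r s"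
    using psi unfolding kr_map_def by blast
  have \<rho>t: "\<rho> t = r t" using \<rho>(2) t by simp
  have equiv: "\<psi> (act a (\<gamma> s)) = act a (\<gamma> (\<rho> s))" if "s \<in> {0<..<L}" for a s
    using psi \<rho>(2)[of s] that unfolding kr_map_def by simp
  have J: "open {0<..<L}" "t \<in> {0<..<L}" using t by auto
  have \<psi>p: "\<psi> ?p = ?q" using equiv[OF J(2), of "\<one>\<^bsub>G\<^esub>"] \<rho>t by simp
  \<comment> \<open>Index \<open>n + 1\<close>, which is \<open>DIM('e)\<close>, receives the
    velocity of the geodesic.\<close>
  define b where "b = (\<lambda>i. if i \<le> n then fld ?p (E i) else ?T)"
  have b: "orthonormal_basis (g ?p) UNIV DIM('e) b"
  proof -
    have on: "g ?p (b i) (b j) = (if i = j then 1 else 0)" if "i \<in> {1..DIM('e)}" "j \<in> {1..DIM('e)}" for i j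
    proof -
      have Eon: "g ?p (fld ?p (E i)) (fld ?p (E j)) = (if i = j then 1 else 0)"
        if "i \<in> {1..n}" "j \<in> {1..n}" for i j
        using E(2) that unfolding orthonormal_basis_def by blast
      have normal': "g ?p (fld ?p X) ?T = 0" for X using normal metric_sym by metis
      show ?thesis
        using that n(2) by (cases "i \<le> n"; cases "j \<le> n") (auto simp: b_def Eon normal normal' unit)
    qed
    have inj: "inj_on b {1..DIM('e)}"
      by (rule inj_onI) (metis on zero_neq_one)
    \<comment> \<open>Orthonormality gives independence, and \<open>DIM('e)\<close> independent
      vectors span.\<close>
    have "independent (b ` {1..DIM('e)})"
      unfolding independent_explicit_finite_subsets
    proof (intro allI impI ballI)
      fix A u v assume A: "A \<subseteq> b ` {1..DIM('e)}" "finite A" "(\<Sum>v\<in>A. u v *\<^sub>R v) = 0" and v: "v \<in> A"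
      have "0 = g ?p (\<Sum>v\<in>A. u v *\<^sub>R v) v" using A(3) by (simp add: metric_simps)
      also have "\<dots> = (\<Sum>w\<in>A. u w * g ?p w v)"
        by (simp add: inner_form_sum[OF inner_form_metric] metric_simps)
      also have "\<dots> = (\<Sum>w\<in>A. if w = v then u w else 0)"
      proof (rule sum.cong[OF refl])
        fix w assume w: "w \<in> A"
        obtain i j where "i \<in> {1..DIM('e)}" "j \<in> {1..DIM('e)}" "w = b i" "v = b j" using A(1) v w by blast
        then show "u w * g ?p w v = (if w = v then u w else 0)"
          using on inj by (auto simp: inj_on_eq_iff)
      qed
      also have "\<dots> = u v" using A(2) v by simp
      finally show "u v = 0" by simp
    qed
    moreover have "card (b ` {1..DIM('e)}) = DIM('e)" using card_image[OF inj] by simp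
    ultimately have "span (b ` {1..DIM('e)}) = UNIV"
      using card_eq_dim[of "b ` {1..DIM('e)}" UNIV] by auto
    then show ?thesis unfolding orthonormal_basis_def using on by blast
  qed
  have split: "(\<Sum>i=1..DIM('e). h (b i)) = (\<Sum>\<mu>=1..n. h (fld ?p (E \<mu>))) + h ?T" for h :: "'e \<Rightarrow> 'e"
  proof -
    have "(\<Sum>i=1..DIM('e). h (b i)) = (\<Sum>i=1..n. h (b i)) + h (b (Suc n))"
      unfolding n(2)[symmetric] by simp
    also have "(\<Sum>i=1..n. h (b i)) = (\<Sum>\<mu>=1..n. h (fld ?p (E \<mu>)))" by (rule sum.cong) (auto simp: b_def)
    finally show ?thesis by (simp add: b_def)
  qed
  have expand: "v = (\<Sum>\<mu>\<in>{1..n}. g ?p v (fld ?p (E \<mu>)) *\<^sub>R fld ?p (E \<mu>)) + g ?p v ?T *\<^sub>R ?T" for v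
    using orthonormal_basis_expansion[OF inner_form_metric b UNIV_I, of v] split[of "\<lambda>w. g ?p v w *\<^sub>R w"] by simp
  have sm: "smooth_map vector_space_charts CM \<gamma>" using geo unfolding is_geodesic_def by blast
  have F2: "twice_differentiable_at (local_rep CM CM ?p (\<gamma> (\<rho> t)) \<psi>) (chart_map CM ?p ?p)"
    by (rule equivariant_map_twice_differentiable[OF isometric_smooth_action_axioms sm \<rho>(1) J equiv expand]) auto
  then have f: "twice_differentiable_at (local_rep CM CM ?p (\<psi> ?p) \<psi>) (chart_map CM ?p ?p)"
    by (simp add: \<psi>p \<rho>t)
  have ev: "\<forall>\<^sub>F s in nhds t. \<psi> (\<gamma> s) = \<gamma> (\<rho> s)"
    using eventually_nhds_in_open[OF J]
  proof (rule eventually_mono)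
    show "\<psi> (\<gamma> s) = \<gamma> (\<rho> s)" if "s \<in> {0<..<L}" for s using equiv[OF that, of "\<one>\<^bsub>G\<^esub>"] by simp
  qed
  let ?D = "fder (local_rep CM CM ?p ?q \<psi>) (chart_map CM ?p ?p)"
  have linD: "linear ?D"
    using F2 has_derivative_linear eventually_nhds_x_imp_x
    unfolding \<rho>t twice_differentiable_at_def frechet_derivative_works by fast
  obtain l d where l: "nabla_d CM g CM g \<psi> ?p ?T ?T = l *\<^sub>R ?U" and d: "?D ?T = d *\<^sub>R ?U"
    using nabla_d_geodesic[OF rM geo \<rho>(1) ev F2] by (auto simp: \<rho>t)
  have nab: "nabla_d CM g CM g \<psi> ?p (fld ?p X) (fld ?p X) = orbit_acceleration ?q X - ?D (orbit_acceleration ?p X)" for X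
    using nabla_d_action_field[OF f, of X] equiv[OF J(2)] by (simp add: \<psi>p \<rho>t)
  define w where "w = (\<Sum>\<mu>=1..n. orbit_acceleration ?p (E \<mu>))"
  \<comment> \<open>An interior parameter is no integer multiple of \<open>L\<close>, so
    \<open>\<nn>\<close> is the complement of the isotropy algebra at \<open>?p\<close>, as
    \<open>bracket_trace_zero\<close> requires.\<close>
  have "stabilizer G act ?p = H"
  proof (rule isotropy, intro allI notI)
    fix i :: int assume i: "t = of_int i * L"
    have "0 < real_of_int i" "real_of_int i < 1"
      using t i quotient(1) by (simp_all add: zero_less_mult_iff)
    then have "0 < i" "i < 1" by (simp_all only: of_int_0_less_iff of_int_less_1_iff)
    then show False by linarith
  qed
  then have nn': "\<nn> = orth_complement (Q \<one>\<^bsub>G\<^esub>) (lie_algebra_of G CG (stabilizer G act ?p))" using nn by simp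
  have "g ?p w (fld ?p Z) = 0" for Z
  proof -
    have "g ?p w (fld ?p Z) = (\<Sum>\<mu>=1..n. - g ?p (fld ?p (lie_bracket G CG (E \<mu>) Z)) (fld ?p (E \<mu>)))"
      unfolding w_def inner_form_sum[OF inner_form_metric] orbit_acceleration_inner ..
    also have "\<dots> = 0" unfolding sum_negf using bracket_trace_zero[OF Q nn' E] by simp
    finally show ?thesis .
  qed
  \<comment> \<open>Being orthogonal to the orbit, \<open>w\<close> has only a component along the
    geodesic, and \<open>?D\<close> maps it to a multiple of \<open>?U\<close>.\<close>
  then have "w = g ?p w ?T *\<^sub>R ?T" using expand[of w] by simp
  then have Dw: "?D w = (g ?p w ?T * d) *\<^sub>R ?U" using linear_scale[OF linD] d by (metis scaleR_scaleR)
  define \<tau> where "\<tau> = tension_field CM g CM g \<psi> ?p"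
  define c where "c = l - g ?p w ?T * d"
  have \<tau>: "\<tau> = (\<Sum>\<mu>=1..n. orbit_acceleration ?q (E \<mu>)) + c *\<^sub>R ?U"
  proof -
    have "\<tau> = (\<Sum>\<mu>=1..n. orbit_acceleration ?q (E \<mu>) - ?D (orbit_acceleration ?p (E \<mu>))) + l *\<^sub>R ?U"
      unfolding \<tau>_def tension_field_orthonormal_basis[where p = ?p, OF rM rM f b] 
      using split[of "\<lambda>v. nabla_d CM g CM g \<psi> ?p v v"] by (simp add: nab l)
    also have "\<dots> = (\<Sum>\<mu>=1..n. orbit_acceleration ?q (E \<mu>)) - ?D w + l *\<^sub>R ?U"
      unfolding w_def by (simp add: sum_subtractf linear_sum[OF linD])
    finally show ?thesis unfolding Dw c_def by (simp add: algebra_simps)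
  qed
  let ?S = "orbit_tangent_space G CG CM act ?q"
  let ?u = "- (\<Sum>\<mu>=1..n. \<Sum>\<nu>=1..n.
      g ?q (fld ?q (lie_bracket G CG (E \<mu>) (F \<nu>))) (fld ?q (E \<mu>)) *\<^sub>R fld ?q (F \<nu>))"
  have sub: "subspace ?S"
    unfolding orbit_tangent_space_def
    by (rule linear_subspace_image[OF action_field_linear subspace_UNIV])
  have uS: "?u \<in> ?S"
    by (intro subspace_neg[OF sub] subspace_sum[OF sub] subspace_scale[OF sub])
      (simp add: orbit_tangent_space_def)
  \<comment> \<open>In the product of \<open>?u\<close> with the field of \<open>F \<kappa>\<close>
    only \<open>\<nu> = \<kappa>\<close> survives. In that of \<open>\<tau>\<close> the multiple of
    \<open>?U\<close> drops out, being normal to the orbit.\<close>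
  have comp: "g ?q (\<tau> - ?u) (fld ?q (F \<kappa>)) = 0" if \<kappa>: "\<kappa> \<in> {1..n}" for \<kappa>
  proof -
    have "g ?q ?u (fld ?q (F \<kappa>)) = - (\<Sum>\<mu>=1..n. \<Sum>\<nu>=1..n.
        g ?q (fld ?q (lie_bracket G CG (E \<mu>) (F \<nu>))) (fld ?q (E \<mu>)) * g ?q (fld ?q (F \<nu>)) (fld ?q (F \<kappa>)))"
      by (simp add: inner_form_sum[OF inner_form_metric] metric_simps)
    also have "\<dots> = - (\<Sum>\<mu>=1..n. \<Sum>\<nu>=1..n.
        if \<nu> = \<kappa> then g ?q (fld ?q (lie_bracket G CG (E \<mu>) (F \<nu>))) (fld ?q (E \<mu>)) else 0)"
      using F(2) \<kappa> unfolding orthonormal_basis_def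
      by (intro arg_cong[where f = uminus] sum.cong refl) auto
    also have "\<dots> = - (\<Sum>\<mu>=1..n. g ?q (fld ?q (lie_bracket G CG (E \<mu>) (F \<kappa>))) (fld ?q (E \<mu>)))"
      using \<kappa> by simp
    also have "\<dots> = g ?q \<tau> (fld ?q (F \<kappa>))"
      unfolding \<tau> inner_form_simps(1)[OF inner_form_metric] inner_form_sum(1)[OF inner_form_metric] orbit_acceleration_inner
      by (simp add: metric_simps normal sum_negf)
    finally show ?thesis by (simp add: metric_simps)
  qed
  \<comment> \<open>The fields of the \<open>F \<nu>\<close> span the tangent space of the orbit at
    \<open>?q\<close>, so \<open>comp\<close> extends to all its vectors.\<close>
  have orth: "g ?q (\<tau> - ?u) v = 0" if v: "v \<in> ?S" for v
  proof -
    have "g ?q (\<tau> - ?u) v = g ?q (\<tau> - ?u) (\<Sum>\<nu>=1..n. g ?q v (fld ?q (F \<nu>)) *\<^sub>R fld ?q (F \<nu>))"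
      using orthonormal_basis_expansion[OF inner_form_metric F(2) v] by simp
    also have "\<dots> = (\<Sum>\<nu>=1..n. g ?q v (fld ?q (F \<nu>)) * g ?q (\<tau> - ?u) (fld ?q (F \<nu>)))"
      unfolding inner_form_sum(2)[OF inner_form_metric] inner_form_simps(6)[OF inner_form_metric] ..
    also have "\<dots> = 0" using comp by (intro sum.neutral) auto
    finally show ?thesis .
  qed
  have "orbit_tangential_part G CG CM g act ?q \<tau> = ?u"
    unfolding orbit_tangential_part_def
  proof (rule the_equality)
    show "?u \<in> ?S \<and> (\<forall>v\<in>?S. g ?q (\<tau> - ?u) v = 0)" using uS orth by blast
    show "u = ?u" if "u \<in> ?S \<and> (\<forall>v\<in>?S. g ?q (\<tau> - u) v = 0)" for u
      by (rule orthogonal_part_unique[OF inner_form_metric sub _ uS _ orth]) (use that in auto)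
  qed
  then show ?thesis unfolding \<tau>_def .
qed

end
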